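(* The restriction of $T$ to $\mathcal{M}_2^2$ is a surjective immersion onto $\mathcal{F}\setminus\left\{\frac{\pm1+i\sqrt3}{2}\right\}$.
   Context: $\mathbb{C}^d[\lambda]$ denotes the complex polynomials in $\lambda$ of degree at most $d$ and $\mathbb{S}^1$ the unit circle. Let $\mathcal{M}_2=\{a\in\mathbb{C}^4[\lambda]\mid a(0)=1,\ \lambda^4\overline{a(\bar\lambda^{-1})}=a(\lambda),\ \lambda^{-2}a(\lambda)\ge0\text{ for }\lambda\in\mathbb{S}^1\}$, and let $\mathcal{M}_2^2$ be the set of $a\in\mathcal{M}_2$ with one double root in $\mathbb{S}^1$ and two simple roots not in $\mathbb{S}^1$. The elements of $\mathcal{M}_2^2$ are exactly $$a(\lambda)=(\lambda-re^{-2i\varphi})(\lambda-r^{-1}e^{-2i\varphi})(\lambda-e^{2i\varphi})^2,\qquad r\in(0,1),\ \varphi\in\mathbb{R}/\pi\mathbb{Z},$$ and $\mathcal{M}_2^2$ is a two-dimensional manifold with coordinates $(r,\varphi)$. For $a\in\mathcal{M}_2^2$ let $\Sigma^\ast=\{(\lambda,\nu)\in(\mathbb{C}\setminus\{0\})\times\mathbb{C}\mid\nu^2+\lambda a(\lambda)=0\}$, $\sigma:(\lambda,\nu)\mapsto(\lambda,-\nu)$, $\rho:(\lambda,\nu)\mapsto(\bar\lambda^{-1},-\bar\lambda^{-3}\bar\nu)$. Let $\tilde\Gamma_a$ be the set of all values $\omega=b(0)$ of polynomials $b\in\mathbb{C}^3[\lambda]$ with $\bar\lambda^3b(\bar\lambda^{-1})=-\overline{b(\lambda)}$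 for which there is a nowhere vanishing function $\mu$ on $\Sigma^\ast$ with $d\ln\mu=\frac{b(\lambda)}{2\nu}d\ln\lambda$ (on the smooth part of $\Sigma^\ast$), $\sigma^\ast\mu=\mu^{-1}$, $\rho^\ast\mu=\bar\mu^{-1}$, and $\mu=f(\lambda)+g(\lambda)\nu$ with holomorphic $f,g:\mathbb{C}\setminus\{0\}\to\mathbb{C}$. Then $\tilde\Gamma_a$ is a lattice in $\mathbb{C}$. Two lattices in $\mathbb{C}$ are called isomorphic if one is obtained from the other by multiplication by a nonzero complex number. $\mathcal{F}$ is the quotient space of $\{\tau\in\mathbb{C}\mid\Im\tau>0,\ |\Re\tau|\le\frac12,\ |\tau|\ge1\}$ by the identifications $-\frac12+iy\sim\frac12+iy$ for $y\ge\frac{\sqrt3}{2}$ and $-x+i\sqrt{1-x^2}\sim x+i\sqrt{1-x^2}$ for $x\in[0,\frac12]$; each lattice is isomorphic to $\mathbb{Z}+\mathbb{Z}\tau$ for a unique $\tau\in\mathcal{F}$. Thus $\mathcal{F}$ is the upper half plane modulo $\mathrm{PSL}(2,\mathbb{Z})$. $T(a)\in\mathcal{F}$ is the unique element $\tau$ such that $\tilde\Gamma_a$ is isomorphic to $\mathbb{Z}+\mathbb{Z}\tau$. That a map to $\mathcal{F}$ is an immersion means that locally it lifts to a smooth map to the upper half plane (here: $\tilde\tau_a$ with $\tilde\Gamma_a$ isomorphic to $\mathbb{Z}+\mathbb{Z}\tilde\tau_a$) whose differential is injective. The two numbers $\frac{\pm1+i\sqrt3}{2}$ represent the same point of $\mathcal{F}$.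 *)

theory Defs
  imports "HOL-Analysis.Analysis" "HOL-Computational_Algebra.Polynomial"
begin

definition M2 :: "complex poly set" where
  "M2 = {a. degree a \<le> 4 \<and> poly a 0 = 1 \<and>
     (\<forall>z. z \<noteq> 0 \<longrightarrow> z ^ 4 * cnj (poly a (inverse (cnj z))) = poly a z) \<and>
     (\<forall>z \<in> sphere 0 1. inverse (z ^ 2) * poly a z \<in> \<real>\<^sub>\<ge>\<^sub>0)}"

definition M22 :: "complex poly set" where
  "M22 = {a \<in> M2. \<exists>\<alpha> \<beta> \<gamma>. \<alpha> \<in> sphere 0 1 \<and> order \<alpha> a = 2 \<and>
     \<beta> \<notin> sphere 0 1 \<and> order \<beta> a = 1 \<and> \<gamma> \<notin> sphere 0 1 \<and> order \<gamma> a = 1 \<and> \<beta> \<noteq> \<gamma>}"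

text \<open>The coordinates \<open>(r, \<phi>)\<close> of the two-dimensional manifold \<open>M22\<close>. The angle is a real number
  here although it only matters modulo \<open>\<pi>\<close>, so the inverses of the restrictions of \<open>M22_param\<close> to
  short intervals of angles are the charts.\<close>

definition M22_coords :: "(real \<times> real) set" where
  "M22_coords = {0<..<1} \<times> UNIV"

definition M22_param :: "real \<times> real \<Rightarrow> complex poly" where
  "M22_param = (\<lambda>(r, \<phi>).
     [:- (of_real r * exp (- 2 * \<i> * of_real \<phi>)), 1:] *
     [:- (inverse (of_real r) * exp (- 2 * \<i> * of_real \<phi>)), 1:] *
     [:- exp (2 * \<i> * of_real \<phi>), 1:] ^ 2)"

definition curve :: "complex poly \<Rightarrow> (complex \<times> complex) set" where
  "curve a = {(x, \<nu>). x \<noteq> 0 \<and> \<nu> ^ 2 + x * poly a x = 0}"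

text \<open>The points at which the differential of \<open>(x, \<nu>) \<mapsto> \<nu>\<^sup>2 + x a(x)\<close> does not vanish.\<close>

definition smooth_part :: "complex poly \<Rightarrow> (complex \<times> complex) set" where
  "smooth_part a =
     {(x, \<nu>) \<in> curve a. (poly (pderiv ([:0, 1:] * a)) x, 2 * \<nu>) \<noteq> (0, 0)}"

definition invol_sigma :: "complex \<times> complex \<Rightarrow> complex \<times> complex" where
  "invol_sigma = (\<lambda>(x, \<nu>). (x, - \<nu>))"

definition invol_rho :: "complex \<times> complex \<Rightarrow> complex \<times> complex" where
  "invol_rho = (\<lambda>(x, \<nu>). (inverse (cnj x), - (inverse (cnj x ^ 3) * cnj \<nu>)))"

text \<open>The identity \<open>d ln \<mu> = b / (2\<nu>) d ln x\<close> of differential forms on the smooth part, expressed by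
  its pullbacks along all holomorphic maps \<open>t \<mapsto> (x t, \<nu> t)\<close> from open subsets of the complex plane to
  the smooth part (in particular along the inverses of local coordinates). At points of the smooth
  part with \<open>\<nu> = 0\<close> the function \<open>x\<close> is branched, the right hand side extends holomorphically, and the
  identity holds there by continuity; so only the holomorphy of the pullback of \<open>\<mu>\<close> is stated there.\<close>

definition dln_eq :: "complex poly \<Rightarrow> complex poly \<Rightarrow> (complex \<times> complex \<Rightarrow> complex) \<Rightarrow> bool" where
  "dln_eq a b \<mu> \<longleftrightarrow> (\<forall>V x \<nu>.
     open V \<and> x holomorphic_on V \<and> \<nu> holomorphic_on V \<and> (\<forall>t\<in>V. (x t, \<nu> t) \<in> smooth_part a) \<longrightarrow>
     (\<lambda>t. \<mu> (x t, \<nu> t)) holomorphic_on V \<and>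
     (\<forall>t\<in>V. \<nu> t \<noteq> 0 \<longrightarrow>
        deriv (\<lambda>t. \<mu> (x t, \<nu> t)) t / \<mu> (x t, \<nu> t) =
        poly b (x t) / (2 * \<nu> t) * (deriv x t / x t)))"

definition admissible ::
  "complex poly \<Rightarrow> complex poly \<Rightarrow> (complex \<times> complex \<Rightarrow> complex) \<Rightarrow> bool" where
  "admissible a b \<mu> \<longleftrightarrow>
     (\<forall>p \<in> curve a. \<mu> p \<noteq> 0) \<and>
     dln_eq a b \<mu> \<and>
     (\<forall>p \<in> curve a. \<mu> (invol_sigma p) = inverse (\<mu> p)) \<and>
     (\<forall>p \<in> curve a. \<mu> (invol_rho p) = inverse (cnj (\<mu> p))) \<and>
     (\<exists>f g. f holomorphic_on - {0} \<and> g holomorphic_on - {0} \<and>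
        (\<forall>(x, \<nu>) \<in> curve a. \<mu> (x, \<nu>) = f x + g x * \<nu>))"

definition Gamma_tilde :: "complex poly \<Rightarrow> complex set" where
  "Gamma_tilde a = {poly b 0 | b.
     degree b \<le> 3 \<and>
     (\<forall>z. z \<noteq> 0 \<longrightarrow> cnj z ^ 3 * poly b (inverse (cnj z)) = - cnj (poly b z)) \<and>
     (\<exists>\<mu>. admissible a b \<mu>)}"

definition std_lattice :: "complex \<Rightarrow> complex set" where
  "std_lattice \<tau> = {of_int m + of_int n * \<tau> | m n. True}"

definition lattice_iso :: "complex set \<Rightarrow> complex set \<Rightarrow> bool" where
  "lattice_iso L L' \<longleftrightarrow> (\<exists>c. c \<noteq> 0 \<and> L' = (\<lambda>z. c * z) ` L)"

definition fund_domain :: "complex set" where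
  "fund_domain = {\<tau>. Im \<tau> > 0 \<and> \<bar>Re \<tau>\<bar> \<le> 1 / 2 \<and> norm \<tau> \<ge> 1}"

definition fund_identifications :: "(complex \<times> complex) set" where
  "fund_identifications =
     {(Complex (- 1 / 2) y, Complex (1 / 2) y) | y. y \<ge> sqrt 3 / 2} \<union>
     {(Complex (- x) (sqrt (1 - x\<^sup>2)), Complex x (sqrt (1 - x\<^sup>2))) | x. 0 \<le> x \<and> x \<le> 1 / 2}"

definition fund_rel :: "(complex \<times> complex) set" where
  "fund_rel = Restr ((fund_identifications \<union> fund_identifications\<inverse>)\<^sup>*) fund_domain"

definition moduli_space :: "complex set set" where
  "moduli_space = fund_domain // fund_rel"

definition moduli_point :: "complex \<Rightarrow> complex set" where
  "moduli_point \<tau> = fund_rel `` {\<tau>}"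

definition T_map :: "complex poly \<Rightarrow> complex set" where
  "T_map a = (THE t. t \<in> moduli_space \<and> (\<exists>\<tau>\<in>t. lattice_iso (Gamma_tilde a) (std_lattice \<tau>)))"

primrec Cn_on ::
  "nat \<Rightarrow> 'a::real_normed_vector set \<Rightarrow> ('a \<Rightarrow> 'b::real_normed_vector) \<Rightarrow> bool" where
  "Cn_on 0 S f \<longleftrightarrow> continuous_on S f"
| "Cn_on (Suc n) S f \<longleftrightarrow> (\<forall>x\<in>S. f differentiable (at x)) \<and>
     (\<forall>v. Cn_on n S (\<lambda>x. frechet_derivative f (at x) v))"

text \<open>For open subsets of finite-dimensional spaces this is the usual notion of smoothness.\<close>

definition smooth_on ::
  "'a::real_normed_vector set \<Rightarrow> ('a \<Rightarrow> 'b::real_normed_vector) \<Rightarrow> bool" where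
  "smooth_on S f \<longleftrightarrow> (\<forall>n. Cn_on n S f)"

text \<open>In the coordinates near the point \<open>a\<close> of \<open>M22\<close>, the map \<open>T_map\<close> lifts to a smooth map into the
  upper half plane with injective differential. That \<open>\<tau> q\<close> is a lift of the value of \<open>T_map\<close> means
  that the lattice which defines this value is isomorphic to \<open>\<int> + \<int> (\<tau> q)\<close>.\<close>

definition T_immersion_at :: "complex poly \<Rightarrow> bool" where
  "T_immersion_at a \<longleftrightarrow> (\<exists>p\<in>M22_coords. M22_param p = a \<and>
     (\<exists>U (\<tau> :: real \<times> real \<Rightarrow> complex). open U \<and> p \<in> U \<and> U \<subseteq> M22_coords \<and> smooth_on U \<tau> \<and>
        (\<forall>q\<in>U. Im (\<tau> q) > 0 \<and>
           lattice_iso (Gamma_tilde (M22_param q)) (std_lattice (\<tau> q)) \<and>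
           inj (frechet_derivative \<tau> (at q)))))"

end

theory Submission
  imports Defs "HOL-Complex_Analysis.Complex_Analysis" "HOL-Real_Asymp.Real_Asymp"
begin

text \<open>Put \<lambda> = e^{-2i\<phi>} e^{2z} and m = (1-r)^2/(4r). The spectral curve becomes \<nu> = 2 e^{-i\<phi>} \<lambda> (\<lambda> - \<gamma>)
  V(z) with V^2 = m - sinh^2 z and the double point \<gamma> = e^{2i\<phi>}, so its periods are elliptic
  integrals that depend on m alone. The branch points are z = \<plusminus> arsinh (sqrt m), the unit circle
  is the imaginary axis, on which V(iy) = d(m,y) = sqrt (m + sin^2 y), and the double point is z =
  2i\<phi>.

  Necessary conditions. Since \<mu> = f + g\<nu> has no zeros, an admissible b vanishes at the double
  point. With the reality condition, this gives d ln \<mu> = (s (sinh^2 z - q)/V + j/V) dz + i t dV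
  with real s, t, j and b(0) = - e^{-i\<phi>} (s + it)/2 (\<open>reality_normal_form\<close>). Here q = q(m) is the
  number for which (sinh^2 z - q)/V has no real period. At the branch points \<mu> = \<plusminus>1, because \<sigma>
  fixes them and inverts \<mu>; comparing the two of them gives j = 0. The loop over the unit circle
  gives s \<Lambda>(m) \<in> 2\<pi> \<int>, and \<mu> = \<plusminus>1 at the double point gives t d(m,\<eta>) - s g(m,\<eta>) \<in> \<pi> \<int>, where \<eta> =
  2\<phi>, i g(m,y) is minus the integral of (sinh^2 z - q)/V from 0 to iy, and \<Lambda>(m) = g(m,\<pi>)
  (\<open>Gamma_subset\<close>).

  Sufficiency. V times the odd solution E of V^2 E' = sinh cosh E + sinh^2 - q is a primitive of
  (sinh^2 z - q)/V; the choice of q makes E holomorphic at both branch points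
  (\<open>elliptic_primitive\<close>). Then \<mu> = exp (V (sE + it)) has even part cosh (V (sE + it)) and odd part
  V times a holomorphic function. The two integrality conditions make both parts periodic in z and
  divisible as required at the double point, so that \<mu> = f(\<lambda>) + g(\<lambda>) \<nu> (\<open>Gamma_superset\<close>). Hence
  \<open>Gamma_tilde\<close> is isomorphic to \<int> + \<int>\<tau> with \<tau>(m,\<eta>) = (- 2 g(m,\<eta>) + 2 i d(m,\<eta>)) / \<Lambda>(m)
  (\<open>Gamma_iso_std_lattice\<close>).

  Immersion. The number e = m - q is a quotient of complete elliptic integrals and satisfies the
  Riccati equation e' = 1/2 + e^2/(2m(1+m)). Because of it, the partial derivatives of g and \<Lambda>
  with respect to m are elementary expressions in e, g, \<Lambda>, d, and the Jacobian of \<tau> is a nonzero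
  multiple of (m - e)(1 + m - e), which is positive as 0 < e < m (\<open>log_deriv_identity\<close>,
  \<open>chart_tau_immersion\<close>). The same relations show that the functions occurring in \<tau> lie in a ring
  that is closed under partial derivatives, so \<tau> is smooth.

  Image. A positive multiple of the same expression is the derivative of Im \<tau> along the curves Re
  \<tau> = const. Along such a curve with Re \<tau> in [-2,0), Im \<tau> therefore increases with m. As m tends
  to 0, \<tau> tends to the circle |\<tau> + 1| = 1, since g, d and \<Lambda> tend to 1 - cos \<eta>, sin \<eta> and 2; as m
  tends to infinity, Im \<tau> tends to infinity (\<open>height_range\<close>). So \<tau> takes exactly the values with
  -2 \<le> Re \<tau> < 0 and |\<tau> + 1| > 1 and their translates by even integers (replacing \<eta> by \<eta> + \<pi>
  replaces \<tau> by \<tau> - 2). Every lattice has such a parameter \<tau> except the hexagonal one, all of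
  whose parameters lie on or inside the translated circles (\<open>region_representative\<close>,
  \<open>fund_domain_in_region\<close>).\<close>

section \<open>Lattices and the moduli space\<close>

lemma lattice_iso_sym: "lattice_iso L L' \<Longrightarrow> lattice_iso L' L"
proof -
  assume "lattice_iso L L'"
  then obtain c where c: "c \<noteq> 0" "L' = (\<lambda>z. c * z) ` L" unfolding lattice_iso_def by blast
  have "inverse c * (c * z) = z" for z using c(1) by simp
  then have "L = (\<lambda>z. inverse c * z) ` L'" unfolding c(2) image_image by (simp only: image_ident)
  then show ?thesis unfolding lattice_iso_def using c(1) by (intro exI[of _ "inverse c"]) auto
qed

lemma lattice_iso_trans: "lattice_iso L M \<Longrightarrow> lattice_iso M N \<Longrightarrow> lattice_iso L N"
proof -
  assume "lattice_iso L M" "lattice_iso M N"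
  then obtain c d where "c \<noteq> 0" "M = (\<lambda>z. c * z) ` L" "d \<noteq> 0" "N = (\<lambda>z. d * z) ` M"
    unfolding lattice_iso_def by blast
  then show ?thesis unfolding lattice_iso_def
    by (intro exI[of _ "d * c"]) (auto simp: image_image mult.assoc)
qed

lemma std_lattice_shift: "std_lattice (\<tau> + of_int j) = std_lattice \<tau>"
proof -
  have "of_int m + of_int n * (\<tau> + of_int j) = of_int (m + n * j) + of_int n * \<tau>"
    "of_int m + of_int n * \<tau> = of_int (m - n * j) + of_int n * (\<tau> + of_int j)" for m n
    by (auto simp: algebra_simps)
  then show ?thesis unfolding std_lattice_def by (auto; metis)
qed

lemma lattice_iso_inversion:
  assumes "\<tau> \<noteq> 0"
  shows "lattice_iso (std_lattice \<tau>) (std_lattice (- inverse \<tau>))"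
  unfolding lattice_iso_def
proof (intro exI[of _ "inverse \<tau>"] conjI)
  have 1: "inverse \<tau> * (of_int m + of_int n * \<tau>) = of_int n + of_int (-m) * (- inverse \<tau>)" for m n
    using assms by (auto simp: algebra_simps)
  have 2: "of_int m + of_int n * (- inverse \<tau>) = inverse \<tau> * (of_int (-n) + of_int m * \<tau>)" for m n
    using assms by (auto simp: algebra_simps)
  show "std_lattice (- inverse \<tau>) = (\<lambda>z. inverse \<tau> * z) ` std_lattice \<tau>"
  proof (intro equalityI subsetI)
    fix x assume "x \<in> std_lattice (- inverse \<tau>)"
    then obtain m n where "x = of_int m + of_int n * (- inverse \<tau>)" unfolding std_lattice_def by blast
    then show "x \<in> (\<lambda>z. inverse \<tau> * z) ` std_lattice \<tau>" unfolding 2 std_lattice_def by blast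
  next
    fix x assume "x \<in> (\<lambda>z. inverse \<tau> * z) ` std_lattice \<tau>"
    then obtain m n where "x = inverse \<tau> * (of_int m + of_int n * \<tau>)" unfolding std_lattice_def by blast
    then show "x \<in> std_lattice (- inverse \<tau>)" unfolding 1 std_lattice_def by blast
  qed
qed (use assms in auto)

lemma std_lattice_coordinates_unique:
  fixes a b c d :: int
  assumes "Im \<tau> \<noteq> 0" "of_int a + of_int b * \<tau> = of_int c + of_int d * \<tau>"
  shows "a = c \<and> b = d"
proof -
  have "real_of_int b * Im \<tau> = real_of_int d * Im \<tau>" using arg_cong[OF assms(2), of Im] by simp
  then have "b = d" using assms(1) by simp
  then show ?thesis using assms(2) by simp
qed

text \<open>An isomorphism of lattices maps a basis to a basis, so it is given by an integer matrix of
  determinant \<open>\<plusminus>1\<close>. The sign is positive because both bases \<open>(1, \<tau>)\<close> and \<open>(1, \<tau>')\<close> are positively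
  oriented.\<close>

lemma lattice_iso_mobius:
  assumes "Im \<tau> > 0" "Im \<tau>' > 0" "lattice_iso (std_lattice \<tau>) (std_lattice \<tau>')"
  obtains p q r s :: int and c :: complex where
    "c * \<tau> = of_int q + of_int p * \<tau>'" "c = of_int s + of_int r * \<tau>'" "c \<noteq> 0" "p * s - q * r = 1"
proof -
  from assms(3) obtain c where c: "c \<noteq> 0" and L: "std_lattice \<tau>' = (\<lambda>z. c * z) ` std_lattice \<tau>"
    unfolding lattice_iso_def by blast
  have mem: "of_int m + of_int n * \<tau> \<in> std_lattice \<tau>" for m n unfolding std_lattice_def by blast
  have mem': "of_int m + of_int n * \<tau>' \<in> std_lattice \<tau>'" for m n unfolding std_lattice_def by blast
  have "c * \<tau> \<in> std_lattice \<tau>'" unfolding L using mem[of 0 1] by auto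
  then obtain p q where pq: "c * \<tau> = of_int q + of_int p * \<tau>'" unfolding std_lattice_def by blast
  have "c \<in> std_lattice \<tau>'" unfolding L using mem[of 1 0] by (auto intro: rev_image_eqI)
  then obtain r s where rs: "c = of_int s + of_int r * \<tau>'" unfolding std_lattice_def by blast
  have "\<tau>' \<in> (\<lambda>z. c * z) ` std_lattice \<tau>" using mem'[of 0 1] L by auto
  then obtain m n where mn: "\<tau>' = c * (of_int m + of_int n * \<tau>)" unfolding std_lattice_def by blast
  have "1 \<in> (\<lambda>z. c * z) ` std_lattice \<tau>" using mem'[of 1 0] L by auto
  then obtain m' n' where mn': "1 = c * (of_int m' + of_int n' * \<tau>)" unfolding std_lattice_def by blast
  have "of_int 0 + of_int 1 * \<tau>' = of_int m * c + of_int n * (c * \<tau>)" by (subst mn) (simp add: algebra_simps)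
  also have "\<dots> = of_int (m * s + n * q) + of_int (m * r + n * p) * \<tau>'"
    unfolding pq by (subst (1) rs) (simp add: algebra_simps)
  finally have 1: "m * s + n * q = 0" "m * r + n * p = 1"
    using std_lattice_coordinates_unique[of \<tau>'] assms(2) by (metis less_irrefl)+
  have "of_int 1 + of_int 0 * \<tau>' = of_int m' * c + of_int n' * (c * \<tau>)"
    using mn' by (simp add: algebra_simps)
  also have "\<dots> = of_int (m' * s + n' * q) + of_int (m' * r + n' * p) * \<tau>'"
    unfolding pq by (subst (1) rs) (simp add: algebra_simps)
  finally have 2: "m' * s + n' * q = 1" "m' * r + n' * p = 0"
    using std_lattice_coordinates_unique[of \<tau>'] assms(2) by (metis less_irrefl)+
  have "(p * s - q * r) * (n * m' - m * n') = (m * r + n * p) * (m' * s + n' * q) - (m * s + n * q) * (m' * r + n' * p)"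
    by (simp add: algebra_simps)
  also have "\<dots> = 1" using 1 2 by simp
  \<comment> \<open>the product of the two integer matrices is the identity\<close>
  finally have unit: "p * s - q * r = 1 \<or> p * s - q * r = -1"
    using zmult_eq_1_iff by blast
  have "Im \<tau> * (cmod c)\<^sup>2 = Im (c * \<tau> * cnj c)"
    unfolding cmod_power2 by (simp add: algebra_simps power2_eq_square)
  also have "\<dots> = of_int (p * s - q * r) * Im \<tau>'"
    unfolding pq by (subst rs) (simp add: algebra_simps)
  finally have "of_int (p * s - q * r) * Im \<tau>' > 0" using assms(1) c by (metis mult_pos_pos zero_less_norm_iff zero_less_power)
  then have "real_of_int (p * s - q * r) > 0" using assms(2) by (simp only: zero_less_mult_iff) linarith
  then have "p * s - q * r > 0" by (simp only: of_int_0_less_iff)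
  then have "p * s - q * r = 1" using unit by auto
  then show ?thesis using that pq rs c by blast
qed

text \<open>Among the translates of \<open>\<tau>\<close> by integers, one with \<open>\<bar>Re \<tau>\<bar> \<le> 1/2\<close> has minimal modulus.\<close>

lemma norm_shift_eq_1_imp:
  fixes j :: int
  assumes "\<bar>Re \<tau>\<bar> \<le> 1 / 2" "cmod \<tau> \<ge> 1" "cmod (\<tau> + of_int j) \<le> 1"
  shows "cmod \<tau> = 1"
proof -
  have A: "(cmod \<tau>)\<^sup>2 = (Re \<tau>)\<^sup>2 + (Im \<tau>)\<^sup>2" "(cmod (\<tau> + of_int j))\<^sup>2 = (Re \<tau> + j)\<^sup>2 + (Im \<tau>)\<^sup>2"
    by (simp_all add: cmod_power2)
  have "2 * Re \<tau> * j \<ge> - \<bar>real_of_int j\<bar>"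
  proof -
    have "\<bar>2 * Re \<tau> * j\<bar> \<le> 1 * \<bar>real_of_int j\<bar>" unfolding abs_mult using assms(1) by (intro mult_right_mono) auto
    then show ?thesis by linarith
  qed
  moreover have "(real_of_int j)\<^sup>2 \<ge> \<bar>real_of_int j\<bar>"
  proof -
    have "\<bar>j\<bar> * 1 \<le> \<bar>j\<bar> * \<bar>j\<bar>" by (cases "j = 0") (auto intro!: mult_left_mono simp del: abs_mult_self_eq)
    then have "\<bar>j\<bar> \<le> j\<^sup>2" using abs_mult_self_eq[of j] by (simp add: power2_eq_square)
    then show ?thesis by (metis of_int_abs of_int_le_iff of_int_power)
  qed
  ultimately have "(cmod \<tau>)\<^sup>2 \<le> (cmod (\<tau> + of_int j))\<^sup>2" unfolding A by (simp add: power2_sum)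
  also have "(cmod (\<tau> + of_int j))\<^sup>2 \<le> 1\<^sup>2" using assms(3) by (intro power_mono) auto
  finally have "cmod \<tau> \<le> 1" by (rule power2_le_imp_le) simp
  then show ?thesis using assms(2) by simp
qed

lemma fund_domain_Im: "\<tau> \<in> fund_domain \<Longrightarrow> (Im \<tau>)\<^sup>2 \<ge> 3/4"
proof -
  assume "\<tau> \<in> fund_domain"
  then have "(Re \<tau>)\<^sup>2 \<le> 1/4" "(cmod \<tau>)\<^sup>2 \<ge> 1" unfolding fund_domain_def
    using abs_le_square_iff[of "Re \<tau>" "1/2"] one_le_power[of "cmod \<tau>" 2] by (auto simp: power_divide)
  then show ?thesis by (simp add: cmod_power2)
qed

lemma arc_identification:
  assumes "\<tau> \<in> fund_domain" "cmod \<tau> = 1" "\<tau>' \<in> fund_domain" "Im \<tau>' = Im \<tau>" "Re \<tau>' = - Re \<tau>" "Re \<tau> \<ge> 0"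
  shows "(\<tau>', \<tau>) \<in> fund_identifications"
proof -
  have "(Re \<tau>)\<^sup>2 + (Im \<tau>)\<^sup>2 = 1" using assms(2) by (metis cmod_power2 one_power2)
  then have I: "Im \<tau> = sqrt (1 - (Re \<tau>)\<^sup>2)" using assms(1) unfolding fund_domain_def
    by (intro real_sqrt_unique[symmetric]) auto
  have "(\<tau>', \<tau>) = (Complex (- Re \<tau>) (sqrt (1 - (Re \<tau>)\<^sup>2)), Complex (Re \<tau>) (sqrt (1 - (Re \<tau>)\<^sup>2)))"
    using I assms(4,5) by (auto simp: complex_eq_iff)
  moreover have "0 \<le> Re \<tau> \<and> Re \<tau> \<le> 1/2" using assms(1,6) unfolding fund_domain_def by auto
  ultimately show ?thesis unfolding fund_identifications_def by blast
qed

lemma side_identification: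
  assumes "\<tau> \<in> fund_domain" "\<tau>' \<in> fund_domain" "\<tau> = \<tau>' + 1"
  shows "(\<tau>', \<tau>) \<in> fund_identifications"
proof -
  have R: "Re \<tau>' = -1/2" "Re \<tau> = 1/2" using assms unfolding fund_domain_def by auto
  have "sqrt (3/4) \<le> Im \<tau>" using fund_domain_Im[OF assms(1)] assms(1) unfolding fund_domain_def
    by (intro real_le_lsqrt) auto
  then have "sqrt 3 / 2 \<le> Im \<tau>" by (simp add: real_sqrt_divide)
  moreover have "(\<tau>', \<tau>) = (Complex (-1/2) (Im \<tau>), Complex (1/2) (Im \<tau>))" using R assms by (auto simp: complex_eq_iff)
  ultimately show ?thesis unfolding fund_identifications_def by blast
qed

lemma fund_rel_equiv: "equiv fund_domain fund_rel"
proof (rule equivI)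
  show "fund_rel \<subseteq> fund_domain \<times> fund_domain" unfolding fund_rel_def by auto
  show "refl_on fund_domain fund_rel" unfolding fund_rel_def by (auto intro!: refl_onI)
  have "sym ((fund_identifications \<union> fund_identifications\<inverse>)\<^sup>*)"
    by (intro sym_rtrancl) (auto simp: sym_def)
  then show "sym fund_rel" unfolding fund_rel_def sym_def by auto
  show "trans fund_rel" unfolding fund_rel_def trans_def by auto
qed

text \<open>The shortest nonzero vectors of \<open>\<int> + \<int>\<tau>\<close> have length 1 when \<open>\<tau>\<close> is in the fundamental domain.
  Hence the scaling factor \<open>c\<close> has modulus 1 and \<open>Im \<tau> = Im \<tau>'\<close>. The lower left entry \<open>r\<close> of the
  matrix satisfies \<open>\<bar>r\<bar> Im \<tau> \<le> 1\<close>, so it is \<open>0\<close> or \<open>\<plusminus>1\<close>. In the first case \<open>\<tau>\<close> and \<open>\<tau>'\<close> differ by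
  an integer and lie on the two vertical sides unless they agree; in the second case both lie on
  the unit circle.\<close>

lemma fund_rel_of_lattice_iso:
  assumes "\<tau> \<in> fund_domain" "\<tau>' \<in> fund_domain" "lattice_iso (std_lattice \<tau>) (std_lattice \<tau>')"
  shows "(\<tau>, \<tau>') \<in> fund_rel"
proof -
  have I: "Im \<tau> > 0" "Im \<tau>' > 0" using assms unfolding fund_domain_def by auto
  obtain p q r s :: int and c :: complex where c: "c * \<tau> = of_int q + of_int p * \<tau>'"
    "c = of_int s + of_int r * \<tau>'" "c \<noteq> 0" and det: "p * s - q * r = 1"
    by (rule lattice_iso_mobius[OF I assms(3)])
  have inv: "\<tau>' * (p - of_int r * \<tau>) = of_int s * \<tau> - of_int q"
    using c(1) unfolding c(2) by (simp add: algebra_simps)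
  \<comment> \<open>\<open>c\<close> and its inverse are lattice vectors, so both have modulus at least 1\<close>
  have key: "(of_int p - of_int r * \<tau>) * c = 1"
  proof -
    have "(of_int p - of_int r * \<tau>) * c = of_int p * c - of_int r * (c * \<tau>)" by (simp add: algebra_simps)
    also have "\<dots> = of_int (p * s - q * r)" unfolding c(1) by (subst c(2)) (simp add: algebra_simps)
    finally show ?thesis using det by simp
  qed
  \<comment> \<open>no nonzero lattice vector is shorter than 1, because \<open>s\<^sup>2 - \<bar>r s\<bar> + r\<^sup>2\<close> is positive definite\<close>
  have lower: "cmod (of_int s + of_int r * z) \<ge> 1" if "z \<in> fund_domain" "(r::int) \<noteq> 0 \<or> (s::int) \<noteq> 0" for r s z
  proof -
    have z: "\<bar>Re z\<bar> \<le> 1/2" "(cmod z)\<^sup>2 \<ge> 1" using that(1) unfolding fund_domain_def by (auto simp: one_le_power)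
    have "2 * Re z * (r * s) \<ge> - \<bar>real_of_int (r * s)\<bar>"
    proof -
      have "\<bar>2 * Re z * (r * s)\<bar> \<le> 1 * \<bar>real_of_int (r * s)\<bar>" unfolding abs_mult using z(1) by (intro mult_mono) (auto simp: abs_mult)
      then show ?thesis by linarith
    qed
    moreover have "(cmod (of_int s + of_int r * z))\<^sup>2 = s\<^sup>2 + 2 * Re z * (r * s) + r\<^sup>2 * (cmod z)\<^sup>2"
      unfolding cmod_power2 by (simp add: power2_eq_square algebra_simps)
    moreover have "r\<^sup>2 * (cmod z)\<^sup>2 \<ge> r\<^sup>2" using z(2) mult_left_mono[of 1 "(cmod z)\<^sup>2" "real_of_int (r\<^sup>2)"] by simp
    moreover have "s\<^sup>2 - \<bar>r * s\<bar> + r\<^sup>2 \<ge> 1"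
    proof -
      have "2 * (s\<^sup>2 - \<bar>r * s\<bar> + r\<^sup>2) = (\<bar>s\<bar> - \<bar>r\<bar>)\<^sup>2 + s\<^sup>2 + r\<^sup>2"
        by (simp add: power2_diff abs_mult algebra_simps)
      also have "\<dots> = (\<bar>s\<bar> - \<bar>r\<bar>)\<^sup>2 + (s\<^sup>2 + r\<^sup>2)" by simp
      also have "\<dots> > 0" by (rule add_nonneg_pos) (use that(2) in \<open>auto simp: sum_power2_gt_zero_iff\<close>)
      finally have "0 < s\<^sup>2 - \<bar>r * s\<bar> + r\<^sup>2" by (simp only: zero_less_mult_iff) simp
      then show ?thesis by (simp only: int_one_le_iff_zero_less)
    qed
    then have "real_of_int (s\<^sup>2 - \<bar>r * s\<bar> + r\<^sup>2) \<ge> 1" by linarith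
    ultimately have "(cmod (of_int s + of_int r * z))\<^sup>2 \<ge> 1\<^sup>2" by simp
    then show ?thesis by (rule power2_le_imp_le) simp
  qed
  have nz: "r \<noteq> 0 \<or> s \<noteq> 0" "- r \<noteq> 0 \<or> p \<noteq> 0" using det by (metis mult_zero_right mult_zero_left diff_0_right zero_neq_one minus_zero minus_minus)+
  have cn: "cmod c = 1"
  proof -
    have "cmod c \<ge> 1" using lower[OF assms(2) nz(1)] by (subst c(2))
    moreover have "cmod (of_int p - of_int r * \<tau>) \<ge> 1" using lower[OF assms(1) nz(2)] by simp
    moreover have "cmod (of_int p - of_int r * \<tau>) * cmod c = 1" using key by (metis norm_mult norm_one)
    moreover have "1 * cmod c \<le> cmod (of_int p - of_int r * \<tau>) * cmod c"
      using calculation by (intro mult_right_mono) auto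
    ultimately show ?thesis by simp
  qed
  then have cn2: "cmod (of_int p - of_int r * \<tau>) = 1" using key by (metis norm_mult norm_one mult.right_neutral)
  have ImIm: "Im \<tau> = Im \<tau>'"
  proof -
    \<comment> \<open>covolumes of the two lattices\<close>
    have "Im \<tau> * (cmod c)\<^sup>2 = Im (c * \<tau> * cnj c)"
      unfolding cmod_power2 by (simp add: algebra_simps power2_eq_square)
    also have "\<dots> = of_int (p * s - q * r) * Im \<tau>'"
      unfolding c(1) by (subst c(2)) (simp add: algebra_simps)
    finally show ?thesis using cn det by simp
  qed
  have "(\<tau>, \<tau>') \<in> (fund_identifications \<union> fund_identifications\<inverse>)\<^sup>*"
  proof (cases "r = 0")
    case True
    then have ps: "p * s = 1" using det by simp
    then have "(p = 1 \<and> s = 1) \<or> (p = -1 \<and> s = -1)" using zmult_eq_1_iff by blast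
    then obtain j :: int where j: "\<tau> = \<tau>' + of_int j"
    proof
      assume "p = 1 \<and> s = 1" then show ?thesis using that[of q] c True by simp
    next
      assume "p = -1 \<and> s = -1"
      then have "- \<tau> = of_int q - \<tau>'" using c(1) True unfolding c(2) by simp
      then have "- (- \<tau>) = \<tau>' + of_int (- q)" by (simp only:) simp
      then show ?thesis using that[of "- q"] by simp
    qed
    have "\<bar>Re \<tau>\<bar> \<le> 1/2" "\<bar>Re \<tau>'\<bar> \<le> 1/2" using assms(1,2) unfolding fund_domain_def by auto
    moreover have "Re \<tau> = Re \<tau>' + real_of_int j" using j by simp
    ultimately have "\<bar>real_of_int j\<bar> \<le> 1" by linarith
    then have "j = 0 \<or> j = 1 \<or> j = -1" by linarith
    then show ?thesis
    proof (elim disjE)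
      assume "j = 0" then show ?thesis using j by simp
    next
      assume "j = 1" then show ?thesis using j side_identification[OF assms(1,2)] by auto
    next
      assume "j = -1" then show ?thesis using j side_identification[OF assms(2,1)] by auto
    qed
  next
    case False
    have ybig: "(Im \<tau>)\<^sup>2 \<ge> 3/4" using fund_domain_Im assms(1) by blast
    have "(Im c)\<^sup>2 \<le> (cmod c)\<^sup>2" by (simp add: cmod_power2)
    then have "(real_of_int r)\<^sup>2 * (Im \<tau>)\<^sup>2 \<le> 1" using cn ImIm unfolding c(2) by (simp add: power_mult_distrib)
    moreover have "(real_of_int r)\<^sup>2 * (Im \<tau>)\<^sup>2 \<ge> (real_of_int r)\<^sup>2 * (3/4)"
      using ybig by (intro mult_left_mono) auto
    ultimately have "(real_of_int r)\<^sup>2 * (3/4) \<le> 1" by (rule order_trans[rotated])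
    then have "\<bar>real_of_int r\<bar>\<^sup>2 < 2\<^sup>2" by simp
    then have "\<bar>real_of_int r\<bar> < 2" by (rule power2_less_imp_less) simp
    then have r: "r = 1 \<or> r = -1" using False by linarith
    have c1: "cmod \<tau>' = 1"
    proof (rule norm_shift_eq_1_imp)
      show "cmod (\<tau>' + of_int (r * s)) \<le> 1" using r cn unfolding c(2)
        by (auto simp: add.commute) (metis minus_diff_eq norm_minus_cancel order_refl add.commute diff_conv_add_uminus)
    qed (use assms(2) in \<open>auto simp: fund_domain_def\<close>)
    have c2: "cmod \<tau> = 1"
    proof (rule norm_shift_eq_1_imp)
      show "cmod (\<tau> + of_int (- r * p)) \<le> 1" using r cn2
        by (auto simp: add.commute norm_minus_commute) 
    qed (use assms(1) in \<open>auto simp: fund_domain_def\<close>)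
    have "(Re \<tau>)\<^sup>2 = (Re \<tau>')\<^sup>2" using c1 c2 ImIm by (metis cmod_power2 add_right_cancel)
    then consider "Re \<tau> = Re \<tau>'" | "Re \<tau> = - Re \<tau>'" using power2_eq_iff by blast
    then show ?thesis
    proof cases
      case 1 then have "\<tau> = \<tau>'" using ImIm by (simp add: complex_eq_iff)
      then show ?thesis by simp
    next
      case 2
      then show ?thesis using arc_identification[OF assms(1) c2 assms(2)] arc_identification[OF assms(2) c1 assms(1)] ImIm
        by (cases "Re \<tau> \<ge> 0") auto
    qed
  qed
  then show ?thesis unfolding fund_rel_def using assms by auto
qed

text \<open>Both kinds of identification are reflections in the imaginary axis.\<close>

lemma fund_rel_invariants:
  assumes "(\<tau>, \<tau>') \<in> fund_rel"
  shows "Im \<tau> = Im \<tau>' \<and> \<bar>Re \<tau>\<bar> = \<bar>Re \<tau>'\<bar>"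
proof -
  have "(\<tau>, \<tau>') \<in> (fund_identifications \<union> fund_identifications\<inverse>)\<^sup>*" using assms unfolding fund_rel_def by auto
  then show ?thesis
    by (induction rule: rtrancl_induct) (auto simp: fund_identifications_def)
qed

lemma T_map_eq_moduli_point:
  assumes "\<tau> \<in> fund_domain" "lattice_iso (Gamma_tilde a) (std_lattice \<tau>)"
  shows "T_map a = moduli_point \<tau>"
  unfolding T_map_def
proof (rule the_equality)
  have refl: "(\<tau>, \<tau>) \<in> fund_rel" using assms(1) unfolding fund_rel_def by auto
  then show "moduli_point \<tau> \<in> moduli_space \<and> (\<exists>\<tau>'\<in>moduli_point \<tau>. lattice_iso (Gamma_tilde a) (std_lattice \<tau>'))"
    unfolding moduli_space_def moduli_point_def using assms by (auto intro: quotientI)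
next
  fix t assume t: "t \<in> moduli_space \<and> (\<exists>\<tau>\<in>t. lattice_iso (Gamma_tilde a) (std_lattice \<tau>))"
  then obtain \<tau>' where \<tau>': "\<tau>' \<in> t" "lattice_iso (Gamma_tilde a) (std_lattice \<tau>')" by blast
  from t obtain x where x: "t = fund_rel `` {x}" unfolding moduli_space_def by (auto elim: quotientE)
  then have x\<tau>': "(x, \<tau>') \<in> fund_rel" using \<tau>'(1) by simp
  then have F: "\<tau>' \<in> fund_domain" unfolding fund_rel_def by simp
  have "lattice_iso (std_lattice \<tau>) (std_lattice \<tau>')"
    by (rule lattice_iso_trans[OF lattice_iso_sym[OF assms(2)] \<tau>'(2)])
  then have "(\<tau>, \<tau>') \<in> fund_rel" by (rule fund_rel_of_lattice_iso[OF assms(1) F])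
  then show "t = moduli_point \<tau>" unfolding moduli_point_def x
    using equiv_class_eq[OF fund_rel_equiv] x\<tau>' by metis
qed

section \<open>Quartics with a double root on the unit circle\<close>

lemma poly_M22_param:
  "poly (M22_param (r, \<phi>)) z = (z - of_real r * cis (- 2 * \<phi>)) * (z - inverse (of_real r) * cis (- 2 * \<phi>)) * (z - cis (2 * \<phi>))\<^sup>2"
proof -
  have "exp (- 2 * \<i> * of_real \<phi>) = cis (- 2 * \<phi>)" "exp (2 * \<i> * of_real \<phi>) = cis (2 * \<phi>)"
    by (simp_all add: cis_conv_exp mult_ac)
  then show ?thesis unfolding M22_param_def by (simp del: mult_pCons_left mult_pCons_right)
qed

lemma M22_param_eq:
  "M22_param (r, \<phi>) = [:- (of_real r * cis (- 2 * \<phi>)), 1:] * [:- (inverse (of_real r) * cis (- 2 * \<phi>)), 1:] * [:- cis (2 * \<phi>), 1:] ^ 2"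
proof -
  have "exp (- 2 * \<i> * of_real \<phi>) = cis (- 2 * \<phi>)" "exp (2 * \<i> * of_real \<phi>) = cis (2 * \<phi>)"
    by (simp_all add: cis_conv_exp mult_ac)
  then show ?thesis unfolding M22_param_def by simp
qed

lemma M22_param_shift: "M22_param (r, \<phi> + pi * of_int j) = M22_param (r, \<phi>)"
proof -
  have "cis (2 * (\<phi> + pi * of_int j)) = cis (2 * \<phi>)" "cis (- 2 * (\<phi> + pi * of_int j)) = cis (- 2 * \<phi>)"
  proof -
    have "cis (2 * (\<phi> + pi * of_int j)) = cis (2 * \<phi>) * cis (2 * pi * of_int j)"
      by (simp add: cis_mult algebra_simps)
    moreover have "cis (2 * pi * of_int j) = 1" by (rule cis_multiple_2pi) simp
    moreover have "cis (- 2 * (\<phi> + pi * of_int j)) = cis (- 2 * \<phi>) * cis (2 * pi * of_int (-j))"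
      by (simp add: cis_mult algebra_simps)
    moreover have "cis (2 * pi * of_int (-j)) = 1" by (rule cis_multiple_2pi) simp
    ultimately show "cis (2 * (\<phi> + pi * of_int j)) = cis (2 * \<phi>)" "cis (- 2 * (\<phi> + pi * of_int j)) = cis (- 2 * \<phi>)" by simp_all
  qed
  then show ?thesis unfolding M22_param_eq by simp
qed

text \<open>For \<open>\<bar>z\<bar> = 1\<close> the two factors \<open>(z - \<alpha>)\<^sup>2\<close> and \<open>(z - \<beta>) (z - 1 / cnj \<beta>)\<close> are, up to unimodular
  constants and a factor \<open>z\<close> each, squares of absolute values. So the quartic has a constant
  argument on the circle after division by \<open>z\<^sup>2\<close>, and the sign condition fixes this argument.\<close>

lemma quartic_on_circle:
  fixes R :: complex
  assumes r: "r > 0" "R = of_real r" and z: "cmod z = 1" and c: "cmod c = 1" and \<alpha>: "cmod \<alpha> = 1"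
  shows "inverse (z\<^sup>2) * ((z - R * inverse c) * (z - inverse R * inverse c) * (z - \<alpha>)\<^sup>2)
    = \<alpha> * inverse c * of_real ((cmod (z - R * inverse c))\<^sup>2 / r * (cmod (z - \<alpha>))\<^sup>2)"
proof -
  have unit: "cnj w = inverse w" "w \<noteq> 0" if "cmod w = 1" for w
  proof -
    have "w * cnj w = 1" using that by (metis complex_norm_square of_real_1 one_power2)
    then show "cnj w = inverse w" "w \<noteq> 0" by (auto simp: inverse_unique)
  qed
  have R: "R \<noteq> 0" "cnj R = R" using r by auto
  have nsq: "of_real ((cmod w)\<^sup>2) = w * cnj w" for w by (metis complex_norm_square)
  have "of_real ((cmod (z - \<alpha>))\<^sup>2) = (z - \<alpha>) * (inverse z - inverse \<alpha>)"
    unfolding nsq complex_cnj_diff unit(1)[OF z] unit(1)[OF \<alpha>] ..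
  also have "\<dots> = - (z - \<alpha>)\<^sup>2 / (z * \<alpha>)" using unit(2)[OF z] unit(2)[OF \<alpha>]
    by (simp add: field_simps power2_eq_square)
  finally have 1: "of_real ((cmod (z - \<alpha>))\<^sup>2) = - (z - \<alpha>)\<^sup>2 / (z * \<alpha>)" .
  have "of_real ((cmod (z - R * inverse c))\<^sup>2 / r) = (z - R * inverse c) * (inverse z - R * c) / R"
    unfolding of_real_divide nsq complex_cnj_diff complex_cnj_mult complex_cnj_inverse unit(1)[OF z] unit(1)[OF c] R r(2)[symmetric] by simp
  also have "\<dots> = - (c / z) * ((z - R * inverse c) * (z - inverse R * inverse c))"
    using unit(2)[OF z] unit(2)[OF c] R(1) by (simp add: field_simps)
  finally have 2: "of_real ((cmod (z - R * inverse c))\<^sup>2 / r) = - (c / z) * ((z - R * inverse c) * (z - inverse R * inverse c))" .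
  show ?thesis unfolding of_real_mult 1 2 using unit(2)[OF z] unit(2)[OF c] unit(2)[OF \<alpha>]
    by (simp add: divide_simps power2_eq_square)
qed

lemma M22_param_in_M22:
  assumes "0 < r" "r < 1"
  shows "M22_param (r, \<phi>) \<in> M22"
proof -
  let ?a = "M22_param (r, \<phi>)"
  define c where "c = cis (2 * \<phi>)"
  have c0: "c \<noteq> 0" "cnj c = inverse c" "cis (- 2 * \<phi>) = inverse c" "cmod c = 1"
    unfolding c_def by (simp_all add: cis_cnj cis_inverse)
  define R :: complex where "R = of_real r"
  have R0: "R \<noteq> 0" "cnj R = R" "cmod R = r" unfolding R_def using assms by auto
  have P: "poly ?a z = (z - R * inverse c) * (z - inverse R * inverse c) * (z - c)\<^sup>2" for z
    unfolding poly_M22_param c0(3) c_def R_def by simp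
  have E: "?a = [:- (R * inverse c), 1:] * [:- (inverse R * inverse c), 1:] * [:- c, 1:] ^ 2"
    unfolding M22_param_eq c0(3) c_def R_def by simp
  have deg: "degree ?a \<le> 4"
    unfolding E by (intro order_trans[OF degree_mult_le]) (auto simp: power2_eq_square intro!: add_mono order_trans[OF degree_mult_le])
  have at0: "poly ?a 0 = 1" unfolding P using c0 R0 by (simp add: field_simps power2_eq_square)
  have real: "z ^ 4 * cnj (poly ?a (inverse (cnj z))) = poly ?a z" if "z \<noteq> 0" for z
    unfolding P complex_cnj_mult complex_cnj_diff complex_cnj_power complex_cnj_inverse complex_cnj_cnj c0(2) R0(2)
    using that c0(1) R0(1) by (simp add: field_simps power2_eq_square power4_eq_xxxx)
  have pos: "inverse (z\<^sup>2) * poly ?a z \<in> \<real>\<^sub>\<ge>\<^sub>0" if "z \<in> sphere 0 1" for z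
    unfolding P using quartic_on_circle[OF assms(1) R_def, of z c c] that assms c0 by simp
  have n1: "cmod (R * inverse c) = r" "cmod (inverse R * inverse c) = inverse r"
    using R0 c0 by (simp_all add: norm_mult norm_inverse)
  have ri: "inverse r > 1" using assms one_less_inverse by blast
  have ne: "R * inverse c \<noteq> c" "inverse R * inverse c \<noteq> c" "R * inverse c \<noteq> inverse R * inverse c"
    using n1 c0(4) assms ri by (metis less_irrefl, metis less_irrefl, metis less_trans less_irrefl)
  have nz: "[:- (R * inverse c), 1:] * [:- (inverse R * inverse c), 1:] * [:- c, 1:] ^ 2 \<noteq> 0"
    by (simp del: mult_pCons_left mult_pCons_right)
  have ord1: "order x [:- y, 1:] = (if x = y then 1 else 0)" for x y :: complex
    using order_power_n_n[of x 1] by (auto simp: order_0I)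
  have ord: "order x ?a = (if x = R * inverse c then 1 else 0) + (if x = inverse R * inverse c then 1 else 0) + 2 * (if x = c then 1 else 0)" for x
    unfolding E power2_eq_square by (simp add: order_mult ord1 del: mult_pCons_left mult_pCons_right)
  show ?thesis unfolding M22_def M2_def mem_Collect_eq
    using deg at0 real pos ne ri n1 c0(4) assms ord[of c] ord[of "R * inverse c"] ord[of "inverse R * inverse c"]
    by (intro conjI ballI allI impI exI[of _ c] exI[of _ "R * inverse c"] exI[of _ "inverse R * inverse c"]) auto
qed

text \<open>The reality condition pairs the two simple roots by reflection in the circle; the normalisation
  at 0 fixes the leading coefficient, namely \<open>(c / \<alpha>)\<^sup>2\<close> for simple roots of argument \<open>- arg c\<close>,
  and positivity at \<open>- \<alpha>\<close> forces \<open>\<alpha> = c\<close>.\<close>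

lemma M22_imp_param:
  assumes "a \<in> M22"
  obtains r \<phi> where "0 < r" "r < 1" "a = M22_param (r, \<phi>)"
proof -
  from assms have deg: "degree a \<le> 4" and at0: "poly a 0 = 1"
    and real: "\<And>z. z \<noteq> 0 \<Longrightarrow> z ^ 4 * cnj (poly a (inverse (cnj z))) = poly a z"
    and pos: "\<And>z. cmod z = 1 \<Longrightarrow> inverse (z\<^sup>2) * poly a z \<in> \<real>\<^sub>\<ge>\<^sub>0"
    unfolding M22_def M2_def by auto
  from assms obtain \<alpha> \<beta> \<gamma> where ab: "cmod \<alpha> = 1" "order \<alpha> a = 2"
    "cmod \<beta> \<noteq> 1" "order \<beta> a = 1" "cmod \<gamma> \<noteq> 1" "order \<gamma> a = 1" "\<beta> \<noteq> \<gamma>"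
    unfolding M22_def by auto
  have a0: "a \<noteq> 0" using at0 by auto
  have inv: "poly a (inverse (cnj x)) = 0" if "poly a x = 0" for x
  proof -
    have "x \<noteq> 0" using that at0 by auto
    then show ?thesis using real[of x] that by simp
  qed
  have r\<beta>: "poly a \<beta> = 0" and r\<gamma>: "poly a \<gamma> = 0" using ab a0 order_root by force+
  have \<beta>0: "\<beta> \<noteq> 0" using r\<beta> at0 by auto
  have dvd: "[:- \<alpha>, 1:] ^ 2 * ([:- \<beta>, 1:] * [:- \<gamma>, 1:]) dvd a"
  proof -
    have o: "[:- \<alpha>, 1:] ^ 2 dvd a" by (metis ab(2) order_1)
    then obtain u where u: "a = [:- \<alpha>, 1:] ^ 2 * u" by (elim dvdE)
    have ne: "\<beta> \<noteq> \<alpha>" "\<gamma> \<noteq> \<alpha>" using ab by auto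
    have "poly u \<beta> = 0" using r\<beta> ne unfolding u by simp
    then obtain v where v: "u = [:- \<beta>, 1:] * v" by (metis poly_eq_0_iff_dvd dvdE)
    have "poly v \<gamma> = 0" using r\<gamma> ne ab(7) unfolding u v by simp
    then obtain w where w: "v = [:- \<gamma>, 1:] * w" by (metis poly_eq_0_iff_dvd dvdE)
    have "a = [:- \<alpha>, 1:] ^ 2 * ([:- \<beta>, 1:] * [:- \<gamma>, 1:]) * w" unfolding u v w by (simp only: mult_ac)
    then show ?thesis by (rule dvdI)
  qed
  then obtain w where w: "a = [:- \<alpha>, 1:] ^ 2 * ([:- \<beta>, 1:] * [:- \<gamma>, 1:]) * w" by (elim dvdE)
  have "degree a = 4 + degree w"
  proof -
    have "w \<noteq> 0" using w a0 by auto
    then show ?thesis unfolding w by (simp add: degree_mult_eq degree_power_eq del: mult_pCons_left mult_pCons_right)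
  qed
  then have "degree w = 0" using deg by simp
  then obtain l where l: "w = [:l:]" by (elim degree_eq_zeroE)
  have P: "poly a z = l * ((z - \<alpha>)\<^sup>2 * ((z - \<beta>) * (z - \<gamma>)))" for z
    unfolding w l poly_mult poly_power by (simp add: mult_ac)
  \<comment> \<open>the root \<open>\<beta>\<close> is reflected to a simple root off the circle, which can only be \<open>\<gamma>\<close>\<close>
  have \<gamma>: "\<gamma> = inverse (cnj \<beta>)"
  proof -
    have l0: "l \<noteq> 0" using w l a0 by auto
    have "inverse (cnj \<beta>) = \<alpha> \<or> inverse (cnj \<beta>) = \<beta> \<or> inverse (cnj \<beta>) = \<gamma>"
      using inv[OF r\<beta>] l0 unfolding P by auto
    moreover have "inverse (cnj \<beta>) \<noteq> \<alpha>"
    proof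
      assume "inverse (cnj \<beta>) = \<alpha>"
      then have "cmod (inverse (cnj \<beta>)) = 1" using ab by simp
      then show False using ab(3) by (simp add: norm_inverse)
    qed
    moreover have "inverse (cnj \<beta>) \<noteq> \<beta>"
    proof
      assume "inverse (cnj \<beta>) = \<beta>"
      then have "cmod \<beta> = inverse (cmod \<beta>)" by (metis complex_mod_cnj norm_inverse)
      then have "cmod \<beta> * cmod \<beta> = 1" using \<beta>0 by (metis norm_eq_zero right_inverse)
      then show False using ab(3) by (metis abs_norm_cancel abs_square_eq_1 power2_eq_square)
    qed
    ultimately show ?thesis by auto
  qed
  obtain b where b: "b \<noteq> 0" "cmod b < 1" and Pb: "\<And>z. (z - \<beta>) * (z - \<gamma>) = (z - b) * (z - inverse (cnj b))"
  proof (cases "cmod \<beta> < 1")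
    case True then show ?thesis using that[of \<beta>] \<beta>0 \<gamma> by simp
  next
    case False
    then have "cmod \<beta> > 1" using ab(3) by simp
    then have "cmod (inverse (cnj \<beta>)) < 1" by (simp add: norm_inverse inverse_less_1_iff)
    then show ?thesis using that[of "inverse (cnj \<beta>)"] \<beta>0 \<gamma> by (simp add: mult.commute)
  qed
  define r where "r = cmod b"
  define R :: complex where "R = of_real r"
  define c where "c = inverse (cis (Arg b))"
  have r: "0 < r" "r < 1" using b unfolding r_def by auto
  have c: "cmod c = 1" "c \<noteq> 0" "cnj c = inverse c" unfolding c_def by (simp_all add: norm_inverse cis_inverse cis_cnj)
  have bc: "b = R * inverse c" unfolding R_def r_def c_def using rcis_cmod_Arg[of b] by (simp add: rcis_def)
  have ib: "inverse (cnj b) = inverse R * inverse c" unfolding bc using c by (simp add: R_def)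
  have P2: "poly a z = l * ((z - R * inverse c) * (z - inverse R * inverse c) * (z - \<alpha>)\<^sup>2)" for z
    unfolding P Pb ib by (simp add: bc mult_ac)
  have \<alpha>0: "\<alpha> \<noteq> 0" using ab by auto
  have R0: "R \<noteq> 0" unfolding R_def using r by auto
  have l: "l = (c / \<alpha>)\<^sup>2" using at0 R0 c(2) \<alpha>0 unfolding P2 by (simp add: field_simps power2_eq_square)
  \<comment> \<open>any point of the circle other than \<open>\<alpha>\<close> decides the sign; \<open>- \<alpha>\<close> is one\<close>
  have "inverse ((-\<alpha>)\<^sup>2) * poly a (-\<alpha>) \<in> \<real>\<^sub>\<ge>\<^sub>0" using pos[of "-\<alpha>"] ab(1) by simp
  moreover have "inverse ((-\<alpha>)\<^sup>2) * poly a (-\<alpha>) = l * (\<alpha> * inverse c * of_real ((cmod (-\<alpha> - R * inverse c))\<^sup>2 / r * (cmod (-\<alpha> - \<alpha>))\<^sup>2))"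
    unfolding P2 mult.left_commute[of _ l] using quartic_on_circle[OF r(1) R_def, of "-\<alpha>" c \<alpha>] ab(1) c(1) by simp
  moreover have "l * (\<alpha> * inverse c * x) = (c / \<alpha>) * x" for x
    unfolding l using \<alpha>0 c(2) by (simp add: field_simps power2_eq_square)
  moreover have "(cmod (-\<alpha> - R * inverse c))\<^sup>2 / r * (cmod (-\<alpha> - \<alpha>))\<^sup>2 > 0"
  proof -
    have "cmod (R * inverse c) = r" using c r unfolding R_def by (simp add: norm_mult norm_inverse)
    then have "-\<alpha> \<noteq> R * inverse c" using ab(1) r by (metis norm_minus_cancel less_irrefl)
    then show ?thesis using r \<alpha>0 by simp
  qed
  ultimately obtain x y where xy: "x > 0" "y \<ge> 0" "(c / \<alpha>) * of_real x = of_real y"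
    by (metis nonneg_Reals_cases)
  then have "c / \<alpha> = of_real (y / x)" by (simp add: field_simps)
  moreover have "cmod (c / \<alpha>) = 1" using ab(1) c(1) by (simp add: norm_divide)
  ultimately have "c / \<alpha> = 1" using xy by (simp add: norm_divide)
  then have ca: "c = \<alpha>" "l = 1" using \<alpha>0 l by auto
  define \<phi> where "\<phi> = - Arg b / 2"
  have "cis (2 * \<phi>) = c" "cis (- 2 * \<phi>) = inverse c" unfolding \<phi>_def c_def by (simp_all add: cis_inverse)
  then have "poly (M22_param (r, \<phi>)) z = poly a z" for z
    unfolding poly_M22_param P2 ca R_def by simp
  then have "M22_param (r, \<phi>) = a" by (intro poly_eq_poly_eq_iff[THEN iffD1]) auto
  then show ?thesis using that r by blast
qed

section \<open>Elliptic integrals depending on the modulus\<close>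

text \<open>With \<open>sinh x = sqrt m sin \<psi>\<close> the complete elliptic integrals of \<open>1 / sqrt (m - sinh\<^sup>2 x)\<close> and
  \<open>sqrt (m - sinh\<^sup>2 x)\<close> between the branch point and 0 take the following form, in which the
  singularity at the branch point has disappeared.\<close>

definition period_K :: "real \<Rightarrow> real" where
  "period_K m = integral {0..pi/2} (\<lambda>\<psi>. 1 / sqrt (1 + m * (sin \<psi>)\<^sup>2))"

definition period_K1 :: "real \<Rightarrow> real" where
  "period_K1 m = integral {0..pi/2} (\<lambda>\<psi>. m * (cos \<psi>)\<^sup>2 / sqrt (1 + m * (sin \<psi>)\<^sup>2))"

text \<open>The mean of \<open>m cos\<^sup>2 \<psi>\<close> with respect to the weight of \<open>period_K\<close>. The differential \<open>(sinh\<^sup>2 x -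
  q) / sqrt (m - sinh\<^sup>2 x) dx\<close> has integral 0 between the branch points exactly for \<open>q = m -
  period_ratio m\<close>.\<close>

definition period_ratio :: "real \<Rightarrow> real" where "period_ratio m = period_K1 m / period_K m"

text \<open>The values of \<open>sqrt (m - sinh\<^sup>2 z)\<close> at the points \<open>z = \<i> t\<close> of the imaginary axis.\<close>

definition axis_root :: "real \<Rightarrow> real \<Rightarrow> real" where "axis_root m t = sqrt (m + (sin t)\<^sup>2)"

text \<open>The integral of the normalised differential of the second kind along the imaginary axis, up to
  the factor \<open>- \<i>\<close>: at \<open>z = \<i> t\<close> one has \<open>sinh\<^sup>2 z - q = - (q + sin\<^sup>2 t)\<close>.\<close>

definition axis_integral :: "real \<Rightarrow> real \<Rightarrow> real" where
  "axis_integral m b = integral {0..b} (\<lambda>t. (m - period_ratio m + (sin t)\<^sup>2) / axis_root m t)"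

definition circle_period :: "real \<Rightarrow> real" where "circle_period m = axis_integral m pi"

text \<open>Incomplete elliptic integrals of the first and the second kind, in terms of which
  \<open>axis_integral\<close> is \<open>root_integral - period_ratio * inv_root_integral\<close>.\<close>

definition inv_root_integral :: "real \<Rightarrow> real \<Rightarrow> real" where "inv_root_integral m b = integral {0..b} (\<lambda>t. 1 / axis_root m t)"
definition root_integral :: "real \<Rightarrow> real \<Rightarrow> real" where "root_integral m b = integral {0..b} (\<lambda>t. axis_root m t)"

text \<open>The logarithmic derivative of \<open>circle_period\<close>.\<close>

definition log_deriv :: "real \<Rightarrow> real" where "log_deriv m = period_ratio m / (2 * m * (1 + m))"

lemma axis_root_pos: "m > 0 \<Longrightarrow> axis_root m t > 0" unfolding axis_root_def by (simp add: add_pos_nonneg)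
lemma axis_root_sq: "m > 0 \<Longrightarrow> (axis_root m t)\<^sup>2 = m + (sin t)\<^sup>2" unfolding axis_root_def by (simp add: add_nonneg_nonneg)

text \<open>Elliptic integrals of the first and second kind satisfy a linear system of differential
  equations in the modulus, because the derivative of one integrand with respect to the modulus is
  a combination \<open>h\<close> of the integrands plus the derivative of an elementary function \<open>\<Phi>\<close> of \<open>t\<close>.\<close>

lemma DERIV_integral_upto_primitive:
  fixes f f' :: "real \<Rightarrow> real \<Rightarrow> real"
  assumes f: "\<And>x t. x > 0 \<Longrightarrow> ((\<lambda>x. f x t) has_real_derivative f' x t) (at x)"
    and cf: "\<And>x. x > 0 \<Longrightarrow> continuous_on UNIV (f x)"
    and cf': "continuous_on ({0<..} \<times> {0..b}) (\<lambda>(x, t). f' x t)"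
    and m: "m > 0" and b: "0 \<le> b"
    and h: "continuous_on UNIV h"
    and \<Phi>: "\<And>t. (\<Phi> has_real_derivative f' m t - h t) (at t)"
  shows "((\<lambda>x. integral {0..b} (f x)) has_real_derivative (integral {0..b} h + (\<Phi> b - \<Phi> 0))) (at m)"
proof -
  have "((\<lambda>x. integral (cbox 0 b) (f x)) has_field_derivative integral (cbox 0 b) (f' m)) (at m within {0<..})"
  proof (rule leibniz_rule_field_derivative)
    show "\<And>x t. x \<in> {0<..} \<Longrightarrow> t \<in> cbox 0 b \<Longrightarrow> ((\<lambda>x. f x t) has_real_derivative f' x t) (at x within {0<..})"
      using f by (auto intro: has_field_derivative_at_within)
    show "\<And>x. x \<in> {0<..} \<Longrightarrow> f x integrable_on cbox 0 b"
      using cf by (auto intro!: integrable_continuous_real intro: continuous_on_subset[OF cf])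
    show "continuous_on ({0<..} \<times> cbox 0 b) (\<lambda>(x, t). f' x t)" using cf' by simp
  qed (use m in auto)
  then have D: "((\<lambda>x. integral {0..b} (f x)) has_real_derivative integral {0..b} (f' m)) (at m)"
    using m by (simp add: at_within_open[of m "{0<..}"])
  have "((\<lambda>t. f' m t - h t) has_integral \<Phi> b - \<Phi> 0) {0..b}"
    using b \<Phi> by (intro fundamental_theorem_of_calculus)
      (auto simp: has_real_derivative_iff_has_vector_derivative[symmetric] intro: has_field_derivative_at_within)
  moreover have "(h has_integral integral {0..b} h) {0..b}"
    using h by (intro integrable_integral integrable_continuous_real) (auto intro: continuous_on_subset)
  ultimately have "((\<lambda>t. (f' m t - h t) + h t) has_integral (\<Phi> b - \<Phi> 0) + integral {0..b} h) {0..b}"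
    by (rule has_integral_add)
  then have "integral {0..b} (f' m) = integral {0..b} h + (\<Phi> b - \<Phi> 0)" by (simp add: integral_unique)
  then show ?thesis using D by simp
qed

lemma DERIV_divide_sqrt:
  fixes u f :: "real \<Rightarrow> real"
  assumes u: "(u has_real_derivative u') (at x)" and f: "(f has_real_derivative f') (at x)" and pos: "f x > 0"
  shows "((\<lambda>x. u x / sqrt (f x)) has_real_derivative (u' - u x * f' / (2 * f x)) / sqrt (f x)) (at x)"
proof -
  define d where "d = sqrt (f x)"
  have d: "d > 0" "f x = d * d" unfolding d_def using pos by auto
  have "((\<lambda>x. sqrt (f x)) has_real_derivative inverse (sqrt (f x)) / 2 * f') (at x)"
    by (rule DERIV_chain2[OF DERIV_real_sqrt[OF pos] f])
  then have "((\<lambda>x. u x / sqrt (f x)) has_real_derivative (u' * sqrt (f x) - u x * (inverse (sqrt (f x)) / 2 * f')) / (sqrt (f x) * sqrt (f x))) (at x)"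
    by (rule DERIV_divide[OF u]) (use pos in auto)
  also have "(u' * sqrt (f x) - u x * (inverse (sqrt (f x)) / 2 * f')) / (sqrt (f x) * sqrt (f x)) = (u' - u x * f' / (2 * f x)) / sqrt (f x)"
    unfolding d_def[symmetric] unfolding d(2) using d(1) by (simp add: field_simps)
  finally show ?thesis .
qed

lemma DERIV_sin_cos: "((\<lambda>t. sin t * cos t) has_real_derivative (cos t)\<^sup>2 - (sin t)\<^sup>2) (at t)"
  using DERIV_mult[OF DERIV_sin DERIV_cos, of t] by (simp add: power2_eq_square)

lemma DERIV_affine_sin_sq: "((\<lambda>t. a + c * (sin t)\<^sup>2) has_real_derivative c * (2 * sin t * cos t)) (at t)"
  by (auto intro!: derivative_eq_intros)

lemma cont_sq_pos: "x > 0 \<Longrightarrow> 1 + x * (sin t)\<^sup>2 > (0::real)"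
  by (simp add: add_pos_nonneg)

lemma cont_sq_nz: "x > 0 \<Longrightarrow> 1 + x * (sin t)\<^sup>2 \<noteq> (0::real)"
  using cont_sq_pos[of x t] by linarith

lemma sum_sq_pos: "x > 0 \<Longrightarrow> x + (sin t)\<^sup>2 > (0::real)"
  by (simp add: add_pos_nonneg)

lemma sum_sq_nz: "x > 0 \<Longrightarrow> x + (sin t)\<^sup>2 \<noteq> (0::real)"
  using sum_sq_pos[of x t] by linarith

lemma twice_cont_sq_nz: "x > 0 \<Longrightarrow> 2 + 2 * (x * (sin t)\<^sup>2) \<noteq> (0::real)"
  using cont_sq_pos[of x t] by linarith

lemma twice_sum_sq_nz: "x > 0 \<Longrightarrow> 2 * x + 2 * (sin t)\<^sup>2 \<noteq> (0::real)"
  using sum_sq_pos[of x t] by linarith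

lemma axis_root_nz: "m > 0 \<Longrightarrow> axis_root m t \<noteq> 0" using axis_root_pos[of m t] by linarith

lemma integral_pos_real:
  fixes f :: "real \<Rightarrow> real"
  assumes "a < b" "continuous_on {a..b} f" "\<And>t. a < t \<Longrightarrow> t < b \<Longrightarrow> f t > 0"
  shows "integral {a..b} f > 0"
proof -
  have I: "f integrable_on {a..b}" using assms(2) by (rule integrable_continuous_real)
  let ?F = "\<lambda>x. integral {a..x} f"
  have "?F a < ?F b"
  proof (rule DERIV_pos_imp_increasing_open[OF assms(1)])
    fix x assume x: "a < x" "x < b"
    have "(?F has_real_derivative f x) (at x within {a..b})"
      by (rule integral_has_real_derivative[OF assms(2)]) (use x in auto)
    then have "(?F has_real_derivative f x) (at x)" using x by (simp add: at_within_Icc_at)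
    then show "\<exists>y. (?F has_real_derivative y) (at x) \<and> 0 < y" using assms(3) x by blast
  next
    show "continuous_on {a..b} ?F" by (rule indefinite_integral_continuous_1[OF I])
  qed
  then show ?thesis by simp
qed

lemma continuous_period_K_integrand: "x > 0 \<Longrightarrow> continuous_on UNIV (\<lambda>\<psi>. 1 / sqrt (1 + x * (sin \<psi>)\<^sup>2))"
  by (intro continuous_intros) (auto simp: cont_sq_nz twice_cont_sq_nz)

lemma continuous_period_K1_integrand: "x > 0 \<Longrightarrow> continuous_on UNIV (\<lambda>\<psi>. x * (cos \<psi>)\<^sup>2 / sqrt (1 + x * (sin \<psi>)\<^sup>2))"
  by (intro continuous_intros) (auto simp: cont_sq_nz twice_cont_sq_nz)

lemma period_K_pos: "m > 0 \<Longrightarrow> period_K m > 0"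
  unfolding period_K_def by (intro integral_pos_real continuous_on_subset[OF continuous_period_K_integrand]) (auto simp: cont_sq_pos)

text \<open>The derivative of the integrand is \<open>- 1 / (2 m (1 + m))\<close> times the integrand of \<open>period_K1\<close>, up
  to the derivative of a multiple of \<open>sin \<psi> cos \<psi> / sqrt (1 + m sin\<^sup>2 \<psi>)\<close>, which vanishes at both
  ends.\<close>

lemma DERIV_period_K:
  assumes m: "m > 0"
  shows "(period_K has_real_derivative - (period_K1 m / (2 * m * (1 + m)))) (at m)"
proof -
  let ?v = "\<lambda>x t::real. 1 + x * (sin t)\<^sup>2"
  let ?h = "\<lambda>t. - (1 / (2 * m * (1 + m))) * (m * (cos t)\<^sup>2 / sqrt (?v m t))"
  let ?\<Phi> = "\<lambda>t. 1 / (2 * (1 + m)) * (sin t * cos t / sqrt (?v m t))"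
  let ?f' = "\<lambda>x t. (0 - 1 * (sin t)\<^sup>2 / (2 * ?v x t)) / sqrt (?v x t)"
  have "((\<lambda>x. integral {0..pi/2} (\<lambda>t. 1 / sqrt (?v x t))) has_real_derivative
      (integral {0..pi/2} ?h + (?\<Phi> (pi/2) - ?\<Phi> 0))) (at m)"
  proof (rule DERIV_integral_upto_primitive[where f' = ?f'])
    fix x t :: real assume x: "x > 0"
    have "((\<lambda>x. ?v x t) has_real_derivative (sin t)\<^sup>2) (at x)" by (auto intro!: derivative_eq_intros)
    then show "((\<lambda>x. 1 / sqrt (?v x t)) has_real_derivative ?f' x t) (at x)"
      by (rule DERIV_divide_sqrt[OF DERIV_const]) (rule cont_sq_pos[OF x])
  next
    show "continuous_on ({0<..} \<times> {0..pi/2}) (\<lambda>(x, t). ?f' x t)"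
      unfolding split_beta by (intro continuous_intros) (auto simp: cont_sq_nz twice_cont_sq_nz)
    show "continuous_on UNIV ?h" by (rule continuous_on_mult_left[OF continuous_period_K1_integrand[OF m]])
  next
    fix t :: real
    define d where "d = sqrt (?v m t)"
    have d: "d > 0" "?v m t = d * d" unfolding d_def using cont_sq_pos[OF m, of t] by auto
    have c2: "(cos t)\<^sup>2 = 1 - (sin t)\<^sup>2" by (simp add: cos_squared_eq)
    have "(?\<Phi> has_real_derivative 1 / (2 * (1 + m)) * (((cos t)\<^sup>2 - (sin t)\<^sup>2 - sin t * cos t * (m * (2 * sin t * cos t)) / (2 * ?v m t)) / sqrt (?v m t))) (at t)"
      by (intro DERIV_cmult DERIV_divide_sqrt DERIV_sin_cos DERIV_affine_sin_sq cont_sq_pos m)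
    also have "1 / (2 * (1 + m)) * (((cos t)\<^sup>2 - (sin t)\<^sup>2 - sin t * cos t * (m * (2 * sin t * cos t)) / (2 * ?v m t)) / sqrt (?v m t))
      = (((cos t)\<^sup>2 - (sin t)\<^sup>2) * ?v m t - m * (sin t)\<^sup>2 * (cos t)\<^sup>2) / (2 * (1 + m) * ?v m t * sqrt (?v m t))"
      unfolding d_def[symmetric] unfolding d(2) using d(1) m by (simp add: divide_simps) (simp add: algebra_simps power2_eq_square)
    also have "((cos t)\<^sup>2 - (sin t)\<^sup>2) * ?v m t - m * (sin t)\<^sup>2 * (cos t)\<^sup>2 = (cos t)\<^sup>2 * ?v m t - (1 + m) * (sin t)\<^sup>2"
      unfolding c2 by (simp add: algebra_simps power2_eq_square)
    also have "((cos t)\<^sup>2 * ?v m t - (1 + m) * (sin t)\<^sup>2) / (2 * (1 + m) * ?v m t * sqrt (?v m t)) = ?f' m t - ?h t"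
      unfolding d_def[symmetric] unfolding d(2) using d(1) m by (simp add: divide_simps)
    finally show "(?\<Phi> has_real_derivative ?f' m t - ?h t) (at t)" .
  qed (use m continuous_period_K_integrand in auto)
  moreover have "integral {0..pi/2} ?h + (?\<Phi> (pi/2) - ?\<Phi> 0) = - (period_K1 m / (2 * m * (1 + m)))"
    unfolding period_K1_def integral_mult_right by simp
  ultimately show ?thesis unfolding period_K_def[abs_def] by metis
qed

lemma DERIV_period_K1:
  assumes m: "m > 0"
  shows "(period_K1 has_real_derivative period_K m / 2) (at m)"
proof -
  let ?v = "\<lambda>x t::real. 1 + x * (sin t)\<^sup>2"
  let ?h = "\<lambda>t. (1/2) * (1 / sqrt (?v m t))"
  let ?\<Phi> = "\<lambda>t. (1/2) * (sin t * cos t / sqrt (?v m t))"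
  let ?f' = "\<lambda>x t. ((cos t)\<^sup>2 - x * (cos t)\<^sup>2 * (sin t)\<^sup>2 / (2 * ?v x t)) / sqrt (?v x t)"
  have "((\<lambda>x. integral {0..pi/2} (\<lambda>t. x * (cos t)\<^sup>2 / sqrt (?v x t))) has_real_derivative
      (integral {0..pi/2} ?h + (?\<Phi> (pi/2) - ?\<Phi> 0))) (at m)"
  proof (rule DERIV_integral_upto_primitive[where f' = ?f'])
    fix x t :: real assume x: "x > 0"
    have D1: "((\<lambda>x. ?v x t) has_real_derivative (sin t)\<^sup>2) (at x)" by (auto intro!: derivative_eq_intros)
    have D2: "((\<lambda>x. x * (cos t)\<^sup>2) has_real_derivative (cos t)\<^sup>2) (at x)" by (auto intro!: derivative_eq_intros)
    show "((\<lambda>x. x * (cos t)\<^sup>2 / sqrt (?v x t)) has_real_derivative ?f' x t) (at x)"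
      by (rule DERIV_divide_sqrt[OF D2 D1 cont_sq_pos[OF x]])
  next
    show "continuous_on ({0<..} \<times> {0..pi/2}) (\<lambda>(x, t). ?f' x t)"
      unfolding split_beta by (intro continuous_intros) (auto simp: cont_sq_nz twice_cont_sq_nz)
    show "continuous_on UNIV ?h" by (rule continuous_on_mult_left[OF continuous_period_K_integrand[OF m]])
  next
    fix t :: real
    define d where "d = sqrt (?v m t)"
    have d: "d > 0" "?v m t = d * d" unfolding d_def using cont_sq_pos[OF m, of t] by auto
    have c2: "(cos t)\<^sup>2 = 1 - (sin t)\<^sup>2" by (simp add: cos_squared_eq)
    have "(?\<Phi> has_real_derivative (1/2) * (((cos t)\<^sup>2 - (sin t)\<^sup>2 - sin t * cos t * (m * (2 * sin t * cos t)) / (2 * ?v m t)) / sqrt (?v m t))) (at t)"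
      by (intro DERIV_cmult DERIV_divide_sqrt DERIV_sin_cos DERIV_affine_sin_sq cont_sq_pos m)
    also have "(1/2) * (((cos t)\<^sup>2 - (sin t)\<^sup>2 - sin t * cos t * (m * (2 * sin t * cos t)) / (2 * ?v m t)) / sqrt (?v m t))
      = ?f' m t - ?h t"
      unfolding d_def[symmetric] unfolding d(2) using d(1) m
      by (simp add: divide_simps, simp add: algebra_simps power2_eq_square) (use c2 in algebra)
    finally show "(?\<Phi> has_real_derivative ?f' m t - ?h t) (at t)" .
  qed (use m continuous_period_K1_integrand in auto)
  moreover have "integral {0..pi/2} ?h + (?\<Phi> (pi/2) - ?\<Phi> 0) = period_K m / 2"
    unfolding period_K_def integral_mult_right by simp
  ultimately show ?thesis unfolding period_K1_def[abs_def] by metis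
qed

text \<open>The linear system for \<open>period_K\<close> and \<open>period_K1\<close> gives a Riccati equation for their quotient.\<close>

lemma DERIV_period_ratio:
  assumes m: "m > 0"
  shows "(period_ratio has_real_derivative 1/2 + (period_ratio m)\<^sup>2 / (2 * m * (1 + m))) (at m)"
proof -
  have K: "period_K m > 0" by (rule period_K_pos[OF m])
  have "((\<lambda>x. period_K1 x / period_K x) has_real_derivative (period_K m / 2 * period_K m - period_K1 m * - (period_K1 m / (2 * m * (1 + m)))) / (period_K m * period_K m)) (at m)"
    by (rule DERIV_divide[OF DERIV_period_K1[OF m] DERIV_period_K[OF m]]) (use K in auto)
  also have "(period_K m / 2 * period_K m - period_K1 m * - (period_K1 m / (2 * m * (1 + m)))) / (period_K m * period_K m) = 1/2 + (period_K1 m / period_K m)\<^sup>2 / (2 * m * (1 + m))"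
    using K m by (simp add: divide_simps) (simp add: algebra_simps power2_eq_square)
  finally show ?thesis unfolding period_ratio_def[abs_def] .
qed

lemma period_K1_pos: "m > 0 \<Longrightarrow> period_K1 m > 0"
  unfolding period_K1_def
proof (rule integral_pos_real)
  fix t :: real assume "m > 0" "0 < t" "t < pi / 2"
  moreover from this have "cos t > 0" by (intro cos_gt_zero_pi) auto
  ultimately show "m * (cos t)\<^sup>2 / sqrt (1 + m * (sin t)\<^sup>2) > 0" by (simp add: cont_sq_pos)
qed (auto intro: continuous_on_subset[OF continuous_period_K1_integrand])

text \<open>A weighted mean of \<open>m cos\<^sup>2 \<psi>\<close> lies strictly between \<open>0\<close> and \<open>m\<close>.\<close>

lemma period_ratio_bounds: assumes m: "m > 0" shows "0 < period_ratio m" "period_ratio m < m"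
proof -
  show "0 < period_ratio m" unfolding period_ratio_def using period_K_pos period_K1_pos m by simp
  have "integral {0..pi/2} (\<lambda>\<psi>. m * (1 / sqrt (1 + m * (sin \<psi>)\<^sup>2)) - m * (cos \<psi>)\<^sup>2 / sqrt (1 + m * (sin \<psi>)\<^sup>2)) > 0"
  proof (rule integral_pos_real)
    show "continuous_on {0..pi/2} (\<lambda>\<psi>. m * (1 / sqrt (1 + m * (sin \<psi>)\<^sup>2)) - m * (cos \<psi>)\<^sup>2 / sqrt (1 + m * (sin \<psi>)\<^sup>2))"
      by (intro continuous_on_diff continuous_on_mult_left continuous_on_subset[OF continuous_period_K_integrand[OF m]]
        continuous_on_subset[OF continuous_period_K1_integrand[OF m]]) auto
    fix t assume t: "0 < t" "t < pi/2"
    have "sin t > 0" using t by (intro sin_gt_zero) auto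
    then have "(cos t)\<^sup>2 < 1" by (simp add: cos_squared_eq)
    then have "m * (cos t)\<^sup>2 < m" using m by simp
    then have "m * (cos t)\<^sup>2 / sqrt (1 + m * (sin t)\<^sup>2) < m / sqrt (1 + m * (sin t)\<^sup>2)"
      using cont_sq_pos[OF m, of t] by (intro divide_strict_right_mono) auto
    then show "0 < m * (1 / sqrt (1 + m * (sin t)\<^sup>2)) - m * (cos t)\<^sup>2 / sqrt (1 + m * (sin t)\<^sup>2)" by simp
  qed simp
  also have "integral {0..pi/2} (\<lambda>\<psi>. m * (1 / sqrt (1 + m * (sin \<psi>)\<^sup>2)) - m * (cos \<psi>)\<^sup>2 / sqrt (1 + m * (sin \<psi>)\<^sup>2))
    = m * period_K m - period_K1 m"
    unfolding period_K_def period_K1_def integral_mult_right[symmetric]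
    by (intro integral_diff integrable_continuous_real continuous_on_mult_left continuous_on_subset[OF continuous_period_K_integrand[OF m]]
        continuous_on_subset[OF continuous_period_K1_integrand[OF m]]) auto
  finally show "period_ratio m < m" unfolding period_ratio_def using period_K_pos[OF m] by (simp add: field_simps)
qed

lemma continuous_axis_root: "continuous_on UNIV (axis_root m)" unfolding axis_root_def[abs_def] by (intro continuous_intros)
lemma continuous_inv_axis_root: "m > 0 \<Longrightarrow> continuous_on UNIV (\<lambda>t. 1 / axis_root m t)"
  by (intro continuous_intros continuous_on_subset[OF continuous_axis_root]) (auto simp: axis_root_nz)

lemma DERIV_inv_root_integral:
  assumes m: "m > 0" and b: "b \<ge> 0"
  shows "((\<lambda>m. inv_root_integral m b) has_real_derivative - ((root_integral m b + sin b * cos b / axis_root m b) / (2 * m * (1 + m)))) (at m)"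
proof -
  let ?c = "- 1 / (2 * m * (1 + m))"
  let ?h = "\<lambda>t. ?c * axis_root m t"
  let ?\<Phi> = "\<lambda>t. ?c * (sin t * cos t / axis_root m t)"
  let ?f' = "\<lambda>x t. (0 - 1 * 1 / (2 * (x + (sin t)\<^sup>2))) / sqrt (x + (sin t)\<^sup>2)"
  have "((\<lambda>x. integral {0..b} (\<lambda>t. 1 / axis_root x t)) has_real_derivative
      (integral {0..b} ?h + (?\<Phi> b - ?\<Phi> 0))) (at m)"
  proof (rule DERIV_integral_upto_primitive[where f' = ?f'])
    fix x t :: real assume x: "x > 0"
    have "((\<lambda>x. x + (sin t)\<^sup>2) has_real_derivative 1) (at x)" by (auto intro!: derivative_eq_intros)
    then show "((\<lambda>x. 1 / axis_root x t) has_real_derivative ?f' x t) (at x)"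
      unfolding axis_root_def by (rule DERIV_divide_sqrt[OF DERIV_const]) (rule sum_sq_pos[OF x])
  next
    show "continuous_on ({0<..} \<times> {0..b}) (\<lambda>(x, t). ?f' x t)"
      unfolding split_beta by (intro continuous_intros) (auto simp: sum_sq_nz twice_sum_sq_nz)
    show "continuous_on UNIV ?h" by (rule continuous_on_mult_left[OF continuous_axis_root])
  next
    fix t :: real
    define d where "d = axis_root m t"
    have d: "d > 0" "m + (sin t)\<^sup>2 = d * d" unfolding d_def using axis_root_pos[OF m] axis_root_sq[OF m, of t] by (auto simp: power2_eq_square)
    have sd: "sqrt (d * d) = d" using d(1) by simp
    have c2: "(cos t)\<^sup>2 = 1 - (sin t)\<^sup>2" by (simp add: cos_squared_eq)
    have s: "m + 1 * (sin t)\<^sup>2 > 0" using sum_sq_pos[OF m, of t] by simp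
    have "((\<lambda>t. sin t * cos t / sqrt (m + 1 * (sin t)\<^sup>2)) has_real_derivative ((cos t)\<^sup>2 - (sin t)\<^sup>2 - sin t * cos t * (1 * (2 * sin t * cos t)) / (2 * (m + 1 * (sin t)\<^sup>2))) / sqrt (m + 1 * (sin t)\<^sup>2)) (at t)"
      by (rule DERIV_divide_sqrt[OF DERIV_sin_cos DERIV_affine_sin_sq s])
    then have "((\<lambda>t. sin t * cos t / axis_root m t) has_real_derivative ((cos t)\<^sup>2 - (sin t)\<^sup>2 - sin t * cos t * (2 * sin t * cos t) / (2 * (d * d))) / d) (at t)"
      unfolding mult_1 axis_root_def[symmetric] d(2) sd d_def[symmetric] .
    also have "((cos t)\<^sup>2 - (sin t)\<^sup>2 - sin t * cos t * (2 * sin t * cos t) / (2 * (d * d))) / d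
      = (((cos t)\<^sup>2 - (sin t)\<^sup>2) * (d * d) - (sin t)\<^sup>2 * (cos t)\<^sup>2) / d ^ 3"
      using d(1) by (simp add: divide_simps) (simp add: algebra_simps power2_eq_square power3_eq_cube)
    also have "((cos t)\<^sup>2 - (sin t)\<^sup>2) * (d * d) - (sin t)\<^sup>2 * (cos t)\<^sup>2 = m * (1 + m) - (d * d) * (d * d)"
      unfolding d(2)[symmetric] c2 by (simp add: algebra_simps power2_eq_square)
    finally have "(?\<Phi> has_real_derivative ?c * ((m * (1 + m) - (d * d) * (d * d)) / d ^ 3)) (at t)" by (rule DERIV_cmult)
    also have "?c * ((m * (1 + m) - (d * d) * (d * d)) / d ^ 3) = (0 - 1 * 1 / (2 * (d * d))) / d - ?c * d"
      using d(1) m by (simp add: divide_simps) (simp add: algebra_simps power3_eq_cube)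
    finally show "(?\<Phi> has_real_derivative ?f' m t - ?h t) (at t)" unfolding axis_root_def[symmetric] unfolding d_def[symmetric] d(2) .
  qed (use m b continuous_inv_axis_root in auto)
  moreover have "integral {0..b} ?h + (?\<Phi> b - ?\<Phi> 0) = - ((root_integral m b + sin b * cos b / axis_root m b) / (2 * m * (1 + m)))"
    unfolding root_integral_def integral_mult_right by (simp add: add_divide_distrib)
  ultimately show ?thesis unfolding inv_root_integral_def by metis
qed

lemma DERIV_axis_root_m:
  assumes "m > 0"
  shows "((\<lambda>m. axis_root m t) has_real_derivative (1/2) * (1 / axis_root m t)) (at m)"
proof -
  have "((\<lambda>x. x + (sin t)\<^sup>2) has_real_derivative 1) (at m)" by (auto intro!: derivative_eq_intros)
  then have "((\<lambda>m. axis_root m t) has_real_derivative inverse (axis_root m t) / 2 * 1) (at m)"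
    unfolding axis_root_def by (rule DERIV_chain2[where f = sqrt and g = "\<lambda>x. x + (sin t)\<^sup>2", OF DERIV_real_sqrt[OF sum_sq_pos[OF assms]]])
  then show ?thesis by (simp add: field_simps)
qed

lemma DERIV_root_integral:
  assumes m: "m > 0" and b: "b \<ge> 0"
  shows "((\<lambda>m. root_integral m b) has_real_derivative inv_root_integral m b / 2) (at m)"
proof -
  have "((\<lambda>x. integral {0..b} (axis_root x)) has_real_derivative
      (integral {0..b} (\<lambda>t. (1/2) * (1 / axis_root m t)) + ((\<lambda>t. 0) b - (\<lambda>t. 0) 0))) (at m)"
  proof (rule DERIV_integral_upto_primitive[where f' = "\<lambda>x t. (1/2) * (1 / axis_root x t)"])
    show "continuous_on ({0<..} \<times> {0..b}) (\<lambda>(x, t). (1/2) * (1 / axis_root x t))"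
      unfolding split_beta axis_root_def by (intro continuous_intros) (auto simp: sum_sq_nz twice_sum_sq_nz)
    show "continuous_on UNIV (\<lambda>t. (1/2) * (1 / axis_root m t))" by (intro continuous_on_mult_left continuous_inv_axis_root m)
  qed (use m b continuous_axis_root DERIV_axis_root_m in auto)
  then show ?thesis unfolding inv_root_integral_def root_integral_def integral_mult_right by simp
qed

lemma axis_integral_eq: assumes "m > 0" shows "axis_integral m b = root_integral m b - period_ratio m * inv_root_integral m b"
proof -
  have "(m - period_ratio m + (sin t)\<^sup>2) / axis_root m t = axis_root m t - period_ratio m * (1 / axis_root m t)" for t
    using axis_root_pos[OF assms, of t] axis_root_sq[OF assms, of t] by (simp add: divide_simps power2_eq_square)
  then have "axis_integral m b = integral {0..b} (\<lambda>t. axis_root m t - period_ratio m * (1 / axis_root m t))" unfolding axis_integral_def by simp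
  also have "\<dots> = root_integral m b - period_ratio m * inv_root_integral m b" unfolding root_integral_def inv_root_integral_def integral_mult_right[symmetric]
    by (intro integral_diff integrable_continuous_real continuous_on_mult_left continuous_on_subset[OF continuous_axis_root] continuous_on_subset[OF continuous_inv_axis_root[OF assms]]) auto
  finally show ?thesis .
qed

text \<open>Differentiating \<open>root_integral - period_ratio * inv_root_integral\<close>, the Riccati equation for
  \<open>period_ratio\<close> cancels the terms that would lead out of the multiples of \<open>axis_integral\<close>: what
  remains is a multiple of \<open>axis_integral\<close> itself and an elementary term. At \<open>b = \<pi>\<close> the
  elementary term vanishes, so \<open>circle_period\<close> satisfies a homogeneous linear equation.\<close>

lemma DERIV_axis_integral_m:
  assumes m: "m > 0" and b: "b \<ge> 0"
  shows "((\<lambda>m. axis_integral m b) has_real_derivative log_deriv m * (axis_integral m b + sin b * cos b / axis_root m b)) (at m)"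
proof -
  have "((\<lambda>m. root_integral m b - period_ratio m * inv_root_integral m b) has_real_derivative
     (inv_root_integral m b / 2 - ((1/2 + (period_ratio m)\<^sup>2 / (2 * m * (1 + m))) * inv_root_integral m b + - ((root_integral m b + sin b * cos b / axis_root m b) / (2 * m * (1 + m))) * period_ratio m))) (at m)"
    by (intro DERIV_diff DERIV_mult DERIV_root_integral DERIV_inv_root_integral DERIV_period_ratio m b)
  also have "(inv_root_integral m b / 2 - ((1/2 + (period_ratio m)\<^sup>2 / (2 * m * (1 + m))) * inv_root_integral m b + - ((root_integral m b + sin b * cos b / axis_root m b) / (2 * m * (1 + m))) * period_ratio m))
    = log_deriv m * (axis_integral m b + sin b * cos b / axis_root m b)"
    unfolding log_deriv_def axis_integral_eq[OF m] using m axis_root_pos[OF m, of b]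
    by (simp add: divide_simps) (simp add: algebra_simps power2_eq_square)
  finally have "((\<lambda>m. root_integral m b - period_ratio m * inv_root_integral m b) has_real_derivative log_deriv m * (axis_integral m b + sin b * cos b / axis_root m b)) (at m)" .
  then show ?thesis
    by (rule DERIV_cong_ev[THEN iffD1, rotated -1])
      (use m in \<open>auto simp: axis_integral_eq intro!: eventually_mono[OF eventually_nhds_in_open[of "{0<..}" m]]\<close>)
qed

lemma DERIV_circle_period: assumes m: "m > 0" shows "(circle_period has_real_derivative log_deriv m * circle_period m) (at m)"
  using DERIV_axis_integral_m[OF m, of pi] unfolding circle_period_def[abs_def] by simp

lemma continuous_axis_integral_integrand: "m > 0 \<Longrightarrow> continuous_on UNIV (\<lambda>t. (m - period_ratio m + (sin t)\<^sup>2) / axis_root m t)"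
  by (intro continuous_intros continuous_on_subset[OF continuous_axis_root]) (auto simp: axis_root_nz)

lemma DERIV_axis_integral_t:
  assumes m: "m > 0" and b: "b > 0"
  shows "(axis_integral m has_real_derivative (m - period_ratio m + (sin b)\<^sup>2) / axis_root m b) (at b)"
proof -
  have "((\<lambda>b. integral {0..b} (\<lambda>t. (m - period_ratio m + (sin t)\<^sup>2) / axis_root m t)) has_real_derivative (m - period_ratio m + (sin b)\<^sup>2) / axis_root m b) (at b within {0..b+1})"
    by (rule integral_has_real_derivative[OF continuous_on_subset[OF continuous_axis_integral_integrand[OF m]]]) (use b in auto)
  then show ?thesis unfolding axis_integral_def[abs_def] using b by (simp add: at_within_Icc_at)
qed

lemma circle_period_pos: assumes m: "m > 0" shows "circle_period m > 0"
  unfolding circle_period_def axis_integral_def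
  by (rule integral_pos_real) (use period_ratio_bounds[OF m] axis_root_pos[OF m] in \<open>auto intro!: continuous_on_subset[OF continuous_axis_integral_integrand[OF m]] divide_pos_pos add_pos_nonneg\<close>)

section \<open>A linear differential equation with a branch point\<close>

text \<open>In the coordinate \<open>z\<close> with \<open>\<lambda> = e\<^sup>-\<^sup>2\<^sup>i\<^sup>\<phi> e\<^sup>2\<^sup>z\<close> the spectral curve is, up to the square of a
  holomorphic factor, the double cover \<open>V\<^sup>2 = branch_fun m z\<close>. Since \<open>\<lambda>\<close> has period \<open>\<pi> \<i>\<close> in \<open>z\<close>,
  the strip covers the punctured plane and has an overlap wide enough to express periodicity in
  its interior. It contains the two branch points \<open>\<plusminus> arsinh (sqrt m)\<close> and no others.\<close>

definition branch_fun :: "real \<Rightarrow> complex \<Rightarrow> complex" where "branch_fun m z = of_real m - (sinh z)\<^sup>2"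

definition strip :: "complex set" where "strip = {z. \<bar>Im z\<bar> < pi}"

lemma Im_sinh: "Im (sinh z) = cosh (Re z) * sin (Im z)"
  by (simp add: sinh_field_def cosh_field_def Im_exp field_simps)

lemma Re_sinh: "Re (sinh z) = sinh (Re z) * cos (Im z)"
  by (simp add: sinh_field_def Re_exp field_simps)

lemma sinh_complex_of_real: "sinh (complex_of_real x) = of_real (sinh x)"
  by (simp add: sinh_field_def exp_of_real flip: of_real_minus)

lemma cosh_complex_of_real: "cosh (complex_of_real x) = of_real (cosh x)"
  by (simp add: cosh_field_def exp_of_real flip: of_real_minus)

lemma branch_fun_real_nonpos:
  assumes m: "m > 0" and P: "branch_fun m z \<in> \<real>\<^sub>\<le>\<^sub>0"
  shows "sin (Im z) = 0"
proof -
  obtain x where x: "branch_fun m z = of_real x" "x \<le> 0" using P by (auto elim: nonpos_Reals_cases)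
  have "(sinh z)\<^sup>2 = of_real (m - x)" using x(1) unfolding branch_fun_def by (simp add: algebra_simps)
  also have "\<dots> = (of_real (sqrt (m - x)))\<^sup>2" using m x(2) by (simp flip: of_real_power)
  finally have "sinh z = of_real (sqrt (m - x)) \<or> sinh z = - of_real (sqrt (m - x))" by (simp add: power2_eq_iff)
  then have "Im (sinh z) = 0" by auto
  then show ?thesis unfolding Im_sinh by simp
qed

lemma sin_zero_strip: "\<bar>y\<bar> < pi \<Longrightarrow> sin y = 0 \<Longrightarrow> y = (0::real)"
  using sin_eq_0_pi by force

lemma branch_fun_zero:
  assumes m: "m > 0" and z: "\<bar>Im z\<bar> < pi" and P: "branch_fun m z = 0"
  shows "z = of_real (arsinh (sqrt m)) \<or> z = - of_real (arsinh (sqrt m))"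
proof -
  have I: "Im z = 0" using branch_fun_real_nonpos[OF m, of z] P sin_zero_strip[OF z] by simp
  have "(sinh z)\<^sup>2 = of_real m" using P unfolding branch_fun_def by simp
  then have "Re ((sinh z)\<^sup>2) = m" by simp
  then have "(Re (sinh z))\<^sup>2 = (sqrt m)\<^sup>2" using I m by (simp add: power2_eq_square Im_sinh)
  then have "sinh (Re z) = sqrt m \<or> sinh (Re z) = - sqrt m" using I unfolding Re_sinh power2_eq_iff by simp
  then have "Re z = arsinh (sqrt m) \<or> Re z = arsinh (- sqrt m)" by (metis arsinh_sinh_real)
  then have "Re z = arsinh (sqrt m) \<or> Re z = - arsinh (sqrt m)" by simp
  then show ?thesis using I by (auto simp: complex_eq_iff)
qed

lemma DERIV_branch_fun: "(branch_fun m has_field_derivative - 2 * sinh z * cosh z) (at z within A)"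
  unfolding branch_fun_def[abs_def] by (auto intro!: derivative_eq_intros)

lemma branch_fun_holomorphic: "branch_fun m holomorphic_on A"
  using DERIV_branch_fun unfolding holomorphic_on_def field_differentiable_def by blast

lemma sinh_cosh_nz: assumes "m > 0" "branch_fun m z = 0" shows "sinh z * cosh z \<noteq> 0"
proof -
  have s: "(sinh z)\<^sup>2 = of_real m" using assms(2) unfolding branch_fun_def by simp
  then have "(cosh z)\<^sup>2 = of_real (m + 1)" unfolding cosh_square_eq by simp
  moreover have "(of_real (m + 1) :: complex) \<noteq> 0" "(of_real m :: complex) \<noteq> 0" using assms(1) by (simp_all del: of_real_add)
  ultimately show ?thesis using s by (auto simp del: of_real_add)
qed

text \<open>Formally \<open>D = const / sqrt (branch_fun m)\<close>: the square of \<open>sqrt (branch_fun m) D\<close> has derivative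
  zero. At a branch point itself the equation reads \<open>0 = sinh z cosh z D z\<close> with a nonzero factor.\<close>

lemma homogeneous_eq_zero:
  assumes m: "m > 0" and U: "convex U" "open U" "0 \<in> U"
    and D: "\<And>z. z \<in> U \<Longrightarrow> (D has_field_derivative D' z) (at z)"
    and eq: "\<And>z. z \<in> U \<Longrightarrow> branch_fun m z * D' z = sinh z * cosh z * D z"
    and D0: "D 0 = 0" and z: "z \<in> U"
  shows "D z = 0"
proof -
  have "((\<lambda>z. branch_fun m z * (D z)\<^sup>2) has_field_derivative 0) (at z within U)" if "z \<in> U" for z
  proof -
    have "((\<lambda>z. branch_fun m z * (D z)\<^sup>2) has_field_derivative (- 2 * sinh z * cosh z * (D z)\<^sup>2 + (2 * D z * D' z) * branch_fun m z)) (at z within U)"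
      by (auto intro!: derivative_eq_intros DERIV_branch_fun has_field_derivative_at_within[OF D[OF that]])
    also have "- 2 * sinh z * cosh z * (D z)\<^sup>2 + (2 * D z * D' z) * branch_fun m z = 2 * D z * (branch_fun m z * D' z - sinh z * cosh z * D z)"
      by (simp add: algebra_simps power2_eq_square)
    finally show ?thesis using eq[OF that] by simp
  qed
  then obtain c where c: "\<And>z. z \<in> U \<Longrightarrow> branch_fun m z * (D z)\<^sup>2 = c"
    using has_field_derivative_zero_constant[OF U(1), of "\<lambda>z. branch_fun m z * (D z)\<^sup>2"] by blast
  have "branch_fun m z * (D z)\<^sup>2 = 0" using c[OF z] c[OF U(3)] D0 by simp
  moreover have "D z = 0" if "branch_fun m z = 0" using eq[OF z] that sinh_cosh_nz[OF m that] by simp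
  ultimately show ?thesis by auto
qed

lemma convex_strip: "convex strip"
proof -
  have eq: "strip = {z. Im z < pi} \<inter> {z. Im z > - pi}" unfolding strip_def by auto
  show ?thesis unfolding eq by (intro convex_Int convex_halfspace_Im_lt convex_halfspace_Im_gt)
qed

lemma open_strip: "open strip"
proof -
  have eq: "strip = {z. Im z < pi} \<inter> {z. Im z > - pi}" unfolding strip_def by auto
  show ?thesis unfolding eq by (intro open_Int open_halfspace_Im_lt open_halfspace_Im_gt)
qed

text \<open>A convex part of the strip that contains exactly one of the two branch points; the other half is
  its image under \<open>z \<mapsto> - z\<close>.\<close>

definition right_half :: "real \<Rightarrow> complex set" where
  "right_half m = strip \<inter> {z. Re z > - arsinh (sqrt m)}"

lemma convex_right_half: "convex (right_half m)" unfolding right_half_def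
  by (intro convex_Int convex_strip convex_halfspace_Re_gt)

lemma open_right_half: "open (right_half m)" unfolding right_half_def
  by (intro open_Int open_strip open_halfspace_Re_gt)

text \<open>Formally \<open>N z = (z - l)\<^sup>-\<^sup>1\<^sup>/\<^sup>2 \<integral> F w / (2 (w - l)\<^sup>1\<^sup>/\<^sup>2) dw\<close>, integrated from \<open>l\<close> to \<open>z\<close>. The
  substitution \<open>w = l + v\<^sup>2 (z - l)\<close> turns this into the integral of \<open>F (l + v\<^sup>2 (z - l))\<close> over
  \<open>v\<close> in \<open>{0..1}\<close>, which is holomorphic in \<open>z\<close> without any choice of a square root.\<close>

lemma singular_linear_ode_solution:
  fixes F :: "complex \<Rightarrow> complex"
  assumes U: "convex U" "open U" "l \<in> U" and F: "F holomorphic_on U"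
  obtains N where "N holomorphic_on U" "\<And>z. z \<in> U \<Longrightarrow> 2 * (z - l) * deriv N z + N z = F z"
proof -
  define N where "N z = integral (cbox 0 1) (\<lambda>v::real. F (l + of_real (v\<^sup>2) * (z - l)))" for z
  have mem: "l + of_real (v\<^sup>2) * (z - l) \<in> U" if "z \<in> U" "v \<in> cbox 0 1" for z and v :: real
  proof -
    have v: "0 \<le> v" "v \<le> 1" using that(2) by auto
    then have "v\<^sup>2 \<le> 1" by (simp add: power_le_one)
    then have "(1 - v\<^sup>2) *\<^sub>R l + v\<^sup>2 *\<^sub>R z \<in> U" using U(1,3) that(1) by (intro convexD) auto
    then show ?thesis by (simp add: scaleR_conv_of_real algebra_simps)
  qed
  have F': "(F has_field_derivative deriv F z) (at z)" if "z \<in> U" for z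
    using holomorphic_derivI[OF F U(2) that] .
  have cF: "continuous_on U F" using F by (rule holomorphic_on_imp_continuous_on)
  have cF': "continuous_on U (deriv F)" using F U(2) by (intro holomorphic_on_imp_continuous_on holomorphic_deriv)
  have D: "(N has_field_derivative integral (cbox 0 1) (\<lambda>v. of_real (v\<^sup>2) * deriv F (l + of_real (v\<^sup>2) * (z - l)))) (at z)" if z: "z \<in> U" for z
  proof -
    have "((\<lambda>z. integral (cbox 0 1) (\<lambda>v. F (l + of_real (v\<^sup>2) * (z - l)))) has_field_derivative
       integral (cbox 0 1) (\<lambda>v. of_real (v\<^sup>2) * deriv F (l + of_real (v\<^sup>2) * (z - l)))) (at z within U)"
    proof (rule leibniz_rule_field_derivative[where fx = "\<lambda>z v. of_real (v\<^sup>2) * deriv F (l + of_real (v\<^sup>2) * (z - l))", OF _ _ _ z U(1)])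
      fix x and t :: real assume xt: "x \<in> U" "t \<in> cbox 0 1"
      have "((\<lambda>x. l + of_real (t\<^sup>2) * (x - l)) has_field_derivative of_real (t\<^sup>2)) (at x within U)"
        by (auto intro!: derivative_eq_intros)
      then show "((\<lambda>x. F (l + of_real (t\<^sup>2) * (x - l))) has_field_derivative of_real (t\<^sup>2) * deriv F (l + of_real (t\<^sup>2) * (x - l))) (at x within U)"
        using DERIV_chain2[where f = F and g = "\<lambda>x. l + of_real (t\<^sup>2) * (x - l)", OF F'[OF mem[OF xt]]]
        by (simp only: mult.commute)
    next
      fix x assume x: "x \<in> U"
      show "(\<lambda>v::real. F (l + of_real (v\<^sup>2) * (x - l))) integrable_on cbox 0 1"
        by (intro integrable_continuous continuous_on_compose2[OF cF] continuous_intros) (use mem[OF x] in auto)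
    next
      show "continuous_on (U \<times> cbox 0 1) (\<lambda>(z, v::real). of_real (v\<^sup>2) * deriv F (l + of_real (v\<^sup>2) * (z - l)))"
        unfolding split_beta by (intro continuous_intros continuous_on_compose2[OF cF']) (use mem in auto)
    qed
    then show ?thesis unfolding N_def[abs_def] using at_within_open[OF z U(2)] by simp
  qed
  show ?thesis
  proof
    show "N holomorphic_on U" using D U(2) by (auto simp: holomorphic_on_open)
    fix z assume z: "z \<in> U"
    let ?f = "\<lambda>v::real. F (l + of_real (v\<^sup>2) * (z - l))"
    let ?f' = "\<lambda>v::real. deriv F (l + of_real (v\<^sup>2) * (z - l))"
    have "((\<lambda>v. 2 * (z - l) * (of_real (v\<^sup>2) * ?f' v) + ?f v) has_integral (of_real 1 * ?f 1 - of_real 0 * ?f 0)) {0..1}"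
    proof (rule fundamental_theorem_of_calculus)
      fix v :: real assume v: "v \<in> {0..1}"
      have 1: "(F has_field_derivative ?f' v) (at (l + of_real (v\<^sup>2) * (z - l)))" using F' mem[OF z] v by auto
      have 2: "((\<lambda>w. l + w\<^sup>2 * (z - l)) has_field_derivative 2 * of_real v * (z - l)) (at (of_real v))"
        by (auto intro!: derivative_eq_intros)
      have "((\<lambda>w. F (l + w\<^sup>2 * (z - l))) has_field_derivative ?f' v * (2 * of_real v * (z - l))) (at (of_real v))"
        using DERIV_chain2[where f = F and g = "\<lambda>w. l + w\<^sup>2 * (z - l)", OF _ 2] 1 by simp
      then have "((\<lambda>w. w * F (l + w\<^sup>2 * (z - l))) has_field_derivative (1 * F (l + (of_real v)\<^sup>2 * (z - l)) + (?f' v * (2 * of_real v * (z - l))) * of_real v)) (at (of_real v))"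
        by (intro DERIV_mult DERIV_ident)
      then have "((\<lambda>v. of_real v * ?f v) has_vector_derivative (1 * F (l + (of_real v)\<^sup>2 * (z - l)) + (?f' v * (2 * of_real v * (z - l))) * of_real v)) (at v)"
        by (subst (asm) of_real_power[symmetric])
          (use has_vector_derivative_real_field[where f = "\<lambda>w. w * F (l + w\<^sup>2 * (z - l))"] in simp)
      moreover have "1 * F (l + (of_real v)\<^sup>2 * (z - l)) + (?f' v * (2 * of_real v * (z - l))) * of_real v = 2 * (z - l) * (of_real (v\<^sup>2) * ?f' v) + ?f v"
        by (simp add: algebra_simps power2_eq_square)
      ultimately have "((\<lambda>v. of_real v * ?f v) has_vector_derivative 2 * (z - l) * (of_real (v\<^sup>2) * ?f' v) + ?f v) (at v)"
        by (simp only:)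
      then show "((\<lambda>v. of_real v * ?f v) has_vector_derivative 2 * (z - l) * (of_real (v\<^sup>2) * ?f' v) + ?f v) (at v within {0..1})"
        by (rule has_vector_derivative_at_within)
    qed simp
    then have "integral {0..1} (\<lambda>v. 2 * (z - l) * (of_real (v\<^sup>2) * ?f' v) + ?f v) = F z" by (simp add: integral_unique)
    also have "integral {0..1} (\<lambda>v. 2 * (z - l) * (of_real (v\<^sup>2) * ?f' v) + ?f v) = 2 * (z - l) * integral {0..1} (\<lambda>v. of_real (v\<^sup>2) * ?f' v) + integral {0..1} ?f"
    proof (subst integral_add)
      show "(\<lambda>v. 2 * (z - l) * (of_real (v\<^sup>2) * ?f' v)) integrable_on {0..1}"
        by (intro integrable_continuous_real continuous_intros continuous_on_compose2[OF cF']) (use mem[OF z] in auto)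
      show "?f integrable_on {0..1}"
        by (intro integrable_continuous_real continuous_intros continuous_on_compose2[OF cF]) (use mem[OF z] in auto)
    qed simp
    finally show "2 * (z - l) * deriv N z + N z = F z" using DERIV_imp_deriv[OF D[OF z]] unfolding N_def by simp
  qed
qed

text \<open>The solution sought is \<open>1 / V\<close> times the integral of \<open>n / V\<close> from the branch point \<open>l\<close>, with \<open>V
  = sqrt (branch_fun m)\<close>. Writing \<open>branch_fun m z = (l - z) (\<rho> z)\<^sup>2\<close> with a zero-free \<open>\<rho>\<close> reduces
  the equation to the one of \<open>singular_linear_ode_solution\<close> by the substitution \<open>E = - 2 N / \<rho>\<close>.\<close>

lemma half_solution:
  assumes m: "m > 0" and n: "n holomorphic_on UNIV"
  obtains E where "E holomorphic_on right_half m" "\<And>z. z \<in> right_half m \<Longrightarrow> branch_fun m z * deriv E z = sinh z * cosh z * E z + n z"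
proof -
  define l :: complex where "l = of_real (arsinh (sqrt m))"
  have lpos: "arsinh (sqrt m) > 0" using m by (metis arsinh_0 arsinh_real_strict_mono real_sqrt_gt_0_iff)
  have l: "l \<in> right_half m" unfolding right_half_def strip_def l_def using lpos by simp
  have sl: "sinh l = of_real (sqrt m)" unfolding l_def by (simp add: sinh_complex_of_real)
  have Pl: "branch_fun m l = 0" unfolding branch_fun_def sl using m by (simp flip: of_real_power)
  \<comment> \<open>the zero-free quotient \<open>branch_fun m z / (l - z)\<close>, extended over the branch point\<close>
  define R where "R z = - (if z = l then deriv (branch_fun m) l else (branch_fun m z - branch_fun m l) / (z - l))" for z
  have R: "R holomorphic_on right_half m" unfolding R_def
    by (intro holomorphic_on_minus pole_lemma branch_fun_holomorphic) (simp add: l open_right_half interior_open)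
  have PR: "branch_fun m z = (l - z) * R z" for z using Pl unfolding R_def by (cases "z = l") (auto simp: field_simps)
  have "R z \<noteq> 0" if z: "z \<in> right_half m" for z
  proof (cases "z = l")
    case True
    then show ?thesis unfolding R_def using DERIV_imp_deriv[OF DERIV_branch_fun, of m l] sinh_cosh_nz[OF m Pl] by simp
  next
    case False
    have "z \<noteq> - l" using z unfolding right_half_def l_def by auto
    then have "branch_fun m z \<noteq> 0" using branch_fun_zero[OF m, of z] False z unfolding right_half_def strip_def l_def by auto
    then show ?thesis using PR[of z] by auto
  qed
  then obtain \<rho> where \<rho>: "\<rho> holomorphic_on right_half m" "\<And>z. z \<in> right_half m \<Longrightarrow> R z = (\<rho> z)\<^sup>2"
    using contractible_imp_holomorphic_sqrt[OF R convex_imp_contractible[OF convex_right_half]] by blast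
  have \<rho>0: "\<rho> z \<noteq> 0" if "z \<in> right_half m" for z using \<rho>(2)[OF that] \<open>\<And>z. z \<in> right_half m \<Longrightarrow> R z \<noteq> 0\<close>[OF that] by auto
  have "(\<lambda>z. n z / \<rho> z) holomorphic_on right_half m" using \<rho>(1) \<rho>0 holomorphic_on_subset[OF n] by (intro holomorphic_intros) auto
  from singular_linear_ode_solution[OF convex_right_half open_right_half l this]
  obtain N where N: "N holomorphic_on right_half m" "\<And>z. z \<in> right_half m \<Longrightarrow> 2 * (z - l) * deriv N z + N z = n z / \<rho> z" by blast
  show ?thesis
  proof
    show "(\<lambda>z. - 2 * N z / \<rho> z) holomorphic_on right_half m" using \<rho>0 by (intro holomorphic_intros N \<rho>) auto
    fix z assume z: "z \<in> right_half m"
    have DN: "(N has_field_derivative deriv N z) (at z)" using holomorphic_derivI[OF N(1) open_right_half z] .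
    have D\<rho>: "(\<rho> has_field_derivative deriv \<rho> z) (at z)" using holomorphic_derivI[OF \<rho>(1) open_right_half z] .
    have dE: "deriv (\<lambda>z. - 2 * N z / \<rho> z) z = (- 2 * deriv N z * \<rho> z + 2 * N z * deriv \<rho> z) / (\<rho> z * \<rho> z)"
      by (rule DERIV_imp_deriv) (use \<rho>0[OF z] in \<open>auto intro!: derivative_eq_intros DN D\<rho> simp: field_simps\<close>)
    have "((\<lambda>z. (l - z) * (\<rho> z)\<^sup>2) has_field_derivative (- (\<rho> z)\<^sup>2 + (2 * \<rho> z * deriv \<rho> z) * (l - z))) (at z)"
      by (auto intro!: derivative_eq_intros D\<rho>)
    then have "(branch_fun m has_field_derivative (- (\<rho> z)\<^sup>2 + (2 * \<rho> z * deriv \<rho> z) * (l - z))) (at z)"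
      by (rule has_field_derivative_transform_within_open[OF _ open_right_half z]) (simp add: PR \<rho>(2))
    \<comment> \<open>both sides are the derivative of \<open>branch_fun m\<close>\<close>
    then have sc: "- 2 * sinh z * cosh z = - (\<rho> z)\<^sup>2 + (2 * \<rho> z * deriv \<rho> z) * (l - z)"
      using DERIV_branch_fun DERIV_unique by blast
    have F: "n z = \<rho> z * (2 * (z - l) * deriv N z + N z)" using N(2)[OF z] \<rho>0[OF z] by (simp add: field_simps)
    have "2 * (branch_fun m z * deriv (\<lambda>z. - 2 * N z / \<rho> z) z) = 2 * ((l - z) * (- 2 * deriv N z * \<rho> z + 2 * N z * deriv \<rho> z))"
      unfolding dE PR \<rho>(2)[OF z] using \<rho>0[OF z] by (simp add: power2_eq_square)
    also have "\<dots> = - (- 2 * sinh z * cosh z) * (- 2 * N z / \<rho> z) + 2 * n z"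
      unfolding sc F using \<rho>0[OF z] by (simp add: field_simps power2_eq_square)
    also have "\<dots> = 2 * (sinh z * cosh z * (- 2 * N z / \<rho> z) + n z)" by (simp add: algebra_simps)
    finally show "branch_fun m z * deriv (\<lambda>z. - 2 * N z / \<rho> z) z = sinh z * cosh z * (- 2 * N z / \<rho> z) + n z"
      by (simp only: mult_cancel_left) simp
  qed
qed

section \<open>The odd solution on the strip\<close>

text \<open>The real segment from 0 to the branch point, parametrised so that \<open>sqrt (branch_fun m) = sqrt m
  cos \<psi>\<close> is smooth up to the branch point at \<open>\<psi> = \<pi>/2\<close>.\<close>

definition real_path :: "real \<Rightarrow> real \<Rightarrow> real" where "real_path m \<psi> = arsinh (sqrt m * sin \<psi>)"

lemma DERIV_real_path:
  assumes "m > 0"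
  shows "(real_path m has_real_derivative sqrt m * cos \<psi> / sqrt (1 + m * (sin \<psi>)\<^sup>2)) (at \<psi>)"
proof -
  have "(sqrt m * sin \<psi>)\<^sup>2 + 1 = 1 + m * (sin \<psi>)\<^sup>2" using assms by (simp add: power_mult_distrib)
  moreover have "((\<lambda>\<psi>. arsinh (sqrt m * sin \<psi>)) has_real_derivative (1 / sqrt ((sqrt m * sin \<psi>)\<^sup>2 + 1)) * (sqrt m * cos \<psi>)) (at \<psi>)"
    by (rule DERIV_chain2[where f = arsinh and g = "\<lambda>\<psi>. sqrt m * sin \<psi>"]) (auto intro!: derivative_eq_intros)
  ultimately show ?thesis unfolding real_path_def[abs_def] by (simp add: add.commute)
qed

lemma sinh_real_path: "sinh (real_path m \<psi>) = sqrt m * sin \<psi>" unfolding real_path_def by simp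

lemma cosh_real_path: assumes "m > 0" shows "cosh (real_path m \<psi>) = sqrt (1 + m * (sin \<psi>)\<^sup>2)"
proof -
  have "(cosh (real_path m \<psi>))\<^sup>2 = 1 + m * (sin \<psi>)\<^sup>2" unfolding cosh_square_eq sinh_real_path using assms by (simp add: power_mult_distrib)
  then show ?thesis using cosh_real_pos[of "real_path m \<psi>"] by (metis real_sqrt_unique less_imp_le)
qed

lemma branch_fun_real_path: assumes "m > 0" shows "branch_fun m (of_real (real_path m \<psi>)) = of_real (m * (cos \<psi>)\<^sup>2)"
proof -
  have "branch_fun m (of_real (real_path m \<psi>)) = of_real (m - (sqrt m * sin \<psi>)\<^sup>2)"
    unfolding branch_fun_def sinh_complex_of_real sinh_real_path by simp
  also have "m - (sqrt m * sin \<psi>)\<^sup>2 = m * (cos \<psi>)\<^sup>2" using assms by (simp add: power_mult_distrib cos_squared_eq algebra_simps)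
  finally show ?thesis .
qed

lemma has_vector_derivative_comp_real:
  fixes E :: "complex \<Rightarrow> complex" and s :: "real \<Rightarrow> real"
  assumes "(E has_field_derivative E') (at (of_real (s x)))" "(s has_real_derivative s') (at x)"
  shows "((\<lambda>x. E (of_real (s x))) has_vector_derivative of_real s' * E') (at x)"
proof -
  have "((\<lambda>x. complex_of_real (s x)) has_vector_derivative of_real s') (at x)"
    using has_vector_derivative_of_real assms(2) has_real_derivative_iff_has_vector_derivative by blast
  from field_vector_diff_chain_at[OF this assms(1)] show ?thesis by (simp add: o_def)
qed

lemma quarter_period_zero:
  assumes m: "m > 0"
  shows "((\<lambda>\<psi>. (m * (sin \<psi>)\<^sup>2 - (m - period_ratio m)) / sqrt (1 + m * (sin \<psi>)\<^sup>2)) has_integral 0) {0..pi/2}"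
proof -
  have 1: "((\<lambda>\<psi>. 1 / sqrt (1 + m * (sin \<psi>)\<^sup>2)) has_integral period_K m) {0..pi/2}"
    unfolding period_K_def by (intro integrable_integral integrable_continuous_real continuous_on_subset[OF continuous_period_K_integrand[OF m]]) auto
  have 2: "((\<lambda>\<psi>. m * (cos \<psi>)\<^sup>2 / sqrt (1 + m * (sin \<psi>)\<^sup>2)) has_integral period_K1 m) {0..pi/2}"
    unfolding period_K1_def by (intro integrable_integral integrable_continuous_real continuous_on_subset[OF continuous_period_K1_integrand[OF m]]) auto
  have "((\<lambda>\<psi>. period_ratio m * (1 / sqrt (1 + m * (sin \<psi>)\<^sup>2)) - m * (cos \<psi>)\<^sup>2 / sqrt (1 + m * (sin \<psi>)\<^sup>2)) has_integral period_ratio m * period_K m - period_K1 m) {0..pi/2}"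
    by (intro has_integral_diff has_integral_mult_right 1 2)
  moreover have "period_ratio m * period_K m - period_K1 m = 0" unfolding period_ratio_def using period_K_pos[OF m] by simp
  moreover have "period_ratio m * (1 / sqrt (1 + m * (sin \<psi>)\<^sup>2)) - m * (cos \<psi>)\<^sup>2 / sqrt (1 + m * (sin \<psi>)\<^sup>2) = (m * (sin \<psi>)\<^sup>2 - (m - period_ratio m)) / sqrt (1 + m * (sin \<psi>)\<^sup>2)" for \<psi>
    unfolding cos_squared_eq by (simp add: diff_divide_distrib add_divide_distrib algebra_simps)
  ultimately show ?thesis by simp
qed

text \<open>The numerator of the normalised differential of the second kind.\<close>

definition form_num :: "real \<Rightarrow> complex \<Rightarrow> complex" where "form_num m z = (sinh z)\<^sup>2 - of_real (m - period_ratio m)"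

text \<open>Along the real segment, \<open>sqrt (branch_fun m) E\<close> is a primitive of the differential of the second
  kind, and it vanishes at the branch point. Its value at 0 is therefore a period of this
  differential, and the constant in \<open>form_num\<close> is chosen so that this period is zero.\<close>

lemma half_solution_at_zero:
  assumes m: "m > 0" and E: "E holomorphic_on right_half m"
    and eq: "\<And>z. z \<in> right_half m \<Longrightarrow> branch_fun m z * deriv E z = sinh z * cosh z * E z + form_num m z"
  shows "E 0 = 0"
proof -
  let ?c = "\<lambda>\<psi>. sqrt m * cos \<psi>"
  let ?g = "\<lambda>\<psi>. (m * (sin \<psi>)\<^sup>2 - (m - period_ratio m)) / sqrt (1 + m * (sin \<psi>)\<^sup>2)"
  let ?f = "\<lambda>\<psi>. complex_of_real (?c \<psi>) * E (of_real (real_path m \<psi>))"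
  have lpos: "arsinh (sqrt m) > 0" using m by (metis arsinh_0 arsinh_real_strict_mono real_sqrt_gt_0_iff)
  have sgpos: "real_path m \<psi> \<ge> 0" if "0 \<le> \<psi>" "\<psi> \<le> pi/2" for \<psi>
  proof -
    have "sin \<psi> \<ge> 0" using that by (intro sin_ge_zero) auto
    then show ?thesis using sinh_real_path[of m \<psi>] m by (metis mult_nonneg_nonneg real_sqrt_ge_zero less_imp_le sinh_real_nonneg_iff)
  qed
  have mem: "of_real (real_path m \<psi>) \<in> right_half m" if "0 \<le> \<psi>" "\<psi> \<le> pi/2" for \<psi>
  proof -
    have "- arsinh (sqrt m) < real_path m \<psi>" using sgpos[OF that] lpos by linarith
    then show ?thesis unfolding right_half_def strip_def by simp
  qed
  have "((\<lambda>\<psi>. of_real (?g \<psi>)) has_integral ?f (pi/2) - ?f 0) {0..pi/2}"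
  proof (rule fundamental_theorem_of_calculus_interior)
    have "continuous_on {0..pi/2} (\<lambda>\<psi>. complex_of_real (real_path m \<psi>))"
      by (intro continuous_on_of_real DERIV_continuous_on[OF has_field_derivative_at_within[OF DERIV_real_path[OF m]]])
    then show "continuous_on {0..pi/2} ?f"
      by (intro continuous_intros continuous_on_compose2[OF holomorphic_on_imp_continuous_on[OF E]]) (use mem in auto)
    fix \<psi> :: real assume \<psi>: "\<psi> \<in> {0<..<pi/2}"
    then have \<psi>': "0 \<le> \<psi>" "\<psi> \<le> pi/2" by auto
    define v where "v = sqrt (1 + m * (sin \<psi>)\<^sup>2)"
    have v: "v > 0" "cosh (real_path m \<psi>) = v" unfolding v_def using cont_sq_pos[OF m, of \<psi>] cosh_real_path[OF m] by auto
    have c0: "?c \<psi> \<noteq> 0" using m \<psi> cos_gt_zero_pi[of \<psi>] by auto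
    let ?z = "complex_of_real (real_path m \<psi>)"
    have 1: "((\<lambda>\<psi>. E (of_real (real_path m \<psi>))) has_vector_derivative of_real (?c \<psi> / v) * deriv E ?z) (at \<psi>)"
      unfolding v_def by (rule has_vector_derivative_comp_real[OF holomorphic_derivI[OF E open_right_half mem[OF \<psi>']] DERIV_real_path[OF m]])
    have 2: "((\<lambda>\<psi>. complex_of_real (?c \<psi>)) has_vector_derivative of_real (- sqrt m * sin \<psi>)) (at \<psi>)"
      by (intro has_vector_derivative_of_real) (auto intro!: derivative_eq_intros simp flip: has_real_derivative_iff_has_vector_derivative)
    have "(?f has_vector_derivative (of_real (?c \<psi>) * (of_real (?c \<psi> / v) * deriv E ?z) + of_real (- sqrt m * sin \<psi>) * E ?z)) (at \<psi>)"
      by (rule has_vector_derivative_mult[OF 2 1])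
    also have "of_real (?c \<psi>) * (of_real (?c \<psi> / v) * deriv E ?z) + of_real (- sqrt m * sin \<psi>) * E ?z = of_real (?g \<psi>)"
    proof -
      have "m * (cos \<psi>)\<^sup>2 = ?c \<psi> * ?c \<psi>" using m by (simp add: power2_eq_square)
      then have "of_real (?c \<psi>) * (of_real (?c \<psi> / v) * deriv E ?z) = branch_fun m ?z * deriv E ?z / of_real v"
        unfolding branch_fun_real_path[OF m] using v by (simp add: field_simps)
      also have "\<dots> = (of_real (sqrt m * sin \<psi>) * of_real v * E ?z + form_num m ?z) / of_real v"
        unfolding eq[OF mem[OF \<psi>']] sinh_complex_of_real cosh_complex_of_real sinh_real_path v(2) by simp
      also have "form_num m ?z = of_real (m * (sin \<psi>)\<^sup>2 - (m - period_ratio m))"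
        unfolding form_num_def sinh_complex_of_real sinh_real_path using m by (simp add: power_mult_distrib flip: of_real_power)
      finally show ?thesis using v(1) unfolding v_def[symmetric] by (simp add: field_simps)
    qed
    finally show "(?f has_vector_derivative of_real (?g \<psi>)) (at \<psi>)" .
  qed simp
  moreover have "((\<lambda>\<psi>. complex_of_real (?g \<psi>)) has_integral of_real 0) {0..pi/2}"
    by (rule has_integral_of_real[OF quarter_period_zero[OF m]])
  ultimately have "?f (pi/2) - ?f 0 = of_real 0" by (rule has_integral_unique)
  then show ?thesis using m by (simp add: real_path_def)
qed

text \<open>The solution \<open>G\<close> that is holomorphic at the right branch point and its odd reflection \<open>- G (-
  z)\<close>, which is holomorphic at the left one, solve the same equation and both vanish at 0, so they
  agree on the overlap and define a solution on the strip. Uniqueness of the solution that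
  vanishes at 0 also gives the symmetries.\<close>

lemma elliptic_primitive:
  assumes m: "m > 0"
  obtains E where "E holomorphic_on strip"
    "\<And>z. z \<in> strip \<Longrightarrow> branch_fun m z * deriv E z = sinh z * cosh z * E z + form_num m z"
    "\<And>z. z \<in> strip \<Longrightarrow> E (- z) = - E z" "\<And>z. z \<in> strip \<Longrightarrow> E (cnj z) = cnj (E z)"
proof -
  have "form_num m holomorphic_on UNIV" unfolding form_num_def[abs_def]
    by (rule holomorphic_on_open[THEN iffD2]) (auto intro!: derivative_eq_intros exI)
  from half_solution[OF m this] obtain G where G: "G holomorphic_on right_half m"
    and eqG: "\<And>z. z \<in> right_half m \<Longrightarrow> branch_fun m z * deriv G z = sinh z * cosh z * G z + form_num m z" by blast
  have G0: "G 0 = 0" by (rule half_solution_at_zero[OF m G eqG])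
  have lpos: "arsinh (sqrt m) > 0" using m by (metis arsinh_0 arsinh_real_strict_mono real_sqrt_gt_0_iff)
  define left_half where "left_half = uminus ` right_half m"
  have left_half: "z \<in> left_half \<longleftrightarrow> - z \<in> right_half m" for z unfolding left_half_def by (metis image_iff minus_minus)
  have conv': "convex left_half" "open left_half" unfolding left_half_def using convex_right_half open_right_half by (auto simp: convex_negations open_negations)
  have PPm: "branch_fun m (- z) = branch_fun m z" for z unfolding branch_fun_def by simp
  have nnm: "form_num m (- z) = form_num m z" for z unfolding form_num_def by simp
  have DG: "(G has_field_derivative deriv G z) (at z)" if "z \<in> right_half m" for z
    using holomorphic_derivI[OF G open_right_half that] .
  have DGm: "((\<lambda>z. - G (- z)) has_field_derivative deriv G (- z)) (at z)" if "z \<in> left_half" for z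
  proof -
    have "((\<lambda>z. - G (- z)) has_field_derivative - (deriv G (- z) * (- 1))) (at z)"
      by (intro DERIV_minus DERIV_chain2[where f = G and g = uminus] DG) (use that left_half in \<open>auto intro!: derivative_eq_intros\<close>)
    then show ?thesis by simp
  qed
  have overlap: "G z = - G (- z)" if z: "z \<in> right_half m" "z \<in> left_half" for z
  proof -
    have "G z - (- G (- z)) = 0"
    proof (rule homogeneous_eq_zero[OF m, where U = "right_half m \<inter> left_half" and D = "\<lambda>z. G z - (- G (- z))" and D' = "\<lambda>z. deriv G z - deriv G (- z)"])
      show "convex (right_half m \<inter> left_half)" "open (right_half m \<inter> left_half)" using conv' convex_right_half open_right_half by (auto intro: convex_Int)
      show "0 \<in> right_half m \<inter> left_half" using lpos by (simp add: left_half right_half_def strip_def)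
      show "((\<lambda>z. G z - (- G (- z))) has_field_derivative deriv G z - deriv G (- z)) (at z)" if "z \<in> right_half m \<inter> left_half" for z
        using that by (intro DERIV_diff DG DGm) auto
      show "branch_fun m z * (deriv G z - deriv G (- z)) = sinh z * cosh z * (G z - (- G (- z)))" if "z \<in> right_half m \<inter> left_half" for z
        using eqG[of z] eqG[of "- z"] that unfolding left_half PPm nnm by (simp add: algebra_simps left_half)
    qed (use z G0 in auto)
    then show ?thesis by (simp add: eq_neg_iff_add_eq_0)
  qed
  have un: "right_half m \<union> left_half = strip"
  proof -
    have "- arsinh (sqrt m) < x \<or> - arsinh (sqrt m) < - x" for x using lpos by linarith
    then show ?thesis unfolding set_eq_iff by (auto simp: left_half right_half_def strip_def)
  qed
  define E where "E z = (if z \<in> right_half m then G z else - G (- z))" for z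
  have hol': "(\<lambda>z. - G (- z)) holomorphic_on left_half" using DGm conv'(2) by (auto simp: holomorphic_on_open)
  have E: "E holomorphic_on strip" unfolding E_def un[symmetric]
    by (rule holomorphic_on_If_Un[OF G hol' open_right_half conv'(2) overlap])
  have E1: "E z = G z" if "z \<in> right_half m" for z using that unfolding E_def by simp
  have E2: "E z = - G (- z)" if "z \<in> left_half" for z using that overlap[of z] unfolding E_def by simp
  have DE: "(E has_field_derivative deriv E z) (at z)" if "z \<in> strip" for z
    using holomorphic_derivI[OF E open_strip that] .
  have eqE: "branch_fun m z * deriv E z = sinh z * cosh z * E z + form_num m z" if z: "z \<in> strip" for z
  proof (cases "z \<in> right_half m")
    case True
    have "(E has_field_derivative deriv G z) (at z)"
      by (rule has_field_derivative_transform_within_open[OF DG[OF True] open_right_half True]) (simp add: E1)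
    then have "deriv E z = deriv G z" by (rule DERIV_imp_deriv)
    then show ?thesis using eqG[OF True] E1[OF True] by simp
  next
    case False
    then have z': "z \<in> left_half" using un z by auto
    have "(E has_field_derivative deriv G (- z)) (at z)"
      by (rule has_field_derivative_transform_within_open[OF DGm[OF z'] conv'(2) z']) (simp add: E2)
    then have "deriv E z = deriv G (- z)" by (rule DERIV_imp_deriv)
    then show ?thesis using eqG[of "- z"] E2[OF z'] z' unfolding left_half PPm nnm by simp
  qed
  have z0: "0 \<in> strip" unfolding strip_def by simp
  have E0: "E 0 = 0" unfolding E_def using G0 by simp
  have odd: "E (- z) = - E z" if z: "z \<in> strip" for z
  proof -
    have neg: "- w \<in> strip" if "w \<in> strip" for w using that unfolding strip_def by simp
    have "E z + E (- z) = 0"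
    proof (rule homogeneous_eq_zero[OF m convex_strip open_strip z0, where D = "\<lambda>z. E z + E (- z)" and D' = "\<lambda>z. deriv E z - deriv E (- z)"])
      fix w assume w: "w \<in> strip"
      have "((\<lambda>z. E z + E (- z)) has_field_derivative deriv E w + deriv E (- w) * (- 1)) (at w)"
        by (intro DERIV_add DERIV_chain2[where f = E and g = uminus] DE neg w) (auto intro!: derivative_eq_intros)
      then show "((\<lambda>z. E z + E (- z)) has_field_derivative deriv E w - deriv E (- w)) (at w)" by simp
      show "branch_fun m w * (deriv E w - deriv E (- w)) = sinh w * cosh w * (E w + E (- w))"
        using eqE[OF w] eqE[OF neg[OF w]] unfolding PPm nnm by (simp add: algebra_simps)
    qed (use E0 z in auto)
    then show ?thesis by (simp add: add_eq_0_iff)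
  qed
  have real: "E (cnj z) = cnj (E z)" if z: "z \<in> strip" for z
  proof -
    have neg: "cnj w \<in> strip" if "w \<in> strip" for w using that unfolding strip_def by simp
    have "E z - cnj (E (cnj z)) = 0"
    proof (rule homogeneous_eq_zero[OF m convex_strip open_strip z0, where D = "\<lambda>z. E z - cnj (E (cnj z))" and D' = "\<lambda>z. deriv E z - cnj (deriv E (cnj z))"])
      fix w assume w: "w \<in> strip"
      have "((cnj \<circ> E \<circ> cnj) has_field_derivative cnj (deriv E (cnj w))) (at w)"
        by (rule has_field_derivative_cnj_cnj) (simp add: DE neg w)
      then show "((\<lambda>z. E z - cnj (E (cnj z))) has_field_derivative deriv E w - cnj (deriv E (cnj w))) (at w)"
        by (intro DERIV_diff DE w) (simp add: o_def)
      have sc: "cnj (sinh (cnj w)) = sinh w" "cnj (cosh (cnj w)) = cosh w"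
        by (simp_all add: sinh_field_def cosh_field_def exp_cnj)
      have "cnj (branch_fun m (cnj w) * deriv E (cnj w)) = cnj (sinh (cnj w) * cosh (cnj w) * E (cnj w) + form_num m (cnj w))"
        using eqE[OF neg[OF w]] by simp
      then have "branch_fun m w * cnj (deriv E (cnj w)) = sinh w * cosh w * cnj (E (cnj w)) + form_num m w"
        unfolding branch_fun_def form_num_def by (simp add: sc)
      then show "branch_fun m w * (deriv E w - cnj (deriv E (cnj w))) = sinh w * cosh w * (E w - cnj (E (cnj w)))"
        using eqE[OF w] by (simp add: algebra_simps)
    qed (use E0 z in auto)
    then show ?thesis by (metis complex_cnj_cnj eq_iff_diff_eq_0)
  qed
  show ?thesis using that[OF E eqE odd real] .
qed

section \<open>Values on the imaginary axis and descent to the punctured plane\<close>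

lemma DERIV_axis_root_t:
  assumes "m > 0"
  shows "(axis_root m has_real_derivative sin t * cos t / axis_root m t) (at t)"
proof -
  have "((\<lambda>t. m + (sin t)\<^sup>2) has_real_derivative 2 * sin t * cos t) (at t)" by (auto intro!: derivative_eq_intros)
  then have "(axis_root m has_real_derivative inverse (axis_root m t) / 2 * (2 * sin t * cos t)) (at t)"
    unfolding axis_root_def[abs_def] by (rule DERIV_chain2[where f = sqrt and g = "\<lambda>t. m + (sin t)\<^sup>2", OF DERIV_real_sqrt[OF sum_sq_pos[OF assms]]])
  then show ?thesis by (simp add: field_simps)
qed

lemma continuous_axis_integral: "m > 0 \<Longrightarrow> continuous_on {0..b} (axis_integral m)"
  unfolding axis_integral_def[abs_def]
  by (intro indefinite_integral_continuous_1 integrable_continuous_real continuous_on_subset[OF continuous_axis_integral_integrand]) auto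

lemma axis_integral_zero: "axis_integral m 0 = 0" unfolding axis_integral_def by simp

lemma const_on_interval:
  fixes f :: "real \<Rightarrow> 'a::banach"
  assumes "a \<le> b" "continuous_on {a..b} f" "\<And>x. a < x \<Longrightarrow> x < b \<Longrightarrow> (f has_vector_derivative 0) (at x)"
  shows "f b = f a"
proof -
  have "((\<lambda>x. 0) has_integral f b - f a) {a..b}"
    by (rule fundamental_theorem_of_calculus_interior) (use assms in auto)
  then show ?thesis by (metis has_integral_0_eq eq_iff_diff_eq_0)
qed

lemma axis_integral_add_pi:
  assumes m: "m > 0" and b: "b \<ge> 0"
  shows "axis_integral m (b + pi) = axis_integral m b + circle_period m"
proof -
  have "axis_integral m (b + pi) - axis_integral m b = axis_integral m (0 + pi) - axis_integral m 0"
  proof (rule const_on_interval[of 0 b "\<lambda>x. axis_integral m (x + pi) - axis_integral m x"])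
    show "continuous_on {0..b} (\<lambda>x. axis_integral m (x + pi) - axis_integral m x)"
      by (intro continuous_intros continuous_axis_integral[OF m] continuous_on_compose2[OF continuous_axis_integral[OF m, of "b + pi"]]) auto
    fix x assume x: "0 < x" "x < b"
    have "((\<lambda>x. axis_integral m (x + pi)) has_real_derivative (m - period_ratio m + (sin (x + pi))\<^sup>2) / axis_root m (x + pi) * 1) (at x)"
      by (rule DERIV_chain2[where f = "axis_integral m" and g = "\<lambda>x. x + pi", OF DERIV_axis_integral_t[OF m]]) (use x in \<open>auto intro!: derivative_eq_intros add_pos_pos\<close>)
    moreover have "(axis_integral m has_real_derivative (m - period_ratio m + (sin x)\<^sup>2) / axis_root m x) (at x)" using DERIV_axis_integral_t[OF m x(1)] .
    ultimately have "((\<lambda>x. axis_integral m (x + pi) - axis_integral m x) has_real_derivative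
       (m - period_ratio m + (sin (x + pi))\<^sup>2) / axis_root m (x + pi) * 1 - (m - period_ratio m + (sin x)\<^sup>2) / axis_root m x) (at x)" by (rule DERIV_diff)
    then show "((\<lambda>x. axis_integral m (x + pi) - axis_integral m x) has_vector_derivative 0) (at x)"
      unfolding has_real_derivative_iff_has_vector_derivative by (simp add: axis_root_def)
  qed (use b in simp)
  then show ?thesis unfolding circle_period_def axis_integral_zero by simp
qed

text \<open>The integrand is symmetric about \<open>\<pi>/2\<close>.\<close>

lemma axis_integral_half: assumes m: "m > 0" shows "2 * axis_integral m (pi/2) = circle_period m"
proof -
  have "axis_integral m (pi - pi/2) + axis_integral m (pi/2) = axis_integral m (pi - 0) + axis_integral m 0"
  proof (rule const_on_interval[of 0 "pi/2" "\<lambda>x. axis_integral m (pi - x) + axis_integral m x"])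
    show "continuous_on {0..pi/2} (\<lambda>x. axis_integral m (pi - x) + axis_integral m x)"
      by (intro continuous_intros continuous_axis_integral[OF m] continuous_on_compose2[OF continuous_axis_integral[OF m, of pi]]) auto
    fix x assume x: "0 < x" "x < pi/2"
    have "((\<lambda>x. axis_integral m (pi - x)) has_real_derivative (m - period_ratio m + (sin (pi - x))\<^sup>2) / axis_root m (pi - x) * (- 1)) (at x)"
      by (rule DERIV_chain2[where f = "axis_integral m" and g = "\<lambda>x. pi - x", OF DERIV_axis_integral_t[OF m]]) (use x in \<open>auto intro!: derivative_eq_intros\<close>)
    moreover have "(axis_integral m has_real_derivative (m - period_ratio m + (sin x)\<^sup>2) / axis_root m x) (at x)" using DERIV_axis_integral_t[OF m x(1)] .
    ultimately have "((\<lambda>x. axis_integral m (pi - x) + axis_integral m x) has_real_derivative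
       (m - period_ratio m + (sin (pi - x))\<^sup>2) / axis_root m (pi - x) * (- 1) + (m - period_ratio m + (sin x)\<^sup>2) / axis_root m x) (at x)" by (rule DERIV_add)
    then show "((\<lambda>x. axis_integral m (pi - x) + axis_integral m x) has_vector_derivative 0) (at x)"
      unfolding has_real_derivative_iff_has_vector_derivative by (simp add: axis_root_def)
  qed simp
  then show ?thesis unfolding circle_period_def axis_integral_zero by simp
qed

lemma sinh_i: "sinh (\<i> * of_real y) = \<i> * of_real (sin y)"
  by (simp add: sinh_conv_sin mult.assoc[symmetric] sin_of_real[symmetric])
lemma cosh_i: "cosh (\<i> * of_real y) = of_real (cos y)"
  by (simp add: cosh_conv_cos mult.assoc[symmetric] cos_of_real[symmetric])

lemma branch_fun_i: assumes "m > 0" shows "branch_fun m (\<i> * of_real y) = of_real ((axis_root m y)\<^sup>2)"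
  unfolding branch_fun_def sinh_i axis_root_sq[OF assms] by (simp add: power_mult_distrib)

lemma csqrt_branch_fun_i: assumes "m > 0" shows "csqrt (branch_fun m (\<i> * of_real y)) = of_real (axis_root m y)"
  unfolding branch_fun_i[OF assms] using axis_root_pos[OF assms, of y] by (subst csqrt_of_real) auto

text \<open>Both sides vanish at 0 and have the same derivative in \<open>y\<close>.\<close>

lemma primitive_imag_axis:
  assumes m: "m > 0" and E: "E holomorphic_on strip"
    and eq: "\<And>z. z \<in> strip \<Longrightarrow> branch_fun m z * deriv E z = sinh z * cosh z * E z + form_num m z"
    and E0: "E 0 = 0" and y: "0 \<le> y" "y < pi"
  shows "of_real (axis_root m y) * E (\<i> * of_real y) = - \<i> * of_real (axis_integral m y)"
proof -
  let ?h = "\<lambda>y. of_real (axis_root m y) * E (\<i> * of_real y) + \<i> * of_real (axis_integral m y)"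
  have mem: "\<i> * of_real x \<in> strip" if "0 \<le> x" "x \<le> y" for x using that y unfolding strip_def by simp
  have "?h y = ?h 0"
  proof (rule const_on_interval[OF y(1)])
    show "continuous_on {0..y} ?h"
      by (intro continuous_intros continuous_on_subset[OF continuous_axis_root] continuous_axis_integral[OF m] continuous_on_compose2[OF holomorphic_on_imp_continuous_on[OF E]])
        (use mem in auto)
    fix x assume x: "0 < x" "x < y"
    let ?z = "\<i> * complex_of_real x"
    define d where "d = axis_root m x"
    have d: "d > 0" "branch_fun m ?z = of_real d * of_real d" unfolding d_def branch_fun_i[OF m] using axis_root_pos[OF m] by (auto simp: power2_eq_square)
    have zm: "?z \<in> strip" using mem x by simp
    have "((\<lambda>y. \<i> * complex_of_real y) has_vector_derivative \<i>) (at x)"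
      by (auto intro!: derivative_eq_intros)
    from field_vector_diff_chain_at[OF this holomorphic_derivI[OF E open_strip zm]]
    have 1: "((\<lambda>y. E (\<i> * of_real y)) has_vector_derivative \<i> * deriv E ?z) (at x)" by (simp add: o_def)
    have 2: "((\<lambda>y. complex_of_real (axis_root m y)) has_vector_derivative of_real (sin x * cos x / d)) (at x)"
      using DERIV_axis_root_t[OF m, of x] unfolding d_def
      by (intro has_vector_derivative_of_real) (simp add: has_real_derivative_iff_has_vector_derivative)
    have 3: "((\<lambda>y. complex_of_real (axis_integral m y)) has_vector_derivative of_real ((m - period_ratio m + (sin x)\<^sup>2) / d)) (at x)"
      using DERIV_axis_integral_t[OF m x(1)] unfolding d_def
      by (intro has_vector_derivative_of_real) (simp add: has_real_derivative_iff_has_vector_derivative)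
    have "(?h has_vector_derivative ((of_real d * (\<i> * deriv E ?z) + of_real (sin x * cos x / d) * E ?z) + \<i> * of_real ((m - period_ratio m + (sin x)\<^sup>2) / d))) (at x)"
      unfolding d_def by (intro has_vector_derivative_add has_vector_derivative_mult_right has_vector_derivative_mult 1[unfolded d_def] 2[unfolded d_def] 3[unfolded d_def])
    also have "((of_real d * (\<i> * deriv E ?z) + of_real (sin x * cos x / d) * E ?z) + \<i> * of_real ((m - period_ratio m + (sin x)\<^sup>2) / d)) = 0"
    proof -
      have "of_real d * of_real d * deriv E ?z = \<i> * of_real (sin x) * of_real (cos x) * E ?z - of_real ((sin x)\<^sup>2 + (m - period_ratio m))"
        using eq[OF zm] unfolding d(2) form_num_def sinh_i cosh_i by (simp add: power_mult_distrib algebra_simps)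
      then have "of_real d * deriv E ?z = (\<i> * of_real (sin x) * of_real (cos x) * E ?z - of_real ((sin x)\<^sup>2 + (m - period_ratio m))) / of_real d"
        using d(1) by (simp add: field_simps)
      then have *: "of_real d * (\<i> * deriv E ?z) = \<i> * ((\<i> * of_real (sin x) * of_real (cos x) * E ?z - of_real ((sin x)\<^sup>2 + (m - period_ratio m))) / of_real d)"
        by (simp only: mult.left_commute[of _ \<i>])
      show ?thesis unfolding * using d(1) by (simp add: divide_simps) (simp add: algebra_simps)
    qed
    finally show "(?h has_vector_derivative 0) (at x)" .
  qed
  then show ?thesis using E0 by (simp add: axis_integral_zero eq_neg_iff_add_eq_0)
qed

lemma sinh_minus_i_pi: "sinh (z - \<i> * of_real pi) = - sinh z" "cosh (z - \<i> * of_real pi) = - cosh z"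
  by (simp_all add: sinh_field_def cosh_field_def exp_diff exp_minus field_simps)

lemma branch_fun_minus_i_pi: "branch_fun m (z - \<i> * of_real pi) = branch_fun m z" "form_num m (z - \<i> * of_real pi) = form_num m z"
  unfolding branch_fun_def form_num_def sinh_minus_i_pi by simp_all

lemma branch_fun_not_nonpos: "m > 0 \<Longrightarrow> 0 < Im z \<Longrightarrow> Im z < pi \<Longrightarrow> branch_fun m z \<notin> \<real>\<^sub>\<le>\<^sub>0"
  using branch_fun_real_nonpos[of m z] sin_gt_zero[of "Im z"] by auto

lemma DERIV_csqrt_branch_fun:
  assumes "branch_fun m z \<notin> \<real>\<^sub>\<le>\<^sub>0"
  shows "((\<lambda>z. csqrt (branch_fun m z)) has_field_derivative - (sinh z * cosh z) / csqrt (branch_fun m z)) (at z within A)"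
  using has_field_derivative_csqrt'[OF DERIV_branch_fun assms] by (simp add: field_simps)

text \<open>\<open>E z\<close> and \<open>E (z - \<pi> \<i>)\<close> satisfy equations with the same coefficients, so the left-hand side is
  constant on the upper half of the strip. At \<open>z = \<pi> \<i> / 2\<close> the oddness of \<open>E\<close> makes it twice a
  value known from the imaginary axis.\<close>

lemma primitive_shift:
  assumes m: "m > 0" and E: "E holomorphic_on strip"
    and eq: "\<And>z. z \<in> strip \<Longrightarrow> branch_fun m z * deriv E z = sinh z * cosh z * E z + form_num m z"
    and odd: "\<And>z. z \<in> strip \<Longrightarrow> E (- z) = - E z"
    and z: "0 < Im z" "Im z < pi"
  shows "csqrt (branch_fun m z) * (E z - E (z - \<i> * of_real pi)) = - \<i> * of_real (circle_period m)"
proof -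
  define U where "U = {z. 0 < Im z} \<inter> {z. Im z < pi}"
  have U: "convex U" unfolding U_def by (intro convex_Int convex_halfspace_Im_lt convex_halfspace_Im_gt)
  let ?V = "\<lambda>z. csqrt (branch_fun m z)"
  let ?D = "\<lambda>z. E z - E (z - \<i> * of_real pi)"
  have "((\<lambda>z. ?V z * ?D z) has_field_derivative 0) (at z within U)" if z: "z \<in> U" for z
  proof -
    have np: "branch_fun m z \<notin> \<real>\<^sub>\<le>\<^sub>0" using z branch_fun_not_nonpos[OF m] unfolding U_def by simp
    then have V0: "?V z \<noteq> 0" by auto
    have z1: "z \<in> strip" "z - \<i> * of_real pi \<in> strip" using z unfolding U_def strip_def by auto
    define e1 where "e1 = deriv E z"
    define e2 where "e2 = deriv E (z - \<i> * of_real pi)"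
    have D1: "(E has_field_derivative e1) (at z)" unfolding e1_def by (rule holomorphic_derivI[OF E open_strip z1(1)])
    have D2: "(E has_field_derivative e2) (at (z - \<i> * of_real pi))" unfolding e2_def by (rule holomorphic_derivI[OF E open_strip z1(2)])
    have "((\<lambda>z. E (z - \<i> * of_real pi)) has_field_derivative e2 * 1) (at z)"
      by (rule DERIV_chain2[where f = E and g = "\<lambda>z. z - \<i> * of_real pi", OF D2]) (auto intro!: derivative_eq_intros)
    then have "(?D has_field_derivative e1 - e2) (at z)" using D1 by (auto intro: DERIV_diff)
    then have "((\<lambda>z. ?V z * ?D z) has_field_derivative (- (sinh z * cosh z) / ?V z) * ?D z + (e1 - e2) * ?V z) (at z)"
      by (rule DERIV_mult[OF DERIV_csqrt_branch_fun[OF np]])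
    also have "(- (sinh z * cosh z) / ?V z) * ?D z + (e1 - e2) * ?V z = (branch_fun m z * (e1 - e2) - sinh z * cosh z * ?D z) / ?V z"
    proof -
      have "(e1 - e2) * ?V z = (?V z)\<^sup>2 * (e1 - e2) / ?V z" using V0 by (simp add: power2_eq_square)
      then show ?thesis by (simp add: diff_divide_distrib)
    qed
    also have "branch_fun m z * (e1 - e2) = sinh z * cosh z * ?D z"
      using eq[OF z1(1)] eq[OF z1(2)] unfolding e1_def e2_def branch_fun_minus_i_pi sinh_minus_i_pi by (simp add: algebra_simps)
    finally show ?thesis by (auto intro: has_field_derivative_at_within)
  qed
  then obtain c where c: "\<And>z. z \<in> U \<Longrightarrow> ?V z * ?D z = c"
    using has_field_derivative_zero_constant[OF U, of "\<lambda>z. ?V z * ?D z"] by blast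
  let ?i = "\<i> * complex_of_real (pi/2)"
  have E0: "E 0 = 0" using odd[of 0] unfolding strip_def by simp
  have i: "?i \<in> U" "?i \<in> strip" unfolding U_def strip_def by simp_all
  have neg: "?i - \<i> * of_real pi = - ?i" by simp
  have "c = of_real (axis_root m (pi/2)) * (E ?i - - E ?i)"
    using c[OF i(1)] unfolding csqrt_branch_fun_i[OF m] neg odd[OF i(2)] by (rule sym)
  also have "\<dots> = 2 * (of_real (axis_root m (pi/2)) * E ?i)" by (simp only: diff_minus_eq_add mult_2 distrib_left)
  also have "\<dots> = - \<i> * of_real (2 * axis_integral m (pi/2))"
    using primitive_imag_axis[OF m E eq E0, of "pi/2"] by simp
  finally have "c = - \<i> * of_real (circle_period m)" unfolding axis_integral_half[OF m] .
  moreover have "z \<in> U" using z unfolding U_def by simp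
  ultimately show ?thesis using c by simp
qed

text \<open>The functions \<open>cosh w\<close> and \<open>sinh w / w\<close> are even in \<open>w\<close>, hence entire functions of \<open>u = w\<^sup>2\<close>.
  Composed with \<open>u = branch_fun m z * (A z)\<^sup>2\<close> they give the even and the odd part of \<open>exp (sqrt
  (branch_fun m z) * A z)\<close> under the change of sign of the root, without any branch. The second
  function is obtained as a derivative, because \<open>d (cosh (sqrt u)) / du = sinh (sqrt u) / (2 sqrt
  u)\<close>.\<close>

definition cosh_sqrt :: "complex \<Rightarrow> complex" where "cosh_sqrt u = cosh (csqrt u)"
definition sinhc_sqrt :: "complex \<Rightarrow> complex" where "sinhc_sqrt u = 2 * deriv cosh_sqrt u"

lemma cosh_sqrt_square: "cosh_sqrt (w\<^sup>2) = cosh w"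
proof -
  have "(csqrt (w\<^sup>2))\<^sup>2 = w\<^sup>2" by simp
  then have "csqrt (w\<^sup>2) = w \<or> csqrt (w\<^sup>2) = - w" unfolding power2_eq_iff .
  then show ?thesis unfolding cosh_sqrt_def by auto
qed

text \<open>Away from 0 one of the two expressions \<open>cosh (csqrt u)\<close> and \<open>cos (csqrt (- u))\<close> avoids the cut
  of the square root; at 0 continuity suffices.\<close>

lemma cosh_sqrt_holomorphic: "cosh_sqrt holomorphic_on UNIV"
proof (rule no_isolated_singularity[where K = "{0}"])
  have A: "(\<lambda>u. cosh (csqrt u)) holomorphic_on - \<real>\<^sub>\<le>\<^sub>0"
    unfolding cosh_conv_cos by (intro holomorphic_intros) auto
  have eq: "cosh_sqrt u = cos (csqrt (- u))" for u
    using cosh_sqrt_square[of "\<i> * csqrt (- u)"] by (simp add: cosh_conv_cos power_mult_distrib mult.assoc[symmetric])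
  have B: "(\<lambda>u. cos (csqrt (- u))) holomorphic_on {u. - u \<notin> \<real>\<^sub>\<le>\<^sub>0}"
    by (intro holomorphic_intros) auto
  have "cosh_sqrt holomorphic_on (- \<real>\<^sub>\<le>\<^sub>0) \<union> {u. - u \<notin> \<real>\<^sub>\<le>\<^sub>0}"
  proof (rule holomorphic_on_Un)
    show "cosh_sqrt holomorphic_on - \<real>\<^sub>\<le>\<^sub>0" using A unfolding cosh_sqrt_def[abs_def] .
    show "cosh_sqrt holomorphic_on {u. - u \<notin> \<real>\<^sub>\<le>\<^sub>0}" using B unfolding eq[abs_def] .
    show "open (- \<real>\<^sub>\<le>\<^sub>0 :: complex set)" by auto
    have "open (uminus -` (- \<real>\<^sub>\<le>\<^sub>0 :: complex set))" by (intro open_vimage continuous_intros) auto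
    then show "open {u::complex. - u \<notin> \<real>\<^sub>\<le>\<^sub>0}" by (simp add: vimage_def)
  qed
  moreover have "(- \<real>\<^sub>\<le>\<^sub>0) \<union> {u. - u \<notin> \<real>\<^sub>\<le>\<^sub>0} = UNIV - {0::complex}"
    by (auto simp: complex_nonpos_Reals_iff complex_eq_iff)
  ultimately show hol: "cosh_sqrt holomorphic_on UNIV - {0}" by simp
  have "isCont cosh_sqrt u" for u
  proof (cases "u = 0")
    case True
    have "((\<lambda>u. csqrt u) \<longlongrightarrow> 0) (at 0)"
    proof (rule tendsto_norm_zero_cancel)
      have "((\<lambda>u::complex. sqrt (cmod u)) \<longlongrightarrow> sqrt (cmod 0)) (at 0)" by (intro tendsto_intros)
      then show "((\<lambda>u. cmod (csqrt u)) \<longlongrightarrow> 0) (at 0)" by simp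
    qed
    then have "((\<lambda>u. cos (\<i> * csqrt u)) \<longlongrightarrow> cos (\<i> * 0)) (at 0)" by (intro tendsto_intros)
    then show ?thesis unfolding True isCont_def cosh_sqrt_def[abs_def] cosh_conv_cos by simp
  next
    case False
    then show ?thesis using hol by (metis (no_types) Diff_iff UNIV_I continuous_on_eq_continuous_at holomorphic_on_imp_continuous_on open_UNIV open_delete singletonD)
  qed
  then show "continuous_on UNIV cosh_sqrt" by (simp add: continuous_at_imp_continuous_on)
qed auto

lemma DERIV_cosh_sqrt: "(cosh_sqrt has_field_derivative sinhc_sqrt u / 2) (at u)"
  unfolding sinhc_sqrt_def using holomorphic_derivI[OF cosh_sqrt_holomorphic open_UNIV, of u] by simp

lemma sinhc_sqrt_holomorphic: "sinhc_sqrt holomorphic_on UNIV"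
  unfolding sinhc_sqrt_def[abs_def] by (intro holomorphic_intros cosh_sqrt_holomorphic) auto

lemma sinhc_sqrt_square: "w * sinhc_sqrt (w\<^sup>2) = sinh w"
proof -
  have "((\<lambda>w. cosh_sqrt (w\<^sup>2)) has_field_derivative (sinhc_sqrt (w\<^sup>2) / 2) * (2 * w)) (at w)"
    by (rule DERIV_chain2[where f = cosh_sqrt and g = "\<lambda>w. w\<^sup>2", OF DERIV_cosh_sqrt]) (auto intro!: derivative_eq_intros)
  moreover have "((\<lambda>w. cosh_sqrt (w\<^sup>2)) has_field_derivative sinh w) (at w)"
    unfolding cosh_sqrt_square by (auto intro!: derivative_eq_intros)
  ultimately have "(sinhc_sqrt (w\<^sup>2) / 2) * (2 * w) = sinh w" by (rule DERIV_unique)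
  then show ?thesis by (simp add: mult.commute)
qed

lemma DERIV_sinhc_sqrt: "(sinhc_sqrt has_field_derivative deriv sinhc_sqrt u) (at u)"
  using holomorphic_derivI[OF sinhc_sqrt_holomorphic open_UNIV, of u] by simp

text \<open>The derivative of \<open>w sinhc_sqrt (w\<^sup>2) = sinh w\<close>, in the variable \<open>u = w\<^sup>2\<close>.\<close>

lemma sinhc_sqrt_ode: "sinhc_sqrt u + 2 * u * deriv sinhc_sqrt u = cosh_sqrt u"
proof -
  define w where "w = csqrt u"
  have u: "u = w\<^sup>2" unfolding w_def by simp
  have "((\<lambda>w. sinhc_sqrt (w\<^sup>2)) has_field_derivative deriv sinhc_sqrt (w\<^sup>2) * (2 * w)) (at w)"
    by (rule DERIV_chain2[where f = sinhc_sqrt and g = "\<lambda>w. w\<^sup>2", OF DERIV_sinhc_sqrt]) (auto intro!: derivative_eq_intros)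
  then have "((\<lambda>w. w * sinhc_sqrt (w\<^sup>2)) has_field_derivative 1 * sinhc_sqrt (w\<^sup>2) + (deriv sinhc_sqrt (w\<^sup>2) * (2 * w)) * w) (at w)"
    by (intro DERIV_mult DERIV_ident)
  moreover have "((\<lambda>w. w * sinhc_sqrt (w\<^sup>2)) has_field_derivative cosh w) (at w)"
    unfolding sinhc_sqrt_square by (auto intro!: derivative_eq_intros)
  ultimately have "1 * sinhc_sqrt (w\<^sup>2) + (deriv sinhc_sqrt (w\<^sup>2) * (2 * w)) * w = cosh w" by (rule DERIV_unique)
  then show ?thesis unfolding u cosh_sqrt_square by (simp add: power2_eq_square algebra_simps)
qed

lemma cosh_sqrt_sinhc_sqrt_pythagoras: "(cosh_sqrt u)\<^sup>2 - u * (sinhc_sqrt u)\<^sup>2 = 1"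
proof -
  define w where "w = csqrt u"
  have u: "u = w\<^sup>2" unfolding w_def by simp
  have "(cosh_sqrt u)\<^sup>2 - u * (sinhc_sqrt u)\<^sup>2 = (cosh w)\<^sup>2 - (w * sinhc_sqrt (w\<^sup>2))\<^sup>2" unfolding u cosh_sqrt_square by (simp add: power_mult_distrib)
  then show ?thesis unfolding sinhc_sqrt_square by (simp add: cosh_square_eq)
qed

lemma cosh_sqrt_cnj: "cosh_sqrt (cnj u) = cnj (cosh_sqrt u)"
proof -
  define w where "w = csqrt u"
  have u: "u = w\<^sup>2" unfolding w_def by simp
  have "cosh_sqrt (cnj u) = cosh (cnj w)" unfolding u complex_cnj_power cosh_sqrt_square ..
  then show ?thesis unfolding u cosh_sqrt_square by (simp add: cosh_field_def exp_cnj)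
qed

lemma sinhc_sqrt_cnj: "sinhc_sqrt (cnj u) = cnj (sinhc_sqrt u)"
proof -
  have "(cnj \<circ> cosh_sqrt \<circ> cnj) = cosh_sqrt" by (simp add: fun_eq_iff cosh_sqrt_cnj)
  moreover have "((cnj \<circ> cosh_sqrt \<circ> cnj) has_field_derivative cnj (sinhc_sqrt (cnj u) / 2)) (at u)"
    by (rule has_field_derivative_cnj_cnj[OF DERIV_cosh_sqrt])
  ultimately have "(cosh_sqrt has_field_derivative cnj (sinhc_sqrt (cnj u) / 2)) (at u)" by simp
  then have "cnj (sinhc_sqrt (cnj u) / 2) = sinhc_sqrt u / 2" by (rule DERIV_unique[OF _ DERIV_cosh_sqrt])
  then have "cnj (sinhc_sqrt (cnj u)) = sinhc_sqrt u" by simp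
  then show ?thesis by (metis complex_cnj_cnj)
qed

text \<open>The map \<open>z \<mapsto> exp (2 z)\<close> takes the strip onto the punctured plane, and two points of the strip
  with the same image differ by a multiple of \<open>\<pi> \<i>\<close>, namely by \<open>0\<close> or \<open>\<plusminus> \<pi> \<i>\<close>. So the periodicity
  makes \<open>f\<close> a function of \<open>exp (2 z)\<close>; it is holomorphic because local inverses of the covering
  map are.\<close>

lemma strip_descend:
  assumes f: "f holomorphic_on strip" and per: "\<And>z. 0 < Im z \<Longrightarrow> Im z < pi \<Longrightarrow> f (z - \<i> * of_real pi) = f z"
  obtains F where "F holomorphic_on - {0}" "\<And>z. z \<in> strip \<Longrightarrow> F (exp (2 * z)) = f z"
proof -
  \<comment> \<open>\<open>Ln w / 2\<close> lies in the closed half \<open>\<bar>Im\<bar> \<le> \<pi>/2\<close> of the strip, so it differs from \<open>z\<close> by at most one period\<close>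
  define F where "F w = f (Ln w / 2)" for w
  have FE: "F (exp (2 * z)) = f z" if z: "z \<in> strip" for z
  proof -
    let ?u = "Ln (exp (2 * z)) / 2"
    have "exp (2 * ?u) = exp (2 * z)" by simp
    then obtain k :: int where "2 * ?u = 2 * z + (of_int (2 * k) * pi) * \<i>" unfolding exp_eq by blast
    then have k: "?u = z + of_int k * (\<i> * of_real pi)" by (simp add: field_simps)
    have Iu: "- pi / 2 < Im ?u" "Im ?u \<le> pi / 2" using mpi_less_Im_Ln[of "exp (2 * z)"] Im_Ln_le_pi[of "exp (2 * z)"] by simp_all
    have Ik: "Im ?u = Im z + of_int k * pi" unfolding k by simp
    have Iz: "- pi < Im z" "Im z < pi" using z unfolding strip_def by auto
    have "of_int k * pi < 2 * pi" "of_int k * pi > - 2 * pi" using Iu Ik Iz by linarith+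
    then have "real_of_int k < 2" "real_of_int k > - 2" by (simp_all only: mult_less_cancel_right_pos pi_gt_zero)
    then have "k = 0 \<or> k = 1 \<or> k = -1" by linarith
    then show ?thesis
    proof (elim disjE)
      assume "k = 0" then show ?thesis using k unfolding F_def by simp
    next
      assume "k = 1"
      then have "?u - \<i> * of_real pi = z" by (simp only: k \<open>k = 1\<close>) simp
      moreover have "Im ?u = Im z + pi" by (simp only: Ik \<open>k = 1\<close>, simp?)
      then have "0 < Im ?u" using Iz by linarith
      moreover have "Im ?u < pi" using Iu pi_gt_zero by linarith
      ultimately show ?thesis using per[of ?u] unfolding F_def by simp
    next
      assume k1: "k = -1"
      have e: "z - \<i> * of_real pi = ?u" by (simp only: k k1, simp?)
      have "Im ?u = Im z - pi" by (simp only: Ik k1, simp?)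
      then have "0 < Im z" using Iu pi_gt_zero by linarith
      then have "f ?u = f z" using per[of z] Iz(2) unfolding e by simp
      then show ?thesis unfolding F_def .
    qed
  qed
  have "F field_differentiable (at w)" if w: "w \<noteq> 0" for w
  proof -
    \<comment> \<open>a branch of \<open>ln u / 2\<close> near \<open>w\<close> whose cut stays away from \<open>w\<close> also when \<open>w\<close> is negative\<close>
    let ?z = "\<lambda>u. (Ln w + Ln (u / w)) / 2"
    have mem: "?z w \<in> strip" using w mpi_less_Im_Ln[OF w] Im_Ln_le_pi[OF w] unfolding strip_def by simp
    define N where "N = {u. u / w \<notin> \<real>\<^sub>\<le>\<^sub>0 \<and> ?z u \<in> strip}"
    have hz: "?z holomorphic_on {u. u / w \<notin> \<real>\<^sub>\<le>\<^sub>0}" using w by (intro holomorphic_intros) auto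
    have op: "open {u. u / w \<notin> \<real>\<^sub>\<le>\<^sub>0}"
    proof -
      have "{u. u / w \<notin> \<real>\<^sub>\<le>\<^sub>0} = (\<lambda>u. u / w) -` (- \<real>\<^sub>\<le>\<^sub>0)" by auto
      then show ?thesis using w by (auto intro!: open_vimage continuous_intros)
    qed
    have "N = {u. u / w \<notin> \<real>\<^sub>\<le>\<^sub>0} \<inter> ?z -` strip" unfolding N_def by auto
    then have "open N" using continuous_open_preimage[OF holomorphic_on_imp_continuous_on[OF hz] op open_strip] by simp
    have wN: "w \<in> N" unfolding N_def using w mem by simp
    have hol: "(\<lambda>u. f (?z u)) holomorphic_on N"
      using holomorphic_on_compose_gen[OF holomorphic_on_subset[OF hz] f, of N] unfolding N_def o_def by auto
    have eq: "F u = f (?z u)" if "u \<in> N" for u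
    proof -
      have "u \<noteq> 0" using that unfolding N_def by auto
      have "2 * (x / 2) = x" for x :: complex by simp
      then have "exp (2 * ?z u) = exp (Ln w + Ln (u / w))" by (simp only:)
      also have "\<dots> = u" using w \<open>u \<noteq> 0\<close> by (simp add: exp_add)
      finally have "exp (2 * ?z u) = u" .
      then show ?thesis using FE[of "?z u"] that unfolding N_def by simp
    qed
    have "F holomorphic_on N" by (rule holomorphic_transform[OF hol]) (simp add: eq)
    then show ?thesis using \<open>open N\<close> wN by (simp add: holomorphic_on_imp_differentiable_at)
  qed
  then have "F holomorphic_on - {0}" unfolding holomorphic_on_def by (auto intro: field_differentiable_at_within)
  then show ?thesis using that FE by blast
qed

section \<open>Multiplicative functions on the strip\<close>

text \<open>The simple roots of the quartic satisfy \<open>e\<^sup>2\<^sup>z = r\<close> or \<open>e\<^sup>2\<^sup>z = 1 / r\<close>, and \<open>4 sinh\<^sup>2 z = e\<^sup>2\<^sup>z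
  + e\<^sup>-\<^sup>2\<^sup>z - 2\<close> has the value \<open>4 modulus r\<close> there.\<close>

definition modulus :: "real \<Rightarrow> real" where "modulus r = (1 - r)\<^sup>2 / (4 * r)"

text \<open>The pull-back of \<open>d ln \<mu>\<close> will be \<open>log_form m s t z / sqrt (branch_fun m z) dz\<close>. The second term
  is \<open>\<i> t\<close> times the derivative of \<open>sqrt (branch_fun m z)\<close>, multiplied by this root.\<close>

definition log_form :: "real \<Rightarrow> real \<Rightarrow> real \<Rightarrow> complex \<Rightarrow> complex" where
  "log_form m s t z = of_real s * form_num m z - \<i> * of_real t * (sinh z * cosh z)"

lemma modulus_pos: "0 < r \<Longrightarrow> r < 1 \<Longrightarrow> modulus r > 0" unfolding modulus_def by simp

text \<open>Let \<open>A = s E + \<i> t\<close> with \<open>E\<close> from \<open>elliptic_primitive\<close> and \<open>V = sqrt (branch_fun m)\<close>. Then \<open>d (V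
  A) = log_form / V dz\<close>, and \<open>f = cosh (V A)\<close> and \<open>V g = sinh (V A)\<close> are the even and the odd part
  of \<open>exp (V A)\<close>. Shifting \<open>z\<close> by \<open>\<pi> \<i>\<close> changes \<open>V A\<close> by \<open>- \<i> s circle_period m\<close>, so the first
  integrality condition makes \<open>f\<close> and \<open>g\<close> periodic. At \<open>z = \<i> \<eta>\<close> the value of \<open>V A\<close> is \<open>\<i> (t
  axis_root m \<eta> - s axis_integral m \<eta>)\<close>, so the second one makes \<open>g\<close> vanish there. As \<open>\<eta>\<close> need not
  lie in the strip, the zero is stated at its representative \<open>\<eta>1\<close> modulo \<open>\<pi>\<close>.\<close>

lemma strip_solution:
  assumes m: "m > 0" and \<eta>: "\<eta> \<ge> 0"
    and s: "s * circle_period m = 2 * pi * of_int k" and t: "t * axis_root m \<eta> - s * axis_integral m \<eta> = pi * of_int l"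
  obtains f g g' \<eta>1 j where "f holomorphic_on strip" "g holomorphic_on strip"
    "\<And>z. z \<in> strip \<Longrightarrow> (f has_field_derivative g z * log_form m s t z) (at z)"
    "\<And>z. z \<in> strip \<Longrightarrow> (g has_field_derivative g' z) (at z)"
    "\<And>z. z \<in> strip \<Longrightarrow> branch_fun m z * g' z = sinh z * cosh z * g z + log_form m s t z * f z"
    "\<And>z. (f z)\<^sup>2 - branch_fun m z * (g z)\<^sup>2 = 1"
    "\<And>z. 0 < Im z \<Longrightarrow> Im z < pi \<Longrightarrow> f (z - \<i> * of_real pi) = f z"
    "\<And>z. 0 < Im z \<Longrightarrow> Im z < pi \<Longrightarrow> g (z - \<i> * of_real pi) = g z"
    "\<And>z. z \<in> strip \<Longrightarrow> f (- cnj z) = cnj (f z)" "\<And>z. z \<in> strip \<Longrightarrow> g (- cnj z) = - cnj (g z)"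
    "0 \<le> \<eta>1" "\<eta>1 < pi" "\<eta> = \<eta>1 + pi * of_nat j" "g (\<i> * of_real \<eta>1) = 0"
proof -
  obtain E where E: "E holomorphic_on strip"
    and eq: "\<And>z. z \<in> strip \<Longrightarrow> branch_fun m z * deriv E z = sinh z * cosh z * E z + form_num m z"
    and odd: "\<And>z. z \<in> strip \<Longrightarrow> E (- z) = - E z" and real: "\<And>z. z \<in> strip \<Longrightarrow> E (cnj z) = cnj (E z)"
    using elliptic_primitive[OF m] by blast
  define A where "A z = of_real s * E z + \<i> * of_real t" for z
  define u where "u z = branch_fun m z * (A z)\<^sup>2" for z
  define f where "f z = cosh_sqrt (u z)" for z
  define g where "g z = A z * sinhc_sqrt (u z)" for z
  define g' where "g' z = of_real s * deriv E z * sinhc_sqrt (u z) + (deriv sinhc_sqrt (u z) * (2 * A z * log_form m s t z)) * A z" for z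
  have DE: "(E has_field_derivative deriv E z) (at z)" if "z \<in> strip" for z by (rule holomorphic_derivI[OF E open_strip that])
  have DA: "(A has_field_derivative of_real s * deriv E z) (at z)" if "z \<in> strip" for z
    unfolding A_def[abs_def] by (auto intro!: derivative_eq_intros DE that)
  have PA: "branch_fun m z * (of_real s * deriv E z) = sinh z * cosh z * A z + log_form m s t z" if "z \<in> strip" for z
    unfolding mult.left_commute[of "branch_fun m z"] eq[OF that] A_def log_form_def by (simp add: algebra_simps)
  have Du: "(u has_field_derivative 2 * A z * log_form m s t z) (at z)" if z: "z \<in> strip" for z
  proof -
    have "(u has_field_derivative (- 2 * sinh z * cosh z) * (A z)\<^sup>2 + (2 * A z * (of_real s * deriv E z)) * branch_fun m z) (at z)"
      unfolding u_def[abs_def] by (auto intro!: derivative_eq_intros DERIV_branch_fun DA z)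
    also have "(- 2 * sinh z * cosh z) * (A z)\<^sup>2 + (2 * A z * (of_real s * deriv E z)) * branch_fun m z
      = 2 * A z * (branch_fun m z * (of_real s * deriv E z) - sinh z * cosh z * A z)" by (simp add: power2_eq_square algebra_simps)
    finally show ?thesis unfolding PA[OF z] by simp
  qed
  have Df: "(f has_field_derivative g z * log_form m s t z) (at z)" if z: "z \<in> strip" for z
  proof -
    have "(f has_field_derivative (sinhc_sqrt (u z) / 2) * (2 * A z * log_form m s t z)) (at z)"
      unfolding f_def[abs_def] by (rule DERIV_chain2[where f = cosh_sqrt and g = u, OF DERIV_cosh_sqrt Du[OF z]])
    then show ?thesis unfolding g_def by (simp add: mult_ac)
  qed
  have Dg: "(g has_field_derivative g' z) (at z)" if z: "z \<in> strip" for z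
    unfolding g_def[abs_def] g'_def
    by (intro DERIV_mult DA z DERIV_chain2[where f = sinhc_sqrt and g = u, OF DERIV_sinhc_sqrt Du[OF z]])
  have ode: "branch_fun m z * g' z = sinh z * cosh z * g z + log_form m s t z * f z" if z: "z \<in> strip" for z
  proof -
    have "branch_fun m z * g' z = (branch_fun m z * (of_real s * deriv E z)) * sinhc_sqrt (u z) + log_form m s t z * (2 * u z * deriv sinhc_sqrt (u z))"
      unfolding g'_def u_def by (simp add: power2_eq_square algebra_simps)
    also have "\<dots> = sinh z * cosh z * g z + log_form m s t z * (sinhc_sqrt (u z) + 2 * u z * deriv sinhc_sqrt (u z))"
      unfolding PA[OF z] g_def by (simp add: algebra_simps)
    finally show ?thesis unfolding sinhc_sqrt_ode f_def .
  qed
  have pyth: "(f z)\<^sup>2 - branch_fun m z * (g z)\<^sup>2 = 1" for z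
    using cosh_sqrt_sinhc_sqrt_pythagoras[of "u z"] unfolding f_def g_def u_def by (simp add: power_mult_distrib mult.assoc)
  \<comment> \<open>the principal root serves only to recognise \<open>f\<close> and \<open>g\<close> as hyperbolic functions of \<open>V A\<close>\<close>
  define V where "V z = csqrt (branch_fun m z)" for z
  have fV: "f z = cosh (V z * A z)" "V z * g z = sinh (V z * A z)" for z
  proof -
    have u: "u z = (V z * A z)\<^sup>2" unfolding u_def V_def by (simp add: power_mult_distrib)
    show "f z = cosh (V z * A z)" unfolding f_def u by (rule cosh_sqrt_square)
    show "V z * g z = sinh (V z * A z)" using sinhc_sqrt_square[of "V z * A z"] unfolding g_def u by (simp only: mult.assoc)
  qed
  have per: "f (z - \<i> * of_real pi) = f z" "g (z - \<i> * of_real pi) = g z" if z: "0 < Im z" "Im z < pi" for z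
  proof -
    let ?w = "z - \<i> * of_real pi"
    have V0: "V z \<noteq> 0" using branch_fun_not_nonpos[OF m z] unfolding V_def by auto
    have Vw: "V ?w = V z" unfolding V_def branch_fun_minus_i_pi ..
    have "V z * A z - V z * A ?w = of_real s * (V z * (E z - E ?w))" unfolding A_def by (simp add: algebra_simps)
    also have "V z * (E z - E ?w) = - \<i> * of_real (circle_period m)"
      unfolding V_def by (rule primitive_shift[OF m E eq odd z])
    also have "of_real s * (- \<i> * of_real (circle_period m)) = - \<i> * of_real (s * circle_period m)" by simp
    finally have d: "V z * A z = V z * A ?w + 2 * of_int (- k) * of_real pi * \<i>" unfolding s by (simp add: algebra_simps)
    have e: "exp (V z * A z) = exp (V z * A ?w)" unfolding exp_eq using d by (intro exI[of _ "- k"]) simp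
    then have e': "exp (- (V z * A z)) = exp (- (V z * A ?w))" by (simp add: exp_minus)
    have "cosh (V z * A ?w) = cosh (V z * A z)" "sinh (V z * A ?w) = sinh (V z * A z)"
      unfolding cosh_field_def sinh_field_def e e' by simp_all
    then have "f ?w = f z" "V z * g ?w = V z * g z" using fV[of z] fV[of ?w] unfolding Vw by simp_all
    then show "f ?w = f z" "g ?w = g z" using V0 unfolding mult_cancel_left by blast+
  qed
  have PPc: "branch_fun m (- cnj z) = cnj (branch_fun m z)" for z
  proof -
    have "sinh (cnj z) = cnj (sinh z)" by (simp add: sinh_field_def exp_cnj)
    then have "sinh (- cnj z) = - cnj (sinh z)" by simp
    then show ?thesis unfolding branch_fun_def by simp
  qed
  have neg: "- z \<in> strip" "cnj z \<in> strip" if "z \<in> strip" for z using that unfolding strip_def by auto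
  have Ac: "A (- cnj z) = - cnj (A z)" if "z \<in> strip" for z
    unfolding A_def using odd[OF neg(2)[OF that]] real[OF that] by simp
  have uc: "u (- cnj z) = cnj (u z)" if "z \<in> strip" for z
    unfolding u_def PPc Ac[OF that] by simp
  have fc: "f (- cnj z) = cnj (f z)" "g (- cnj z) = - cnj (g z)" if "z \<in> strip" for z
    unfolding f_def g_def uc[OF that] Ac[OF that] cosh_sqrt_cnj sinhc_sqrt_cnj by simp_all
  define j where "j = nat \<lfloor>\<eta> / pi\<rfloor>"
  define \<eta>1 where "\<eta>1 = \<eta> - pi * of_nat j"
  have fl: "real_of_int \<lfloor>\<eta> / pi\<rfloor> \<le> \<eta> / pi" "\<eta> / pi < real_of_int \<lfloor>\<eta> / pi\<rfloor> + 1" by linarith+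
  have "\<lfloor>\<eta> / pi\<rfloor> \<ge> 0" using \<eta> by simp
  then have j: "real j = real_of_int \<lfloor>\<eta> / pi\<rfloor>" unfolding j_def by simp
  have "pi * real j \<le> \<eta>" "\<eta> < pi * (real j + 1)" using fl unfolding j
    by (simp_all only: pos_le_divide_eq[OF pi_gt_zero] pos_divide_less_eq[OF pi_gt_zero] mult.commute[of pi])
  then have \<eta>1: "0 \<le> \<eta>1" "\<eta>1 < pi" unfolding \<eta>1_def by (simp_all add: algebra_simps)
  have gj: "axis_integral m (\<eta>1 + pi * of_nat i) = axis_integral m \<eta>1 + of_nat i * circle_period m" for i
  proof (induction i)
    case (Suc i)
    have "axis_integral m (\<eta>1 + pi * of_nat (Suc i)) = axis_integral m ((\<eta>1 + pi * of_nat i) + pi)" by (simp add: algebra_simps)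
    also have "\<dots> = axis_integral m (\<eta>1 + pi * of_nat i) + circle_period m" by (rule axis_integral_add_pi[OF m]) (use \<eta>1 in simp)
    finally show ?case using Suc by (simp add: algebra_simps)
  qed simp
  have e: "\<eta> = \<eta>1 + pi * of_nat j" unfolding \<eta>1_def by simp
  have sin2: "(sin (x + pi * of_nat i))\<^sup>2 = (sin x)\<^sup>2" for x and i :: nat
  proof (induction i)
    case (Suc i)
    have "sin (x + pi * of_nat (Suc i)) = - sin (x + pi * of_nat i)" by (simp add: distrib_left add.assoc[symmetric] add.commute[of pi])
    then show ?case using Suc by simp
  qed simp
  have dj: "axis_root m \<eta> = axis_root m \<eta>1" unfolding e axis_root_def sin2 ..
  have gz: "g (\<i> * of_real \<eta>1) = 0"
  proof -
    let ?z = "\<i> * complex_of_real \<eta>1"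
    have E0: "E 0 = 0" using odd[of 0] unfolding strip_def by simp
    have V: "V ?z = of_real (axis_root m \<eta>1)" unfolding V_def by (rule csqrt_branch_fun_i[OF m])
    have key: "of_real (axis_root m \<eta>1) * E ?z = - \<i> * of_real (axis_integral m \<eta>1)"
      by (rule primitive_imag_axis[OF m E eq E0 \<eta>1(1,2)])
    have "V ?z * A ?z = of_real s * (of_real (axis_root m \<eta>1) * E ?z) + \<i> * of_real (t * axis_root m \<eta>1)"
      unfolding V A_def by (simp add: algebra_simps)
    also have "\<dots> = \<i> * of_real (t * axis_root m \<eta>1 - s * axis_integral m \<eta>1)"
      unfolding key by (simp add: algebra_simps)
    also have "t * axis_root m \<eta>1 - s * axis_integral m \<eta>1 = pi * of_int (l + 2 * k * int j)"
    proof -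
      have "t * axis_root m \<eta>1 - s * (axis_integral m \<eta>1 + of_nat j * circle_period m) = pi * of_int l" using t unfolding dj using gj[of j] e by simp
      then have "t * axis_root m \<eta>1 - s * axis_integral m \<eta>1 = pi * of_int l + of_nat j * (s * circle_period m)" by (simp add: algebra_simps)
      then show ?thesis unfolding s by (simp add: algebra_simps)
    qed
    finally have "V ?z * g ?z = sinh (\<i> * of_real (pi * of_int (l + 2 * k * int j)))" unfolding fV by simp
    also have "\<dots> = 0" unfolding sinh_i sin_npi_int by simp
    finally show ?thesis unfolding V using axis_root_pos[OF m, of \<eta>1] by auto
  qed
  have hol: "f holomorphic_on strip" "g holomorphic_on strip"
    using Df Dg open_strip by (auto simp: holomorphic_on_open)
  show ?thesis
    by (rule that[OF hol(1) hol(2) Df Dg ode pyth per(1) per(2) fc(1) fc(2) \<eta>1(1) \<eta>1(2) e gz])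
qed

section \<open>Construction of lattice vectors\<close>

text \<open>The quotient of \<open>\<nu>\<close> and \<open>sqrt (branch_fun m z)\<close>, as a function of \<open>\<lambda>\<close>; its zero in the punctured
  plane is the double root of the quartic.\<close>

definition nu_factor :: "real \<Rightarrow> complex \<Rightarrow> complex" where
  "nu_factor \<phi> x = 2 * cis (- \<phi>) * x * (x - cis (2 * \<phi>))"

definition curve_x :: "real \<Rightarrow> complex \<Rightarrow> complex" where
  "curve_x \<phi> z = cis (- 2 * \<phi>) * exp (2 * z)"

lemma cis_pow: "cis (2 * \<phi>) = (cis \<phi>)\<^sup>2" "cis (- 2 * \<phi>) = inverse ((cis \<phi>)\<^sup>2)" "cis (- \<phi>) = inverse (cis \<phi>)"
  by (simp_all add: power2_eq_square cis_mult cis_inverse)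

lemma curve_x_nz: "curve_x \<phi> z \<noteq> 0" unfolding curve_x_def by simp

lemma sinh_sq_exp: "4 * ((sinh z)\<^sup>2) = exp (2 * z) + inverse (exp (2 * z)) - (2::complex)"
  "4 * (sinh z * cosh z) = exp (2 * z) - inverse (exp (2 * z :: complex))"
proof -
  have e: "exp (2 * z) = (exp z)\<^sup>2" by (simp add: exp_double)
  have n: "exp z \<noteq> 0" by simp
  show "4 * ((sinh z)\<^sup>2) = exp (2 * z) + inverse (exp (2 * z)) - (2::complex)"
    unfolding sinh_field_def e exp_minus using n by (simp add: field_simps power2_eq_square)
  show "4 * (sinh z * cosh z) = exp (2 * z) - inverse (exp (2 * z :: complex))"
    unfolding sinh_field_def cosh_field_def e exp_minus using n by (simp add: field_simps power2_eq_square)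
qed

lemma curve_poly:
  assumes r: "0 < r"
  shows "- (curve_x \<phi> z * poly (M22_param (r, \<phi>)) (curve_x \<phi> z)) = (nu_factor \<phi> (curve_x \<phi> z))\<^sup>2 * branch_fun (modulus r) z"
proof -
  define c where "c = inverse ((cis \<phi>)\<^sup>2)"
  define x where "x = exp (2 * z)"
  define R where "R = complex_of_real r"
  have n: "x \<noteq> 0" "R \<noteq> 0" "c \<noteq> 0" unfolding x_def R_def c_def using r by auto
  have M: "of_real (modulus r) = (1 - R)\<^sup>2 / (4 * R)" unfolding modulus_def R_def by simp
  have "4 * branch_fun (modulus r) z = 4 * of_real (modulus r) - 4 * (sinh z)\<^sup>2" unfolding branch_fun_def by (simp add: algebra_simps)
  also have "\<dots> = R + inverse R - x - inverse x"
    unfolding sinh_sq_exp M x_def[symmetric] using n by (simp add: field_simps power2_eq_square)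
  finally have P4: "4 * branch_fun (modulus r) z = R + inverse R - x - inverse x" .
  have P: "(c * x - R * c) * (c * x - inverse R * c) = - (c\<^sup>2 * x) * (4 * branch_fun (modulus r) z)"
    unfolding P4 using n by (simp add: field_simps power2_eq_square)
  have l: "curve_x \<phi> z = c * x" unfolding curve_x_def c_def x_def cis_pow ..
  have w: "(nu_factor \<phi> (curve_x \<phi> z))\<^sup>2 = 4 * c * (c * x)\<^sup>2 * (c * x - cis (2 * \<phi>))\<^sup>2"
    unfolding nu_factor_def l cis_pow(3) c_def by (simp add: power_mult_distrib power_inverse del: cis_inverse)
  have pol: "poly (M22_param (r, \<phi>)) (c * x) = - (c\<^sup>2 * x) * (4 * branch_fun (modulus r) z) * (c * x - cis (2 * \<phi>))\<^sup>2"
    unfolding poly_M22_param P[symmetric] cis_pow(2) c_def[symmetric] R_def ..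
  show ?thesis unfolding w unfolding l pol by (simp add: power2_eq_square algebra_simps)
qed

lemma curve_iff:
  assumes "0 < r"
  shows "(curve_x \<phi> z, \<nu>) \<in> curve (M22_param (r, \<phi>)) \<longleftrightarrow> \<nu>\<^sup>2 = (nu_factor \<phi> (curve_x \<phi> z))\<^sup>2 * branch_fun (modulus r) z"
  unfolding curve_def curve_poly[OF assms, symmetric] using curve_x_nz by (auto simp: eq_neg_iff_add_eq_0)

text \<open>The polynomial \<open>b\<close> for which \<open>b / (2 \<nu>) d ln \<lambda>\<close> pulls back to \<open>log_form / sqrt (branch_fun m)
  dz\<close>.\<close>

definition form_poly :: "real \<Rightarrow> real \<Rightarrow> real \<Rightarrow> real \<Rightarrow> complex poly" where
  "form_poly m \<phi> s t = [: - cis (2 * \<phi>), 1:] *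
    [: inverse (cis \<phi> ^ 3) * (Complex s t / 2), - (inverse (cis \<phi>) * of_real (s * (1 + 2 * (m - period_ratio m)))), cis \<phi> * cnj (Complex s t / 2) :]"

lemma degree_form_poly: "degree (form_poly m \<phi> s t) \<le> 3"
  unfolding form_poly_def by (rule order_trans[OF degree_mult_le]) simp

lemma form_poly_0: "poly (form_poly m \<phi> s t) 0 = - cis (- \<phi>) * Complex s t / 2"
proof -
  have "(cis \<phi>)\<^sup>2 * inverse (cis \<phi> ^ 3) = inverse (cis \<phi>)" by (simp add: field_simps power2_eq_square power3_eq_cube)
  moreover have "poly (form_poly m \<phi> s t) 0 = - ((cis \<phi>)\<^sup>2 * inverse (cis \<phi> ^ 3)) * Complex s t / 2"
    unfolding form_poly_def cis_pow(1) poly_mult by simp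
  ultimately show ?thesis unfolding cis_pow(3) by simp
qed

lemma poly_form_poly: "poly (form_poly m \<phi> s t) (curve_x \<phi> z) = nu_factor \<phi> (curve_x \<phi> z) * log_form m s t z"
proof -
  define c where "c = cis \<phi>"
  define x where "x = exp (2 * z)"
  define q where "q = complex_of_real (m - period_ratio m)"
  define S where "S = complex_of_real s"
  define T where "T = complex_of_real t"
  have n: "x \<noteq> 0" "c \<noteq> 0" unfolding x_def c_def by auto
  have C: "cnj (Complex s t / 2) = (S - \<i> * T) / 2" "Complex s t / 2 = (S + \<i> * T) / 2"
    unfolding S_def T_def by (simp_all add: complex_eq_iff)
  have l: "curve_x \<phi> z = inverse (c\<^sup>2) * x" unfolding curve_x_def c_def x_def cis_pow ..
  have "4 * log_form m s t z = S * (4 * (sinh z)\<^sup>2 - 4 * q) - \<i> * T * (4 * (sinh z * cosh z))"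
    unfolding log_form_def form_num_def S_def T_def q_def by (simp add: algebra_simps)
  also have "\<dots> = S * (x + inverse x - 2 - 4 * q) - \<i> * T * (x - inverse x)"
    unfolding sinh_sq_exp x_def by simp
  finally have B: "log_form m s t z = (S * (x + inverse x - 2 - 4 * q) - \<i> * T * (x - inverse x)) / 4" by (simp add: eq_divide_eq mult.commute)
  have "poly (form_poly m \<phi> s t) (curve_x \<phi> z) = (curve_x \<phi> z - c\<^sup>2) * (inverse (c ^ 3) * ((S + \<i> * T) / 2) - curve_x \<phi> z * (inverse c * (S * (1 + 2 * q))) + (curve_x \<phi> z)\<^sup>2 * (c * ((S - \<i> * T) / 2)))"
    unfolding form_poly_def cis_pow(1) c_def[symmetric] poly_mult C(1) unfolding C(2) q_def S_def of_real_mult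
    by (simp add: power2_eq_square algebra_simps)
  also have "inverse (c ^ 3) * ((S + \<i> * T) / 2) - curve_x \<phi> z * (inverse c * (S * (1 + 2 * q))) + (curve_x \<phi> z)\<^sup>2 * (c * ((S - \<i> * T) / 2))
    = 2 * inverse c * curve_x \<phi> z * log_form m s t z"
    unfolding B l using n by (simp add: field_simps power2_eq_square power3_eq_cube)
  finally show ?thesis unfolding nu_factor_def cis_pow c_def[symmetric] by (simp add: mult_ac)
qed

lemma form_poly_real:
  assumes z: "z \<noteq> 0"
  shows "cnj z ^ 3 * poly (form_poly m \<phi> s t) (inverse (cnj z)) = - cnj (poly (form_poly m \<phi> s t) z)"
proof -
  define c where "c = cis \<phi>"
  define w where "w = cnj z"
  define k where "k = complex_of_real (s * (1 + 2 * (m - period_ratio m)))"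
  define p where "p = Complex s t / 2"
  have n: "w \<noteq> 0" "c \<noteq> 0" "cnj c = inverse c" unfolding w_def c_def using z by (auto simp: cis_cnj cis_inverse)
  have k: "cnj k = k" unfolding k_def by simp
  have P: "poly (form_poly m \<phi> s t) y = (y - c\<^sup>2) * (inverse (c ^ 3) * p - inverse c * k * y + c * cnj p * y\<^sup>2)" for y
    unfolding form_poly_def cis_pow(1) c_def[symmetric] poly_mult p_def[symmetric] k_def[symmetric]
    by (simp add: power2_eq_square algebra_simps)
  have "cnj (poly (form_poly m \<phi> s t) z) = (w - inverse (c\<^sup>2)) * (c ^ 3 * cnj p - c * k * w + inverse c * p * w\<^sup>2)"
    unfolding P complex_cnj_mult complex_cnj_add complex_cnj_diff complex_cnj_power complex_cnj_inverse complex_cnj_cnj n(3) k w_def[symmetric]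
    by (simp add: power_inverse)
  moreover have "w ^ 3 * poly (form_poly m \<phi> s t) (inverse w) = - ((w - inverse (c\<^sup>2)) * (c ^ 3 * cnj p - c * k * w + inverse c * p * w\<^sup>2))"
    unfolding P using n(1,2) by (simp add: field_simps power2_eq_square power3_eq_cube)
  ultimately show ?thesis unfolding w_def by simp
qed

lemma curve_x_surj:
  assumes "x \<noteq> 0"
  obtains z where "z \<in> strip" "x = curve_x \<phi> z"
proof
  let ?y = "x * cis (2 * \<phi>)"
  have y: "?y \<noteq> 0" using assms by simp
  show "Ln ?y / 2 \<in> strip" using mpi_less_Im_Ln[OF y] Im_Ln_le_pi[OF y] unfolding strip_def by simp
  show "x = curve_x \<phi> (Ln ?y / 2)" unfolding curve_x_def using y by (simp add: cis_mult mult.left_commute)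
qed

text \<open>Descending the functions of \<open>strip_solution\<close> along \<open>z \<mapsto> \<lambda>\<close> gives \<open>\<mu> = f + G \<nu> / nu_factor\<close> with
  \<open>f\<close> and \<open>G\<close> holomorphic in \<open>\<lambda>\<close>. Since \<open>G\<close> vanishes at the double root, it is divisible by
  \<open>nu_factor\<close>. The condition for \<open>\<sigma>\<close> is the relation \<open>cosh\<^sup>2 - sinh\<^sup>2 = 1\<close>, and the one for \<open>\<rho>\<close>
  comes from \<open>z \<mapsto> - cnj z\<close>.\<close>

lemma Gamma_superset:
  assumes r: "0 < r" "r < 1" and \<phi>: "\<phi> > 0"
    and s: "s * circle_period (modulus r) = 2 * pi * of_int k" and t: "t * axis_root (modulus r) (2 * \<phi>) - s * axis_integral (modulus r) (2 * \<phi>) = pi * of_int l"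
  shows "- cis (- \<phi>) * Complex s t / 2 \<in> Gamma_tilde (M22_param (r, \<phi>))"
proof -
  define m where "m = modulus r"
  have m: "m > 0" unfolding m_def using modulus_pos[OF r] .
  let ?a = "M22_param (r, \<phi>)" and ?b = "form_poly m \<phi> s t"
  define \<gamma> where "\<gamma> = cis (2 * \<phi>)"
  have "2 * \<phi> \<ge> 0" using \<phi> by simp
  obtain f0 g0 g0' \<eta>1 j where f0: "f0 holomorphic_on strip" and g0: "g0 holomorphic_on strip"
    and Df: "\<And>z. z \<in> strip \<Longrightarrow> (f0 has_field_derivative g0 z * log_form m s t z) (at z)"
    and Dg: "\<And>z. z \<in> strip \<Longrightarrow> (g0 has_field_derivative g0' z) (at z)"
    and ode: "\<And>z. z \<in> strip \<Longrightarrow> branch_fun m z * g0' z = sinh z * cosh z * g0 z + log_form m s t z * f0 z"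
    and pyth: "\<And>z. (f0 z)\<^sup>2 - branch_fun m z * (g0 z)\<^sup>2 = 1"
    and per: "\<And>z. 0 < Im z \<Longrightarrow> Im z < pi \<Longrightarrow> f0 (z - \<i> * of_real pi) = f0 z"
      "\<And>z. 0 < Im z \<Longrightarrow> Im z < pi \<Longrightarrow> g0 (z - \<i> * of_real pi) = g0 z"
    and cn: "\<And>z. z \<in> strip \<Longrightarrow> f0 (- cnj z) = cnj (f0 z)" "\<And>z. z \<in> strip \<Longrightarrow> g0 (- cnj z) = - cnj (g0 z)"
    and \<eta>1: "0 \<le> \<eta>1" "\<eta>1 < pi" "2 * \<phi> = \<eta>1 + pi * of_nat j" "g0 (\<i> * of_real \<eta>1) = 0"
    by (rule strip_solution[OF m \<open>2 * \<phi> \<ge> 0\<close> s[folded m_def] t[folded m_def]]) (rule that)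
  obtain F where F: "F holomorphic_on - {0}" "\<And>z. z \<in> strip \<Longrightarrow> F (exp (2 * z)) = f0 z"
    using strip_descend[OF f0 per(1)] by blast
  obtain G where G: "G holomorphic_on - {0}" "\<And>z. z \<in> strip \<Longrightarrow> G (exp (2 * z)) = g0 z"
    using strip_descend[OF g0 per(2)] by blast
  define f where "f x = F (\<gamma> * x)" for x
  define G1 where "G1 x = G (\<gamma> * x)" for x
  \<comment> \<open>\<open>G1 / nu_factor\<close>, with the removable singularity at the double root filled in\<close>
  define g where "g x = (if x = \<gamma> then deriv G1 \<gamma> else (G1 x - G1 \<gamma>) / (x - \<gamma>)) / (2 * cis (- \<phi>) * x)" for x
  have \<gamma>0: "\<gamma> \<noteq> 0" unfolding \<gamma>_def by simp
  have sc: "(\<lambda>x. \<gamma> * x) ` (- {0}) \<subseteq> - {0}" using \<gamma>0 by auto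
  have hf: "f holomorphic_on - {0}" unfolding f_def[abs_def]
    using holomorphic_on_compose_gen[OF _ F(1) sc, unfolded o_def] by (auto intro!: holomorphic_intros)
  have hG1: "G1 holomorphic_on - {0}" unfolding G1_def[abs_def]
    using holomorphic_on_compose_gen[OF _ G(1) sc, unfolded o_def] by (auto intro!: holomorphic_intros)
  have op: "open (- {0 :: complex})" by auto
  have hg: "g holomorphic_on - {0}" unfolding g_def[abs_def]
    by (intro holomorphic_on_divide pole_lemma hG1 holomorphic_intros) (use \<gamma>0 op in \<open>auto simp: interior_open\<close>)
  have \<gamma>l: "\<gamma> * curve_x \<phi> z = exp (2 * z)" for z unfolding \<gamma>_def curve_x_def by (simp add: mult.assoc[symmetric] cis_mult)
  have fl: "f (curve_x \<phi> z) = f0 z" if "z \<in> strip" for z unfolding f_def \<gamma>l using F(2)[OF that] .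
  have Gl: "G1 (curve_x \<phi> z) = g0 z" if "z \<in> strip" for z unfolding G1_def \<gamma>l using G(2)[OF that] .
  have i\<eta>: "\<i> * of_real \<eta>1 \<in> strip" unfolding strip_def using \<eta>1(1,2) by simp
  have lg: "curve_x \<phi> (\<i> * of_real \<eta>1) = \<gamma>"
  proof -
    have "exp (2 * (\<i> * of_real \<eta>1)) = cis (2 * \<eta>1)" by (simp add: cis_conv_exp mult_ac)
    then have "curve_x \<phi> (\<i> * of_real \<eta>1) = cis (- 2 * \<phi> + 2 * \<eta>1)" unfolding curve_x_def by (simp add: cis_mult)
    also have "- 2 * \<phi> + 2 * \<eta>1 = 2 * \<phi> + 2 * pi * of_int (- int j)" using \<eta>1(3) by (simp add: algebra_simps)
    also have "cis \<dots> = cis (2 * \<phi>) * cis (2 * pi * of_int (- int j))" by (simp only: cis_mult)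
    also have "cis (2 * pi * of_int (- int j)) = 1" by (rule cis_multiple_2pi) simp
    finally show ?thesis unfolding \<gamma>_def by simp
  qed
  have G1\<gamma>: "G1 \<gamma> = 0" using Gl[OF i\<eta>] lg \<eta>1(4) by simp
  have wg: "nu_factor \<phi> x * g x = G1 x" if "x \<noteq> 0" for x
    using that G1\<gamma> unfolding nu_factor_def g_def \<gamma>_def[symmetric] by (cases "x = \<gamma>") auto
  define \<mu> where "\<mu> = (\<lambda>(x, \<nu>). f x + g x * \<nu>)"
  have unit: "(f x + g x * \<nu>) * (f x - g x * \<nu>) = 1" if "(x, \<nu>) \<in> curve ?a" for x \<nu>
  proof -
    have x0: "x \<noteq> 0" using that unfolding curve_def by auto
    then obtain z where z: "z \<in> strip" "x = curve_x \<phi> z" by (rule curve_x_surj)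
    have \<nu>: "\<nu>\<^sup>2 = (nu_factor \<phi> x)\<^sup>2 * branch_fun m z" using that curve_iff[OF r(1)] unfolding z(2) m_def by blast
    have "(f x + g x * \<nu>) * (f x - g x * \<nu>) = (f x)\<^sup>2 - (g x)\<^sup>2 * \<nu>\<^sup>2" by (simp add: power2_eq_square algebra_simps)
    also have "(g x)\<^sup>2 * \<nu>\<^sup>2 = branch_fun m z * (nu_factor \<phi> x * g x)\<^sup>2" unfolding \<nu> by (simp add: power_mult_distrib)
    finally show ?thesis unfolding wg[OF x0] using pyth[of z] fl[OF z(1)] Gl[OF z(1)] z(2) by simp
  qed
  have sig: "\<mu> (invol_sigma p) = inverse (\<mu> p)" "\<mu> p \<noteq> 0" if "p \<in> curve ?a" for p
  proof -
    obtain x \<nu> where p: "p = (x, \<nu>)" by (cases p)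
    have u: "(f x + g x * \<nu>) * (f x - g x * \<nu>) = 1" using unit that p by blast
    then show "\<mu> p \<noteq> 0" unfolding \<mu>_def p by auto
    show "\<mu> (invol_sigma p) = inverse (\<mu> p)" using u unfolding \<mu>_def p invol_sigma_def by (simp add: inverse_unique)
  qed
  have rho: "\<mu> (invol_rho p) = inverse (cnj (\<mu> p))" if "p \<in> curve ?a" for p
  proof -
    obtain x \<nu> where p: "p = (x, \<nu>)" by (cases p)
    have x0: "x \<noteq> 0" using that p unfolding curve_def by auto
    then obtain z where z: "z \<in> strip" "x = curve_x \<phi> z" by (rule curve_x_surj)
    have u: "(f x + g x * \<nu>) * (f x - g x * \<nu>) = 1" using unit that p by blast
    let ?x = "inverse (cnj x)" and ?\<nu> = "- (inverse (cnj x ^ 3) * cnj \<nu>)"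
    have z': "- cnj z \<in> strip" using z(1) unfolding strip_def by simp
    have x': "?x = curve_x \<phi> (- cnj z)"
      unfolding z(2) curve_x_def by (simp add: exp_cnj exp_minus cis_cnj cis_inverse)
    have "f ?x = f0 (- cnj z)" "G1 ?x = g0 (- cnj z)"
      using fl[OF z'] Gl[OF z'] unfolding x'[symmetric] by blast+
    moreover have "f x = f0 z" "G1 x = g0 z" using fl[OF z(1)] Gl[OF z(1)] unfolding z(2)[symmetric] by blast+
    ultimately have f': "f ?x = cnj (f x)" and G': "G1 ?x = - cnj (G1 x)"
      by (simp_all only: cn[OF z(1)])
    have g': "g ?x * ?\<nu> = - cnj (g x * \<nu>)"
    proof (cases "\<nu> = 0")
      case False
      have \<nu>2: "\<nu>\<^sup>2 = (nu_factor \<phi> x)\<^sup>2 * branch_fun m z" using that p curve_iff[OF r(1)] unfolding z(2) m_def by blast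
      then have w0: "nu_factor \<phi> x \<noteq> 0" using False by auto
      have c0: "cis \<phi> \<noteq> 0" "cnj (cis \<phi>) = inverse (cis \<phi>)" by (auto simp: cis_cnj cis_inverse)
      define c where "c = cis \<phi>"
      define y where "y = cnj x"
      have y0: "y \<noteq> 0" unfolding y_def using x0 by simp
      have W: "nu_factor \<phi> ?x * y ^ 3 = - cnj (nu_factor \<phi> x)"
      proof -
        have "cnj (nu_factor \<phi> x) = 2 * c * y * (y - inverse (c\<^sup>2))"
          unfolding nu_factor_def cis_pow complex_cnj_mult complex_cnj_diff complex_cnj_power complex_cnj_inverse c0(2) c_def y_def
          by (simp add: power_inverse del: cis_inverse)
        moreover have "nu_factor \<phi> ?x * y ^ 3 = - (2 * c * y * (y - inverse (c\<^sup>2)))"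
          unfolding nu_factor_def cis_pow c_def[symmetric] y_def[symmetric]
          using c0(1) y0 unfolding c_def[symmetric] by (simp add: field_simps power2_eq_square power3_eq_cube)
        ultimately show ?thesis by simp
      qed
      have "nu_factor \<phi> ?x * g ?x = - cnj (nu_factor \<phi> x * g x)" using wg[of x] wg[of ?x] x0 G' by simp
      then have "(nu_factor \<phi> ?x * y ^ 3) * (g ?x * ?\<nu>) = (nu_factor \<phi> ?x * y ^ 3) * (- cnj (g x * \<nu>))"
      proof -
        assume a: "nu_factor \<phi> ?x * g ?x = - cnj (nu_factor \<phi> x * g x)"
        have "(nu_factor \<phi> ?x * y ^ 3) * (g ?x * ?\<nu>) = - (nu_factor \<phi> ?x * g ?x) * cnj \<nu>" using y0 unfolding y_def[symmetric] by simp
        also have "\<dots> = cnj (nu_factor \<phi> x) * cnj (g x * \<nu>)" unfolding a by simp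
        finally show ?thesis unfolding W by simp
      qed
      moreover have "nu_factor \<phi> ?x * y ^ 3 \<noteq> 0" unfolding W using w0 by simp
      ultimately show ?thesis by (simp only: mult_cancel_left) blast
    qed simp
    have "\<mu> (invol_rho p) = cnj (f x - g x * \<nu>)" unfolding \<mu>_def p invol_rho_def using f' g' by simp
    moreover have "cnj (f x + g x * \<nu>) * cnj (f x - g x * \<nu>) = 1" using u by (metis complex_cnj_mult complex_cnj_one)
    ultimately show ?thesis unfolding \<mu>_def p by (simp add: inverse_unique)
  qed
  have dln: "dln_eq ?a ?b \<mu>"
    unfolding dln_eq_def
  proof (intro allI impI conjI ballI)
    fix V :: "complex set" and x \<nu> :: "complex \<Rightarrow> complex"
    assume V: "open V \<and> x holomorphic_on V \<and> \<nu> holomorphic_on V \<and> (\<forall>t\<in>V. (x t, \<nu> t) \<in> smooth_part ?a)"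
    then have oV: "open V" and hx: "x holomorphic_on V" and h\<nu>: "\<nu> holomorphic_on V"
      and cur: "\<And>t. t \<in> V \<Longrightarrow> (x t, \<nu> t) \<in> curve ?a" unfolding smooth_part_def by auto
    have x0: "x t \<noteq> 0" if "t \<in> V" for t using cur[OF that] unfolding curve_def by auto
    have xV: "x ` V \<subseteq> - {0}" using x0 by auto
    have hfx: "(\<lambda>t. f (x t)) holomorphic_on V" using holomorphic_on_compose_gen[OF hx hf xV] unfolding o_def .
    have hgx: "(\<lambda>t. g (x t)) holomorphic_on V" using holomorphic_on_compose_gen[OF hx hg xV] unfolding o_def .
    show "(\<lambda>t. \<mu> (x t, \<nu> t)) holomorphic_on V" unfolding \<mu>_def prod.case
      by (intro holomorphic_intros hfx hgx h\<nu>)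
    fix \<tau> assume t: "\<tau> \<in> V" and \<nu>0: "\<nu> \<tau> \<noteq> 0"
    define X where "X = x \<tau>"
    define N where "N = \<nu> \<tau>"
    have X0: "X \<noteq> 0" unfolding X_def using x0[OF t] .
    then obtain z where z: "z \<in> strip" "X = curve_x \<phi> z" by (rule curve_x_surj)
    have N2: "N\<^sup>2 = (nu_factor \<phi> X)\<^sup>2 * branch_fun m z"
      using cur[OF t] curve_iff[OF r(1)] unfolding z(2) m_def X_def[symmetric] N_def[symmetric] by blast
    define Q where "Q = (\<lambda>y. - (y * poly ?a y))"
    obtain Q' where DQ: "(Q has_field_derivative Q') (at X)"
    proof -
      have "(Q has_field_derivative - (1 * poly ?a X + poly (pderiv ?a) X * X)) (at X)"
        unfolding Q_def by (intro DERIV_minus DERIV_mult DERIV_ident poly_DERIV)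
      then show ?thesis using that by blast
    qed
    define dx where "dx = deriv x \<tau>"
    define dn where "dn = deriv \<nu> \<tau>"
    have Dx: "(x has_field_derivative dx) (at \<tau>)" unfolding dx_def by (rule holomorphic_derivI[OF hx oV t])
    have Dn: "(\<nu> has_field_derivative dn) (at \<tau>)" unfolding dn_def by (rule holomorphic_derivI[OF h\<nu> oV t])
    \<comment> \<open>the differential of the equation of the curve along \<open>(x, \<nu>)\<close>\<close>
    have A: "2 * N * dn = Q' * dx"
    proof -
      have "((\<lambda>t. Q (x t)) has_field_derivative Q' * dx) (at \<tau>)"
        by (rule DERIV_chain2[where f = Q and g = x, OF DQ[unfolded X_def] Dx])
      then have "((\<lambda>t. (\<nu> t)\<^sup>2) has_field_derivative Q' * dx) (at \<tau>)"
        by (rule has_field_derivative_transform_within_open[OF _ oV t])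
          (use cur in \<open>auto simp: Q_def curve_def neg_eq_iff_add_eq_0 add.commute\<close>)
      moreover have "((\<lambda>t. (\<nu> t)\<^sup>2) has_field_derivative 2 * \<nu> \<tau> * dn) (at \<tau>)"
        by (auto intro!: derivative_eq_intros Dn)
      ultimately show ?thesis unfolding N_def using DERIV_unique by blast
    qed
    define f' where "f' = deriv f X"
    define g' where "g' = deriv g X"
    have Dfx: "(f has_field_derivative f') (at X)" unfolding f'_def by (rule holomorphic_derivI[OF hf op]) (use X0 in simp)
    have Dgx: "(g has_field_derivative g') (at X)" unfolding g'_def by (rule holomorphic_derivI[OF hg op]) (use X0 in simp)
    have Dl: "(curve_x \<phi> has_field_derivative 2 * X) (at z)"
      unfolding curve_x_def[abs_def] z(2) by (auto intro!: derivative_eq_intros)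
    define W where "W = nu_factor \<phi> X"
    define W' where "W' = 2 * cis (- \<phi>) * (X - cis (2 * \<phi>)) + 2 * cis (- \<phi>) * X"
    have DW: "(nu_factor \<phi> has_field_derivative W') (at X)" unfolding nu_factor_def[abs_def] W'_def
      by (auto intro!: derivative_eq_intros simp: algebra_simps)
    define B where "B = log_form m s t z"
    define sc where "sc = sinh z * cosh z"
    have g0W: "g0 z = W * g X" using wg[OF X0] Gl[OF z(1)] unfolding W_def z(2) by simp
    have 1: "f' * (2 * X) = W * g X * B"
    proof -
      have "((\<lambda>w. f (curve_x \<phi> w)) has_field_derivative f' * (2 * X)) (at z)"
        by (rule DERIV_chain2[where f = f and g = "curve_x \<phi>", OF Dfx[unfolded z(2)] Dl[unfolded z(2)], folded z(2)])
      then have "(f0 has_field_derivative f' * (2 * X)) (at z)"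
        by (rule has_field_derivative_transform_within_open[OF _ open_strip z(1)]) (rule fl)
      then show ?thesis using DERIV_unique[OF _ Df[OF z(1)]] unfolding B_def g0W[symmetric] by blast
    qed
    have 2: "(g' * (2 * X)) * W + g X * (W' * (2 * X)) = g0' z"
    proof -
      have a: "((\<lambda>w. g (curve_x \<phi> w)) has_field_derivative g' * (2 * X)) (at z)"
        by (rule DERIV_chain2[where f = g and g = "curve_x \<phi>", OF Dgx[unfolded z(2)] Dl[unfolded z(2)], folded z(2)])
      have b: "((\<lambda>w. nu_factor \<phi> (curve_x \<phi> w)) has_field_derivative W' * (2 * X)) (at z)"
        by (rule DERIV_chain2[where f = "nu_factor \<phi>" and g = "curve_x \<phi>", OF DW[unfolded z(2)] Dl[unfolded z(2)], folded z(2)])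
      have "((\<lambda>w. nu_factor \<phi> (curve_x \<phi> w) * g (curve_x \<phi> w)) has_field_derivative (W' * (2 * X)) * g X + (g' * (2 * X)) * W) (at z)"
        using DERIV_mult[OF b a] unfolding z(2)[symmetric] W_def .
      then have "(g0 has_field_derivative (W' * (2 * X)) * g X + (g' * (2 * X)) * W) (at z)"
        by (rule has_field_derivative_transform_within_open[OF _ open_strip z(1)]) (simp add: wg curve_x_nz Gl)
      then have "(W' * (2 * X)) * g X + (g' * (2 * X)) * W = g0' z" by (rule DERIV_unique[OF _ Dg[OF z(1)]])
      then show ?thesis by (simp add: algebra_simps)
    qed
    have 3: "Q' * (2 * X) = (2 * W * (W' * (2 * X))) * branch_fun m z + W\<^sup>2 * (- 2 * sc)"
    proof -
      have a: "((\<lambda>w. Q (curve_x \<phi> w)) has_field_derivative Q' * (2 * X)) (at z)"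
        by (rule DERIV_chain2[where f = Q and g = "curve_x \<phi>", OF DQ[unfolded z(2)] Dl[unfolded z(2)], folded z(2)])
      have b: "((\<lambda>w. nu_factor \<phi> (curve_x \<phi> w)) has_field_derivative W' * (2 * X)) (at z)"
        by (rule DERIV_chain2[where f = "nu_factor \<phi>" and g = "curve_x \<phi>", OF DW[unfolded z(2)] Dl[unfolded z(2)], folded z(2)])
      have "((\<lambda>w. (nu_factor \<phi> (curve_x \<phi> w))\<^sup>2 * branch_fun m w) has_field_derivative
         (2 * nu_factor \<phi> (curve_x \<phi> z) * (W' * (2 * X))) * branch_fun m z + (- 2 * sinh z * cosh z) * (nu_factor \<phi> (curve_x \<phi> z))\<^sup>2) (at z)"
        by (rule DERIV_mult[OF _ DERIV_branch_fun]) (auto intro!: derivative_eq_intros b)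
      moreover have "(\<lambda>w. (nu_factor \<phi> (curve_x \<phi> w))\<^sup>2 * branch_fun m w) = (\<lambda>w. Q (curve_x \<phi> w))"
        unfolding Q_def m_def using curve_poly[OF r(1)] by simp
      ultimately have "Q' * (2 * X) = (2 * nu_factor \<phi> (curve_x \<phi> z) * (W' * (2 * X))) * branch_fun m z + (- 2 * sinh z * cosh z) * (nu_factor \<phi> (curve_x \<phi> z))\<^sup>2"
        using DERIV_unique[OF a] by metis
      then show ?thesis unfolding z(2)[symmetric] W_def[symmetric] sc_def by (simp add: mult_ac)
    qed
    have 3: "Q' * X = W * (W' * (2 * X)) * branch_fun m z - W\<^sup>2 * sc"
    proof -
      have "2 * (Q' * X) = 2 * (W * (W' * (2 * X)) * branch_fun m z - W\<^sup>2 * sc)" using 3 by (simp add: algebra_simps)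
      then show ?thesis by (simp only: mult_cancel_left) simp
    qed
    have 4: "branch_fun m z * g0' z = sc * (W * g X) + B * f X"
      using ode[OF z(1)] fl[OF z(1)] unfolding g0W sc_def B_def z(2) by simp
    define M where "M = f X + g X * N"
    have M0: "M \<noteq> 0" using sig(2)[OF cur[OF t]] unfolding M_def \<mu>_def X_def N_def by simp
    have DM: "((\<lambda>t. \<mu> (x t, \<nu> t)) has_field_derivative f' * dx + ((g' * dx) * N + dn * g X)) (at \<tau>)"
      unfolding \<mu>_def prod.case X_def N_def
      by (intro DERIV_add DERIV_mult DERIV_chain2[where f = f and g = x, OF Dfx[unfolded X_def] Dx]
        DERIV_chain2[where f = g and g = x, OF Dgx[unfolded X_def] Dx] Dn)
    have "(f' * dx + ((g' * dx) * N + dn * g X)) * (2 * N * X) = W * B * dx * M"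
    proof -
      have "(f' * dx + ((g' * dx) * N + dn * g X)) * (2 * N * X)
        = N * dx * (f' * (2 * X)) + N\<^sup>2 * dx * (g' * (2 * X)) + g X * X * (2 * N * dn)"
        by (simp add: algebra_simps power2_eq_square)
      also have "\<dots> = dx * (N * (f' * (2 * X)) + N\<^sup>2 * (g' * (2 * X)) + g X * (Q' * X))"
        unfolding A by (simp add: algebra_simps)
      also have "\<dots> = dx * (N * (W * g X * B) + W * (branch_fun m z * ((g' * (2 * X)) * W + g X * (W' * (2 * X))) - sc * (W * g X)))"
        unfolding 1 3 N2 W_def[symmetric] by (simp add: algebra_simps power2_eq_square)
      also have "\<dots> = W * B * dx * M" unfolding 2 4 M_def by (simp add: algebra_simps)
      finally show ?thesis .
    qed
    then have "(f' * dx + ((g' * dx) * N + dn * g X)) / M = W * B / (2 * N) * (dx / X)"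
      using M0 X0 \<nu>0 unfolding N_def[symmetric] by (simp add: frac_eq_eq mult_ac)
    moreover have "poly ?b X = W * B" unfolding z(2) poly_form_poly W_def B_def ..
    ultimately show "deriv (\<lambda>t. \<mu> (x t, \<nu> t)) \<tau> / \<mu> (x \<tau>, \<nu> \<tau>) = poly ?b (x \<tau>) / (2 * \<nu> \<tau>) * (deriv x \<tau> / x \<tau>)"
      using DERIV_imp_deriv[OF DM] unfolding M_def \<mu>_def prod.case X_def[symmetric] N_def[symmetric] dx_def[symmetric] by simp
  qed
  have "admissible ?a ?b \<mu>"
    unfolding admissible_def
  proof (intro conjI ballI)
    show "\<exists>f g. f holomorphic_on - {0} \<and> g holomorphic_on - {0} \<and> (\<forall>(x, \<nu>)\<in>curve ?a. \<mu> (x, \<nu>) = f x + g x * \<nu>)"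
      using hf hg unfolding \<mu>_def by auto
  qed (use sig rho dln in auto)
  then show ?thesis unfolding Gamma_tilde_def mem_Collect_eq
    using degree_form_poly[of m \<phi> s t] form_poly_real[of _ m \<phi> s t] form_poly_0[of m \<phi> s t]
    by (intro exI[of _ ?b]) (auto simp del: mult_minus_left)
qed

section \<open>Consequences of admissibility\<close>

text \<open>The condition says that the polynomial with coefficients \<open>b\<^sub>3\<^sub>-\<^sub>i + cnj b\<^sub>i\<close> vanishes on the
  punctured plane.\<close>

lemma cubic_reality:
  fixes b :: "complex poly"
  assumes deg: "degree b \<le> 3"
    and real: "\<And>z. z \<noteq> 0 \<Longrightarrow> cnj z ^ 3 * poly b (inverse (cnj z)) = - cnj (poly b z)"
  shows "b = [: coeff b 0, coeff b 1, coeff b 2, coeff b 3 :]"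
    "coeff b 3 = - cnj (coeff b 0)" "coeff b 2 = - cnj (coeff b 1)"
proof -
  define b0 where "b0 = coeff b 0"
  define b1 where "b1 = coeff b 1"
  define b2 where "b2 = coeff b 2"
  define b3 where "b3 = coeff b 3"
  have b: "b = [: b0, b1, b2, b3 :]"
  proof (rule poly_eqI)
    fix n show "coeff b n = coeff [: b0, b1, b2, b3 :] n"
    proof (cases "n \<le> 3")
      case True
      then have "n = 0 \<or> n = 1 \<or> n = 2 \<or> n = 3" by auto
      then show ?thesis by (auto simp: b0_def b1_def b2_def b3_def numeral_2_eq_2 numeral_3_eq_3)
    next
      case False
      then have "coeff b n = 0" "coeff [: b0, b1, b2, b3 :] n = 0" using deg by (auto intro!: coeff_eq_0)
      then show ?thesis by simp
    qed
  qed
  then show "b = [: coeff b 0, coeff b 1, coeff b 2, coeff b 3 :]" unfolding b0_def b1_def b2_def b3_def .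
  define e where "e = [: b3 + cnj b0, b2 + cnj b1, b1 + cnj b2, b0 + cnj b3 :]"
  have e0: "poly e w = 0" if w: "w \<noteq> 0" for w
  proof -
    have "w ^ 3 * poly b (inverse w) = - cnj (poly b (cnj w))" using real[of "cnj w"] w by simp
    moreover have "w ^ 3 * poly b (inverse w) = b3 + w * b2 + w\<^sup>2 * b1 + w ^ 3 * b0"
      unfolding b using w by (simp add: field_simps power3_eq_cube power2_eq_square)
    moreover have "cnj (poly b (cnj w)) = cnj b0 + w * cnj b1 + w\<^sup>2 * cnj b2 + w ^ 3 * cnj b3"
      unfolding b by (simp add: algebra_simps power3_eq_cube power2_eq_square)
    ultimately have "(b3 + w * b2 + w\<^sup>2 * b1 + w ^ 3 * b0) + (cnj b0 + w * cnj b1 + w\<^sup>2 * cnj b2 + w ^ 3 * cnj b3) = 0" by simp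
    then show ?thesis unfolding e_def by (simp add: algebra_simps power3_eq_cube power2_eq_square)
  qed
  have "poly ([:0, 1:] * e) w = 0" for w using e0[of w] by (cases "w = 0") simp_all
  then have "[:0, 1:] * e = 0" using poly_all_0_iff_0 by blast
  then have "e = 0" by (metis mult_eq_0_iff one_neq_zero pCons_eq_0_iff)
  then have "b3 + cnj b0 = 0" "b2 + cnj b1 = 0" unfolding e_def by simp_all
  then show "coeff b 3 = - cnj (coeff b 0)" "coeff b 2 = - cnj (coeff b 1)"
    unfolding b0_def b1_def b2_def b3_def by (simp_all add: eq_neg_iff_add_eq_0)
qed

text \<open>The cubic \<open>b\<close> has the form \<open>(\<lambda> - \<gamma>)\<close> times a quadratic polynomial, and the reality condition
  leaves one complex parameter for the outer coefficients of the quadratic factor, written as \<open>s +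
  \<i> t\<close>, and one real parameter \<open>k\<close> for the middle one. The latter is measured from its value in
  \<open>form_poly\<close>, so that \<open>j\<close> is the coefficient of the differential of the first kind.\<close>

lemma reality_normal_form:
  assumes deg: "degree b \<le> 3"
    and real: "\<And>z. z \<noteq> 0 \<Longrightarrow> cnj z ^ 3 * poly b (inverse (cnj z)) = - cnj (poly b z)"
    and root: "poly b (cis (2 * \<phi>)) = 0"
  obtains s t j :: real where "\<And>z. poly b (curve_x \<phi> z) = nu_factor \<phi> (curve_x \<phi> z) * (log_form m s t z + of_real j)"
    "poly b 0 = - cis (- \<phi>) * Complex s t / 2"
proof -
  define c where "c = cis \<phi>"
  define x0 where "x0 = coeff b 0"
  define x1 where "x1 = coeff b 1"
  have c: "c \<noteq> 0" "cnj c = inverse c" unfolding c_def by (auto simp: cis_cnj cis_inverse)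
  have b: "b = [: x0, x1, - cnj x1, - cnj x0 :]"
    using cubic_reality[OF deg real] unfolding x0_def x1_def by simp
  define p where "p = - c * x0"
  define s where "s = 2 * Re p"
  define t where "t = 2 * Im p"
  have p: "p = Complex s t / 2" unfolding s_def t_def by (simp add: complex_eq_iff)
  have x0: "x0 = - inverse c * p" "cnj x0 = - c * cnj p"
    unfolding p_def complex_cnj_mult complex_cnj_minus c(2) using c(1) by simp_all
  \<comment> \<open>the middle coefficient of the quadratic factor, rotated so that it is real\<close>
  define k where "k = c * (- cnj x1 - c\<^sup>2 * cnj x0)"
  have root': "x0 + c\<^sup>2 * x1 - c ^ 4 * cnj x1 - c ^ 6 * cnj x0 = 0"
    using root unfolding b cis_pow(1) c_def[symmetric] by (simp add: algebra_simps power2_eq_square power4_eq_xxxx eval_nat_numeral)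
  have "cnj k = inverse c * (- x1 - inverse (c\<^sup>2) * x0)"
    unfolding k_def by (simp add: c(2) power_inverse)
  also have "\<dots> = k"
  proof -
    have "x1 = - inverse (c\<^sup>2) * x0 + c\<^sup>2 * cnj x1 + c ^ 4 * cnj x0"
      using root' c(1) by (simp add: field_simps eval_nat_numeral)
    then have "- x1 - inverse (c\<^sup>2) * x0 = c\<^sup>2 * (- cnj x1 - c\<^sup>2 * cnj x0)" by (simp add: algebra_simps eval_nat_numeral)
    then show ?thesis unfolding k_def using c(1) by (simp add: field_simps power2_eq_square)
  qed
  finally have "Im k = 0" by (simp add: complex_eq_iff)
  then obtain kr where kr: "k = of_real kr" by (metis Re_complex_of_real complex_is_Real_iff Reals_cases)
  define j where "j = (kr + s * (1 + 2 * (m - period_ratio m))) / 2"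
  have tj: "2 * j = kr + s * (1 + 2 * (m - period_ratio m))" unfolding j_def by simp
  have x1: "cnj x1 = - inverse c * k - c\<^sup>2 * cnj x0" unfolding k_def using c(1) by (simp add: field_simps)
  have fac: "poly b y = (y - c\<^sup>2) * (inverse (c ^ 3) * p + inverse c * k * y + c * cnj p * y\<^sup>2)" for y
  proof -
    have "x1 = - inverse (c\<^sup>2) * x0 + c\<^sup>2 * cnj x1 + c ^ 4 * cnj x0"
      using root' c(1) by (simp add: field_simps eval_nat_numeral)
    moreover have "c\<^sup>2 * cnj x1 = - c * k - c ^ 4 * cnj x0"
      unfolding x1 using c(1) by (simp add: algebra_simps eval_nat_numeral)
    ultimately have "x1 = - inverse (c\<^sup>2) * x0 + (- c * k - c ^ 4 * cnj x0) + c ^ 4 * cnj x0" by (simp only:)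
    also have "\<dots> = - inverse (c\<^sup>2) * x0 - c * k" by simp
    finally have x1': "x1 = - inverse (c\<^sup>2) * x0 - c * k" .
    have "poly b y = x0 + y * x1 - y\<^sup>2 * cnj x1 - y ^ 3 * cnj x0" unfolding b by (simp add: algebra_simps eval_nat_numeral)
    also have "\<dots> = x0 + y * (- inverse (c\<^sup>2) * x0 - c * k) - y\<^sup>2 * (- inverse c * k - c\<^sup>2 * cnj x0) - y ^ 3 * cnj x0"
      unfolding x1 by (subst x1') (rule refl)
    also have "\<dots> = (y - c\<^sup>2) * (inverse (c ^ 3) * p + inverse c * k * y + c * cnj p * y\<^sup>2)"
      unfolding x0(2) unfolding x0(1) using c(1) by (simp add: field_simps eval_nat_numeral)
    finally show ?thesis .
  qed
  show ?thesis
  proof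
    fix z
    define y where "y = curve_x \<phi> z"
    have P: "poly (form_poly m \<phi> s t) y = (y - c\<^sup>2) * (inverse (c ^ 3) * p - inverse c * of_real (s * (1 + 2 * (m - period_ratio m))) * y + c * cnj p * y\<^sup>2)"
      unfolding form_poly_def cis_pow(1) c_def[symmetric] poly_mult p[symmetric]
      by (simp add: power2_eq_square algebra_simps)
    have "poly b y = poly (form_poly m \<phi> s t) y + (y - c\<^sup>2) * (inverse c * y * of_real (2 * j))"
      unfolding fac P kr tj by (simp add: algebra_simps)
    also have "(y - c\<^sup>2) * (inverse c * y * of_real (2 * j)) = nu_factor \<phi> y * of_real j"
      unfolding nu_factor_def cis_pow c_def[symmetric] by (simp add: mult_ac)
    finally show "poly b (curve_x \<phi> z) = nu_factor \<phi> (curve_x \<phi> z) * (log_form m s t z + of_real j)"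
      unfolding y_def poly_form_poly by (simp add: algebra_simps)
  next
    show "poly b 0 = - cis (- \<phi>) * Complex s t / 2"
      unfolding b cis_pow(3) c_def[symmetric] using x0(1) unfolding p by simp
  qed
qed

lemma exp_solution_on_interval:
  fixes M :: "real \<Rightarrow> complex"
  assumes ab: "a \<le> b" and cM: "continuous_on {a..b} M" and cH: "continuous_on {a..b} H"
    and M: "\<And>x. a < x \<Longrightarrow> x < b \<Longrightarrow> (M has_vector_derivative h x * M x) (at x)"
    and H: "\<And>x. a < x \<Longrightarrow> x < b \<Longrightarrow> (H has_vector_derivative h x) (at x)"
  shows "M b = M a * exp (H b - H a)"
proof -
  have "M b * exp (- H b) = M a * exp (- H a)"
  proof (rule const_on_interval[OF ab])
    show "continuous_on {a..b} (\<lambda>x. M x * exp (- H x))" by (intro continuous_intros cM cH)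
    fix x assume x: "a < x" "x < b"
    have "((\<lambda>x. - H x) has_vector_derivative - h x) (at x)" using H[OF x] by (rule has_vector_derivative_minus)
    then have "((exp \<circ> (\<lambda>x. - H x)) has_vector_derivative - h x * exp (- H x)) (at x)"
      by (rule field_vector_diff_chain_at) (rule DERIV_exp)
    then have "((\<lambda>x. M x * exp (- H x)) has_vector_derivative M x * (- h x * exp (- H x)) + h x * M x * exp (- H x)) (at x)"
      unfolding o_def by (rule has_vector_derivative_mult[OF M[OF x]])
    then show "((\<lambda>x. M x * exp (- H x)) has_vector_derivative 0) (at x)" by (simp add: algebra_simps)
  qed
  then have "M b * exp (- H b) * exp (H b) = M a * exp (- H a) * exp (H b)" by simp
  then show ?thesis by (simp add: exp_diff exp_minus field_simps)
qed

lemma eventually_exp_ne: "eventually (\<lambda>z. exp (2 * z) \<noteq> w) (at (z0 :: complex))"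
proof -
  have "eventually (\<lambda>z. z \<noteq> z0 \<and> dist z z0 < 1) (at z0)"
    unfolding eventually_at by (intro exI[of _ 1]) auto
  moreover have "eventually (\<lambda>z. dist z z0 < 1 \<and> z \<noteq> z0 \<longrightarrow> exp (2 * z) \<noteq> w) (at z0)"
  proof (cases "exp (2 * z0) = w")
    case True
    have "exp (2 * z) \<noteq> w" if z: "dist z z0 < 1" "z \<noteq> z0" for z
    proof
      assume "exp (2 * z) = w"
      then have "exp (2 * z) = exp (2 * z0)" using True by simp
      then obtain n :: int where "2 * z = 2 * z0 + (of_int (2 * n) * pi) * \<i>" unfolding exp_eq by blast
      then have "2 * (z - z0) = 2 * (of_real (of_int n * pi) * \<i>)" by (simp add: algebra_simps)
      then have n: "z - z0 = of_real (of_int n * pi) * \<i>" by (simp only: mult_cancel_left) simp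
      then have "n \<noteq> 0" using z(2) by auto
      have "dist z z0 = \<bar>of_int n\<bar> * pi" unfolding dist_norm n norm_mult norm_of_real by (simp add: abs_mult)
      moreover have "\<bar>real_of_int n\<bar> \<ge> 1" using \<open>n \<noteq> 0\<close> by linarith
      ultimately have "dist z z0 \<ge> 1 * pi" using pi_gt_zero by (simp only: mult_right_mono less_imp_le)
      then show False using z(1) pi_gt3 by linarith
    qed
    then show ?thesis by simp
  next
    case False
    have "((\<lambda>z. exp (2 * z)) \<longlongrightarrow> exp (2 * z0)) (at z0)" by (intro tendsto_intros)
    then have "eventually (\<lambda>z. exp (2 * z) \<noteq> w) (at z0)" using False by (rule tendsto_imp_eventually_ne)
    then show ?thesis by (rule eventually_mono) simp
  qed
  ultimately show ?thesis by eventually_elim simp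
qed

text \<open>The points with \<open>exp (2 z) = w\<close> are isolated, so an identity that holds outside of them extends
  by continuity. It is used at the preimages of the double point, where \<open>d ln \<mu>\<close> is not given.\<close>

lemma continuous_zero_at_isolated:
  fixes h :: "complex \<Rightarrow> complex"
  assumes U: "open U" and h: "continuous_on U h" and z: "\<And>z. z \<in> U \<Longrightarrow> exp (2 * z) \<noteq> w \<Longrightarrow> h z = 0" and z0: "z0 \<in> U"
  shows "h z0 = 0"
proof -
  have "(h \<longlongrightarrow> h z0) (at z0)" using h U z0 by (simp add: continuous_on_eq_continuous_at isCont_def)
  moreover have "eventually (\<lambda>z. h z = 0) (at z0)"
    using eventually_exp_ne[of w z0] eventually_at_in_open'[OF U z0] by eventually_elim (rule z)
  then have "(h \<longlongrightarrow> 0) (at z0)" by (rule tendsto_eventually)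
  ultimately show ?thesis by (rule tendsto_unique[rotated]) simp
qed

text \<open>The map \<open>z \<mapsto> (\<lambda>, \<nu>)\<close> with the principal square root is holomorphic where \<open>branch_fun\<close> avoids the
  cut, in particular near the imaginary axis, and away from the double point it runs in the smooth
  part of the curve. The pulled back equation is \<open>\<nu> M' = b M\<close>. It extends to the double point by
  continuity; there \<open>\<nu> = 0\<close> and \<open>M \<noteq> 0\<close>, so \<open>b\<close> vanishes at the double root and has the normal
  form above. Here it enters that \<open>\<mu> = f + g \<nu>\<close> with holomorphic \<open>f\<close> and \<open>g\<close>: it makes \<open>M\<close>
  holomorphic at the double point as well.\<close>

lemma pullback_solution:
  assumes r: "0 < r" "r < 1" and adm: "admissible (M22_param (r, \<phi>)) b \<mu>"
    and deg: "degree b \<le> 3"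
    and real: "\<And>z. z \<noteq> 0 \<Longrightarrow> cnj z ^ 3 * poly b (inverse (cnj z)) = - cnj (poly b z)"
  defines "\<Omega> \<equiv> {z. branch_fun (modulus r) z \<notin> \<real>\<^sub>\<le>\<^sub>0}"
  obtains f g M M' and s t j :: real where "f holomorphic_on - {0}" "g holomorphic_on - {0}"
    "\<And>x \<nu>. (x, \<nu>) \<in> curve (M22_param (r, \<phi>)) \<Longrightarrow> \<mu> (x, \<nu>) = f x + g x * \<nu>"
    "\<And>z. z \<in> \<Omega> \<Longrightarrow> M z = f (curve_x \<phi> z) + g (curve_x \<phi> z) * (nu_factor \<phi> (curve_x \<phi> z) * csqrt (branch_fun (modulus r) z))"
    "\<And>z. z \<in> \<Omega> \<Longrightarrow> (M has_field_derivative M' z) (at z)"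
    "\<And>z. z \<in> \<Omega> \<Longrightarrow> csqrt (branch_fun (modulus r) z) * M' z = (log_form (modulus r) s t z + of_real j) * M z"
    "\<And>z. z \<in> \<Omega> \<Longrightarrow> M z \<noteq> 0"
    "poly b 0 = - cis (- \<phi>) * Complex s t / 2"
proof -
  define m where "m = modulus r"
  have m: "m > 0" unfolding m_def using modulus_pos[OF r] .
  let ?a = "M22_param (r, \<phi>)"
  define \<gamma> where "\<gamma> = cis (2 * \<phi>)"
  from adm have nz: "\<And>p. p \<in> curve ?a \<Longrightarrow> \<mu> p \<noteq> 0" and dln: "dln_eq ?a b \<mu>"
    and "\<exists>f g. f holomorphic_on - {0} \<and> g holomorphic_on - {0} \<and> (\<forall>(x, \<nu>)\<in>curve ?a. \<mu> (x, \<nu>) = f x + g x * \<nu>)"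
    unfolding admissible_def by blast+
  then obtain f g where f: "f holomorphic_on - {0}" and g: "g holomorphic_on - {0}"
    and fg: "\<And>x \<nu>. (x, \<nu>) \<in> curve ?a \<Longrightarrow> \<mu> (x, \<nu>) = f x + g x * \<nu>" by blast
  define V where "V z = csqrt (branch_fun m z)" for z
  define \<nu> where "\<nu> z = nu_factor \<phi> (curve_x \<phi> z) * V z" for z
  define M where "M z = f (curve_x \<phi> z) + g (curve_x \<phi> z) * \<nu> z" for z
  have cur: "(curve_x \<phi> z, \<nu> z) \<in> curve ?a" for z
    unfolding curve_iff[OF r(1)] \<nu>_def V_def m_def by (simp add: power_mult_distrib)
  have op: "open \<Omega>"
  proof -
    have "\<Omega> = branch_fun m -` (- \<real>\<^sub>\<le>\<^sub>0)" unfolding \<Omega>_def m_def by auto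
    then show ?thesis using holomorphic_on_imp_continuous_on[OF branch_fun_holomorphic[of m UNIV]]
      by (auto intro!: open_vimage simp: continuous_on_eq_continuous_at)
  qed
  have hV: "V holomorphic_on \<Omega>" unfolding V_def[abs_def]
    by (intro holomorphic_intros branch_fun_holomorphic) (auto simp: \<Omega>_def m_def)
  have hl: "curve_x \<phi> holomorphic_on A" for A unfolding curve_x_def[abs_def] by (intro holomorphic_intros)
  have hw: "(\<lambda>z. nu_factor \<phi> (curve_x \<phi> z)) holomorphic_on A" for A unfolding nu_factor_def by (intro holomorphic_intros hl)
  have h\<nu>: "\<nu> holomorphic_on \<Omega>" unfolding \<nu>_def[abs_def] by (intro holomorphic_intros hV hw)
  have ls: "curve_x \<phi> ` A \<subseteq> - {0}" for A using curve_x_nz by auto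
  have hM: "M holomorphic_on \<Omega>" unfolding M_def[abs_def]
    using holomorphic_on_compose_gen[OF hl f ls] holomorphic_on_compose_gen[OF hl g ls] unfolding o_def
    by (intro holomorphic_intros h\<nu>) auto
  have DM: "(M has_field_derivative deriv M z) (at z)" if "z \<in> \<Omega>" for z by (rule holomorphic_derivI[OF hM op that])
  have cM': "continuous_on \<Omega> (deriv M)" by (intro holomorphic_on_imp_continuous_on holomorphic_deriv hM op)
  have M\<mu>: "M z = \<mu> (curve_x \<phi> z, \<nu> z)" for z unfolding M_def using fg[OF cur] by simp
  have Mfun: "M = (\<lambda>z. \<mu> (curve_x \<phi> z, \<nu> z))" using M\<mu> by (simp add: fun_eq_iff)
  have Mnz: "M z \<noteq> 0" for z unfolding M\<mu> using nz[OF cur] .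
  define w where "w = \<gamma> * \<gamma>"
  have ne: "curve_x \<phi> z \<noteq> \<gamma>" if "exp (2 * z) \<noteq> w" for z
  proof
    assume "curve_x \<phi> z = \<gamma>"
    then have "\<gamma> * curve_x \<phi> z = w" unfolding w_def by simp
    moreover have "\<gamma> * curve_x \<phi> z = exp (2 * z)" unfolding \<gamma>_def curve_x_def by (simp add: mult.assoc[symmetric] cis_mult)
    ultimately show False using that by simp
  qed
  have step1: "\<nu> z * deriv M z = poly b (curve_x \<phi> z) * M z" if z: "z \<in> \<Omega>" "exp (2 * z) \<noteq> w" for z
  proof -
    \<comment> \<open>here \<open>\<nu> \<noteq> 0\<close>, so the pulled back path is in the smooth part\<close>
    define \<Omega>1 where "\<Omega>1 = \<Omega> \<inter> (\<lambda>z. exp (2 * z)) -` (- {w})"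
    have o1: "open \<Omega>1" unfolding \<Omega>1_def by (intro open_Int op open_vimage continuous_intros)
    have \<nu>nz: "\<nu> z \<noteq> 0" if "z \<in> \<Omega>1" for z
      using that ne[of z] curve_x_nz unfolding \<nu>_def nu_factor_def V_def \<Omega>1_def \<Omega>_def m_def \<gamma>_def by auto
    have "z \<in> \<Omega>1" using z unfolding \<Omega>1_def by simp
    have "open \<Omega>1 \<and> curve_x \<phi> holomorphic_on \<Omega>1 \<and> \<nu> holomorphic_on \<Omega>1 \<and> (\<forall>t\<in>\<Omega>1. (curve_x \<phi> t, \<nu> t) \<in> smooth_part ?a)"
      using o1 hl holomorphic_on_subset[OF h\<nu>] \<nu>nz cur unfolding smooth_part_def by (auto simp: \<Omega>1_def)
    then have "deriv (\<lambda>t. \<mu> (curve_x \<phi> t, \<nu> t)) z / \<mu> (curve_x \<phi> z, \<nu> z) = poly b (curve_x \<phi> z) / (2 * \<nu> z) * (deriv (curve_x \<phi>) z / curve_x \<phi> z)"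
      using dln \<open>z \<in> \<Omega>1\<close> \<nu>nz unfolding dln_eq_def by blast
    moreover have "(curve_x \<phi> has_field_derivative 2 * curve_x \<phi> z) (at z)"
      unfolding curve_x_def[abs_def] by (auto intro!: derivative_eq_intros)
    then have "deriv (curve_x \<phi>) z = 2 * curve_x \<phi> z" by (rule DERIV_imp_deriv)
    ultimately have "deriv M z / M z = poly b (curve_x \<phi> z) / \<nu> z" using curve_x_nz unfolding Mfun by simp
    then show ?thesis using Mnz[of z] \<nu>nz[OF \<open>z \<in> \<Omega>1\<close>] by (simp add: frac_eq_eq mult.commute)
  qed
  have step2: "\<nu> z * deriv M z - poly b (curve_x \<phi> z) * M z = 0" if z: "z \<in> \<Omega>" for z
  proof (rule continuous_zero_at_isolated[OF op _ _ z, where w = w])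
    show "continuous_on \<Omega> (\<lambda>z. \<nu> z * deriv M z - poly b (curve_x \<phi> z) * M z)"
      by (intro continuous_intros holomorphic_on_imp_continuous_on h\<nu> hM hl cM')
  qed (use step1 in simp)
  have \<eta>: "\<i> * of_real x \<in> \<Omega>" for x :: real
    unfolding \<Omega>_def m_def[symmetric] mem_Collect_eq branch_fun_i[OF m] using axis_root_pos[OF m, of x] by (auto simp: complex_nonpos_Reals_iff)
  have l\<eta>: "curve_x \<phi> (\<i> * of_real (2 * \<phi>)) = \<gamma>"
  proof -
    have "exp (2 * (\<i> * of_real (2 * \<phi>))) = cis (4 * \<phi>)" by (simp add: cis_conv_exp mult_ac)
    then show ?thesis unfolding curve_x_def \<gamma>_def by (simp add: cis_mult)
  qed
  have root: "poly b (cis (2 * \<phi>)) = 0"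
    using step2[OF \<eta>[of "2 * \<phi>"]] Mnz[of "\<i> * of_real (2 * \<phi>)"] unfolding l\<eta> \<nu>_def nu_factor_def \<gamma>_def by simp
  obtain s t j :: real where stj: "\<And>z. poly b (curve_x \<phi> z) = nu_factor \<phi> (curve_x \<phi> z) * (log_form m s t z + of_real j)"
    and b0: "poly b 0 = - cis (- \<phi>) * Complex s t / 2"
    using reality_normal_form[OF deg real root] by blast
  have step3: "V z * deriv M z - (log_form m s t z + of_real j) * M z = 0" if z: "z \<in> \<Omega>" for z
  proof (rule continuous_zero_at_isolated[OF op _ _ z, where w = w])
    show "continuous_on \<Omega> (\<lambda>z. V z * deriv M z - (log_form m s t z + of_real j) * M z)"
      unfolding log_form_def form_num_def by (intro continuous_intros holomorphic_on_imp_continuous_on hV hM cM')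
    fix z assume z: "z \<in> \<Omega>" "exp (2 * z) \<noteq> w"
    have "nu_factor \<phi> (curve_x \<phi> z) * (V z * deriv M z - (log_form m s t z + of_real j) * M z) = 0"
      using step2[OF z(1)] unfolding \<nu>_def stj by (simp add: algebra_simps)
    moreover have "nu_factor \<phi> (curve_x \<phi> z) \<noteq> 0" using ne[OF z(2)] curve_x_nz unfolding nu_factor_def \<gamma>_def by simp
    ultimately show "V z * deriv M z - (log_form m s t z + of_real j) * M z = 0" by simp
  qed
  show ?thesis
    by (rule that[of f g M "deriv M" s t j]) (use f g fg DM step3 Mnz b0 in \<open>auto simp: M_def \<nu>_def V_def m_def\<close>)
qed

section \<open>Level curves of the real part\<close>

text \<open>The left-hand side is the bracket that appears in the Jacobian of \<open>\<tau>\<close> with respect to modulus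
  and angle, and in the derivative of \<open>Im \<tau>\<close> along the level curves of \<open>Re \<tau>\<close>. All terms that
  depend on \<open>t\<close> beyond the factor \<open>(axis_root m t)\<^sup>2\<close> cancel, and the right-hand side is positive
  because of \<open>0 < period_ratio m < m\<close>.\<close>

lemma log_deriv_identity:
  assumes m: "m > 0"
  shows "(m - period_ratio m + (sin t)\<^sup>2) * (1 - 2 * log_deriv m * (axis_root m t)\<^sup>2) - 2 * log_deriv m * (sin t)\<^sup>2 * (cos t)\<^sup>2
    = (m - period_ratio m) * (1 + m - period_ratio m) * (axis_root m t)\<^sup>2 / (m * (1 + m))"
  unfolding axis_root_sq[OF m] cos_squared_eq log_deriv_def using m
  by (simp add: divide_simps) (simp add: algebra_simps power2_eq_square)

lemma axis_integral_strict_mono: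
  assumes m: "m > 0" and "0 \<le> a" "a < b"
  shows "axis_integral m a < axis_integral m b"
proof (rule DERIV_pos_imp_increasing_open[OF \<open>a < b\<close>])
  fix x assume "a < x" "x < b"
  then have x: "x > 0" using assms by simp
  have "(m - period_ratio m + (sin x)\<^sup>2) / axis_root m x > 0" using period_ratio_bounds[OF m] axis_root_pos[OF m] by (auto intro!: divide_pos_pos add_pos_nonneg)
  then show "\<exists>y. (axis_integral m has_real_derivative y) (at x) \<and> 0 < y" using DERIV_axis_integral_t[OF m x] by blast
next
  show "continuous_on {a..b} (axis_integral m)" by (rule continuous_on_subset[OF continuous_axis_integral[OF m, of b]]) (use assms in auto)
qed

lemma isCont_period_ratio: "m > 0 \<Longrightarrow> isCont period_ratio m" by (rule DERIV_isCont[OF DERIV_period_ratio])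

lemma axis_integral_total_derivative:
  assumes m: "m > 0" and t: "t > 0"
  shows "((\<lambda>(m, t). axis_integral m t) has_derivative
    (\<lambda>(a, b). log_deriv m * (axis_integral m t + sin t * cos t / axis_root m t) * a + (m - period_ratio m + (sin t)\<^sup>2) / axis_root m t * b)) (at (m, t))"
proof -
  let ?fy = "\<lambda>x y. blinfun_scaleR_left ((x - period_ratio x + (sin y)\<^sup>2) / axis_root x y)"
  have "((\<lambda>(m, t). axis_integral m t) has_derivative (\<lambda>(tx, ty). (*) (log_deriv m * (axis_integral m t + sin t * cos t / axis_root m t)) tx + ?fy m t ty))
    (at (m, t) within {0<..} \<times> {0<..})"
  proof (rule has_derivative_partialsI)
    show "((\<lambda>x. axis_integral x t) has_derivative (*) (log_deriv m * (axis_integral m t + sin t * cos t / axis_root m t))) (at m within {0<..})"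
      using DERIV_axis_integral_m[OF m, of t] t by (auto simp: has_field_derivative_def intro: has_derivative_at_withinI)
    fix x y :: real assume "x \<in> {0<..}" "y \<in> {0<..}"
    then have "(axis_integral x has_real_derivative (x - period_ratio x + (sin y)\<^sup>2) / axis_root x y) (at y)" by (intro DERIV_axis_integral_t) auto
    then have "(axis_integral x has_derivative (*) ((x - period_ratio x + (sin y)\<^sup>2) / axis_root x y)) (at y)" by (simp only: has_field_derivative_def)
    then have "(axis_integral x has_derivative blinfun_apply (?fy x y)) (at y)"
      by (rule has_derivative_eq_rhs) (simp add: fun_eq_iff)
    then show "((\<lambda>y. axis_integral x y) has_derivative blinfun_apply (?fy x y)) (at y within {0<..})"
      by (rule has_derivative_at_withinI)
  next
    have "continuous_on {0<..} period_ratio" using isCont_period_ratio by (auto intro: continuous_at_imp_continuous_on)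
    then have c1: "continuous_on ({0<..} \<times> {0<..}) (\<lambda>x :: real \<times> real. period_ratio (fst x))"
      by (rule continuous_on_compose2) (auto intro!: continuous_intros)
    have "continuous_on ({0<..} \<times> {0<..}) (\<lambda>(x, y). ?fy x y)"
      unfolding split_beta axis_root_def by (intro continuous_intros c1) (auto simp: sum_sq_nz)
    then show "continuous (at (m, t) within {0<..} \<times> {0<..}) (\<lambda>(x, y). ?fy x y)"
      using m t by (auto simp: continuous_on_eq_continuous_within)
  qed (use t in auto)
  moreover have "at (m, t) within {0<..} \<times> {0<..} = at (m, t)"
    using m t by (intro at_within_open open_Times) auto
  ultimately have "((\<lambda>(m, t). axis_integral m t) has_derivative (\<lambda>(tx, ty). (*) (log_deriv m * (axis_integral m t + sin t * cos t / axis_root m t)) tx + ?fy m t ty)) (at (m, t))"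
    by (simp only:)
  then show ?thesis by (rule has_derivative_eq_rhs) (simp add: fun_eq_iff)
qed

text \<open>For each \<open>m\<close> the quotient \<open>axis_integral m t / circle_period m\<close> increases from 0 to 1 as \<open>t\<close>
  runs from 0 to \<open>\<pi>\<close>, so it takes the value \<open>\<xi>\<close> at exactly one \<open>t = h m\<close>. The map \<open>(m, t) \<mapsto> (m,
  axis_integral m t / circle_period m)\<close> is injective with invertible differential, and its inverse
  \<open>G\<close> is differentiable; this gives the derivative of \<open>h\<close>.\<close>

lemma level_curve:
  assumes \<xi>: "0 < \<xi>" "\<xi> \<le> 1"
  obtains h where "\<And>m. m > 0 \<Longrightarrow> 0 < h m \<and> h m \<le> pi \<and> axis_integral m (h m) = \<xi> * circle_period m"
    "\<And>m. m > 0 \<Longrightarrow> (h has_real_derivative - (log_deriv m * sin (h m) * cos (h m)) / (m - period_ratio m + (sin (h m))\<^sup>2)) (at m)"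
proof -
  define F where "F m t = axis_integral m t / circle_period m" for m t
  define f where "f = (\<lambda>(m, t). (m, F m t))"
  define S :: "(real \<times> real) set" where "S = {0<..} \<times> {0<..}"
  define G where "G = (\<lambda>(m :: real, x). (m, SOME t. t > 0 \<and> F m t = x))"
  have oS: "open S" unfolding S_def by (intro open_Times) auto
  have Lp: "circle_period m > 0" if "m > 0" for m using circle_period_pos[OF that] .
  have Finj: "t = t'" if "m > 0" "t > 0" "t' > 0" "F m t = F m t'" for m t t'
  proof -
    have "axis_integral m t = axis_integral m t'" using that(4) Lp[OF that(1)] unfolding F_def by simp
    then show ?thesis using axis_integral_strict_mono[OF that(1), of t t'] axis_integral_strict_mono[OF that(1), of t' t] that by (cases t t' rule: linorder_cases) auto
  qed
  have ex: "\<exists>t. 0 < t \<and> t \<le> pi \<and> F m t = \<xi>" if m: "m > 0" for m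
  proof -
    have "\<exists>t\<ge>0. t \<le> pi \<and> axis_integral m t = \<xi> * circle_period m"
    proof (rule IVT')
      show "axis_integral m 0 \<le> \<xi> * circle_period m" using \<xi> Lp[OF m] by (simp add: axis_integral_zero)
      show "\<xi> * circle_period m \<le> axis_integral m pi" using \<xi> Lp[OF m] unfolding circle_period_def[symmetric] by simp
      show "continuous_on {0..pi} (axis_integral m)" by (rule continuous_axis_integral[OF m])
    qed simp
    then obtain t where t: "t \<ge> 0" "t \<le> pi" "axis_integral m t = \<xi> * circle_period m" by blast
    moreover have "t \<noteq> 0" using t(3) \<xi> Lp[OF m] axis_integral_zero[of m] by auto
    ultimately show ?thesis unfolding F_def using Lp[OF m] by (intro exI[of _ t]) auto
  qed
  define h where "h m = snd (G (m, \<xi>))" for m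
  have h: "0 < h m" "h m \<le> pi" "F m (h m) = \<xi>" if m: "m > 0" for m
  proof -
    obtain t where t: "0 < t" "t \<le> pi" "F m t = \<xi>" using ex[OF m] by blast
    have "h m > 0 \<and> F m (h m) = \<xi>" unfolding h_def G_def prod.case snd_conv by (rule someI[of _ t]) (use t in auto)
    moreover from this have "h m = t" using Finj[OF m _ t(1)] t(3) by simp
    ultimately show "0 < h m" "h m \<le> pi" "F m (h m) = \<xi>" using t by auto
  qed
  have GF: "G (f x) = x" if xS: "x \<in> S" for x
  proof -
    obtain m t where x: "x = (m, t)" "m > 0" "t > 0" using xS unfolding S_def by (cases x) auto
    have "(SOME t'. t' > 0 \<and> F m t' = F m t) = t"
      by (rule some_equality) (use x Finj in auto)
    then show ?thesis unfolding x(1) f_def G_def by simp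
  qed
  have Gh: "G (m, \<xi>) = (m, h m)" for m unfolding h_def G_def by simp
  define F1 where "F1 m t = log_deriv m * (sin t * cos t / axis_root m t) / circle_period m" for m t
  define F2 where "F2 m t = (m - period_ratio m + (sin t)\<^sup>2) / axis_root m t / circle_period m" for m t
  have F2p: "F2 m t > 0" if "m > 0" for m t
    unfolding F2_def using period_ratio_bounds[OF that] axis_root_pos[OF that] Lp[OF that] by (auto intro!: divide_pos_pos add_pos_nonneg)
  have Df: "(f has_derivative (\<lambda>(a, b). (a, F1 m t * a + F2 m t * b))) (at (m, t))" if m: "m > 0" and t: "t > 0" for m t
  proof -
    have "((\<lambda>x. circle_period (fst x)) has_derivative (\<lambda>x. log_deriv m * circle_period m * fst x)) (at (m, t))"
      using has_derivative_compose[OF has_derivative_fst[OF has_derivative_ident], of circle_period "(*) (log_deriv m * circle_period m)" "(m, t)" UNIV]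
        DERIV_circle_period[OF m] unfolding has_field_derivative_def by simp
    from has_derivative_divide'[OF axis_integral_total_derivative[OF m t] this]
    have "((\<lambda>x. F (fst x) (snd x)) has_derivative
      (\<lambda>v. ((log_deriv m * (axis_integral m t + sin t * cos t / axis_root m t) * fst v + (m - period_ratio m + (sin t)\<^sup>2) / axis_root m t * snd v) * circle_period m - axis_integral m t * (log_deriv m * circle_period m * fst v)) / (circle_period m * circle_period m))) (at (m, t))"
      unfolding F_def using Lp[OF m] by (simp add: split_beta)
    also have "(\<lambda>v. ((log_deriv m * (axis_integral m t + sin t * cos t / axis_root m t) * fst v + (m - period_ratio m + (sin t)\<^sup>2) / axis_root m t * snd v) * circle_period m - axis_integral m t * (log_deriv m * circle_period m * fst v)) / (circle_period m * circle_period m))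
      = (\<lambda>v. F1 m t * fst v + F2 m t * snd v)"
      unfolding F1_def F2_def using Lp[OF m] axis_root_pos[OF m, of t] by (intro ext) (simp add: field_simps)
    finally have "((\<lambda>x. F (fst x) (snd x)) has_derivative (\<lambda>v. F1 m t * fst v + F2 m t * snd v)) (at (m, t))" .
    from has_derivative_Pair[OF has_derivative_fst[OF has_derivative_ident] this]
    show ?thesis unfolding f_def split_beta .
  qed
  have Dh: "(h has_real_derivative - (F1 m (h m)) / F2 m (h m)) (at m)" if m: "m > 0" for m
  proof -
    let ?g' = "\<lambda>(a, b). (a, (b - F1 m (h m) * a) / F2 m (h m))"
    have fh: "f (m, h m) = (m, \<xi>)" unfolding f_def using h(3)[OF m] by simp
    have DG: "(G has_derivative ?g') (at (f (m, h m)))"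
    proof (rule has_derivative_inverse_strong[OF oS, where f = f and x = "(m, h m)" and f' = "\<lambda>(a, b). (a, F1 m (h m) * a + F2 m (h m) * b)"])
      show "(m, h m) \<in> S" unfolding S_def using m h(1)[OF m] by simp
      show "continuous_on S f"
        by (intro continuous_at_imp_continuous_on ballI) (auto simp: S_def intro: has_derivative_continuous[OF Df])
      show "(f has_derivative (\<lambda>(a, b). (a, F1 m (h m) * a + F2 m (h m) * b))) (at (m, h m))"
        by (rule Df[OF m h(1)[OF m]])
      show "(\<lambda>(a, b). (a, F1 m (h m) * a + F2 m (h m) * b)) \<circ> ?g' = id"
        using F2p[OF m, of "h m"] by (auto simp: fun_eq_iff)
    qed (use GF in auto)
    have "((\<lambda>m. (m, \<xi>)) has_derivative (\<lambda>a. (a, 0))) (at m)" by (auto intro!: derivative_eq_intros)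
    from has_derivative_compose[OF this DG[unfolded fh]]
    have "((\<lambda>m. G (m, \<xi>)) has_derivative (\<lambda>a. ?g' (a, 0))) (at m)" .
    then have "((\<lambda>m. snd (G (m, \<xi>))) has_derivative (\<lambda>a. snd (?g' (a, 0)))) (at m)" by (rule has_derivative_snd)
    then show ?thesis unfolding h_def[abs_def, symmetric] has_field_derivative_def
      by (rule has_derivative_eq_rhs) (auto simp: fun_eq_iff)
  qed
  show ?thesis
  proof (rule that)
    fix m :: real assume m: "m > 0"
    show "0 < h m \<and> h m \<le> pi \<and> axis_integral m (h m) = \<xi> * circle_period m" using h[OF m] Lp[OF m] unfolding F_def by (simp add: field_simps)
    have "m - period_ratio m + (sin (h m))\<^sup>2 > 0" using period_ratio_bounds[OF m] by (auto intro: add_pos_nonneg)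
    then have "- (F1 m (h m)) / F2 m (h m) = - (log_deriv m * sin (h m) * cos (h m)) / (m - period_ratio m + (sin (h m))\<^sup>2)"
      unfolding F1_def F2_def using Lp[OF m] axis_root_pos[OF m, of "h m"] by (simp add: field_simps)
    then show "(h has_real_derivative - (log_deriv m * sin (h m) * cos (h m)) / (m - period_ratio m + (sin (h m))\<^sup>2)) (at m)"
      using Dh[OF m] by simp
  qed
qed

text \<open>For \<open>m = 0\<close> the integrand would be \<open>sin\<close>. It differs from \<open>sin\<close> by at most \<open>sqrt m\<close>.\<close>

lemma axis_integral_bounds:
  assumes m: "m > 0" and t: "0 \<le> t" "t \<le> pi"
  shows "\<bar>axis_integral m t - (1 - cos t)\<bar> \<le> sqrt m * t"
proof -
  have Is: "(sin has_integral (1 - cos t)) {0..t}"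
  proof -
    have "(sin has_integral (- cos t - - cos 0)) {0..t}"
      by (rule fundamental_theorem_of_calculus[OF t(1)])
        (auto intro!: derivative_eq_intros simp flip: has_real_derivative_iff_has_vector_derivative)
    then show ?thesis by simp
  qed
  have Ig: "((\<lambda>t. (m - period_ratio m + (sin t)\<^sup>2) / axis_root m t) has_integral axis_integral m t) {0..t}"
    unfolding axis_integral_def by (intro integrable_integral integrable_continuous_real continuous_on_subset[OF continuous_axis_integral_integrand[OF m]]) auto
  have "norm (integral {0..t} (\<lambda>x. (m - period_ratio m + (sin x)\<^sup>2) / axis_root m x - sin x)) \<le> integral {0..t} (\<lambda>x. sqrt m)"
  proof (rule integral_norm_bound_integral)
    fix x assume x: "x \<in> {0..t}"
    define s where "s = sin x"
    have s: "s \<ge> 0" unfolding s_def using x t by (intro sin_ge_zero) auto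
    define d where "d = axis_root m x"
    have d: "d > 0" "d\<^sup>2 = m + s\<^sup>2" unfolding d_def s_def using axis_root_pos[OF m] axis_root_sq[OF m] by auto
    have du: "d \<le> s + sqrt m" unfolding d_def axis_root_def s_def[symmetric]
      using s m by (intro real_le_lsqrt) (auto simp: power2_sum)
    have "(m - period_ratio m + s\<^sup>2) / d \<le> d"
      using period_ratio_bounds[OF m] d by (simp add: pos_divide_le_eq power2_eq_square)
    then have 1: "(m - period_ratio m + s\<^sup>2) / d \<le> s + sqrt m" using du by linarith
    have "(s - sqrt m) * d \<le> s\<^sup>2"
    proof (cases "s \<ge> sqrt m")
      case True
      then have "(s - sqrt m) * d \<le> (s - sqrt m) * (s + sqrt m)" using du by (intro mult_left_mono) auto
      also have "\<dots> = s\<^sup>2 - m" using m by (simp add: algebra_simps power2_eq_square)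
      finally show ?thesis using m by linarith
    next
      case False
      then have "(s - sqrt m) * d \<le> 0" using d(1) by (intro mult_nonpos_nonneg) auto
      then show ?thesis using zero_le_power2[of s] by linarith
    qed
    then have "(s - sqrt m) * d \<le> m - period_ratio m + s\<^sup>2" using period_ratio_bounds[OF m] by linarith
    then have 2: "s - sqrt m \<le> (m - period_ratio m + s\<^sup>2) / d" using d(1) by (simp add: pos_le_divide_eq)
    show "norm ((m - period_ratio m + (sin x)\<^sup>2) / axis_root m x - sin x) \<le> sqrt m"
      using 1 2 unfolding s_def d_def by (simp add: abs_le_iff)
  next
    show "(\<lambda>x. (m - period_ratio m + (sin x)\<^sup>2) / axis_root m x - sin x) integrable_on {0..t}"
      using has_integral_diff[OF Ig Is] by blast
    show "(\<lambda>x. sqrt m) integrable_on {0..t}" by (intro integrable_continuous_real continuous_on_const)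
  qed
  moreover have "integral {0..t} (\<lambda>x. (m - period_ratio m + (sin x)\<^sup>2) / axis_root m x - sin x) = axis_integral m t - (1 - cos t)"
    using has_integral_diff[OF Ig Is] by (rule integral_unique)
  ultimately show ?thesis using t by (simp add: mult.commute)
qed

lemma circle_period_upper: assumes m: "m > 0" shows "circle_period m \<le> pi * (m - period_ratio m + 1) / sqrt m"
proof -
  have Ig: "((\<lambda>t. (m - period_ratio m + (sin t)\<^sup>2) / axis_root m t) has_integral circle_period m) {0..pi}"
    unfolding axis_integral_def circle_period_def by (intro integrable_integral integrable_continuous_real continuous_on_subset[OF continuous_axis_integral_integrand[OF m]]) auto
  have "((\<lambda>t::real. (m - period_ratio m + 1) / sqrt m) has_integral pi * ((m - period_ratio m + 1) / sqrt m)) {0..pi}"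
    using has_integral_const_real[of "(m - period_ratio m + 1) / sqrt m" 0 pi] by simp
  from has_integral_le[OF Ig this] show ?thesis
  proof -
    assume *: "(\<And>x. x \<in> {0..pi} \<Longrightarrow> (m - period_ratio m + (sin x)\<^sup>2) / axis_root m x \<le> (m - period_ratio m + 1) / sqrt m) \<Longrightarrow> circle_period m \<le> pi * ((m - period_ratio m + 1) / sqrt m)"
    have "(m - period_ratio m + (sin x)\<^sup>2) / axis_root m x \<le> (m - period_ratio m + 1) / sqrt m" for x
      using period_ratio_bounds[OF m] m unfolding axis_root_def
      by (intro frac_le) (auto simp: abs_square_le_1 abs_sin_le_one)
    then show ?thesis using * by simp
  qed
qed

text \<open>The difference is \<open>(m period_K - period_K1) / period_K\<close>. The numerator is the integral of \<open>m
  sin\<^sup>2 / sqrt (1 + m sin\<^sup>2) \<le> sqrt m sin\<close>, while \<open>sqrt m period_K\<close> grows at least like \<open>ln m /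
  2\<close>, because \<open>sin \<psi> \<le> \<psi>\<close> bounds it below by an elementary integral.\<close>

lemma period_ratio_gap_upper: assumes m: "m > 1" shows "m - period_ratio m \<le> 2 * m / ln m"
proof -
  have m0: "m > 0" using m by simp
  have IK: "((\<lambda>\<psi>. 1 / sqrt (1 + m * (sin \<psi>)\<^sup>2)) has_integral period_K m) {0..pi/2}"
    unfolding period_K_def by (intro integrable_integral integrable_continuous_real continuous_on_subset[OF continuous_period_K_integrand[OF m0]]) auto
  have IK1: "((\<lambda>\<psi>. m * (cos \<psi>)\<^sup>2 / sqrt (1 + m * (sin \<psi>)\<^sup>2)) has_integral period_K1 m) {0..pi/2}"
    unfolding period_K1_def by (intro integrable_integral integrable_continuous_real continuous_on_subset[OF continuous_period_K1_integrand[OF m0]]) auto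
  have Is: "((\<lambda>\<psi>. sqrt m * sin \<psi>) has_integral sqrt m * 1) {0..pi/2}"
  proof (rule has_integral_mult_right)
    have "(sin has_integral (- cos (pi/2) - - cos 0)) {0..pi/2}"
      by (rule fundamental_theorem_of_calculus)
        (auto intro!: derivative_eq_intros simp flip: has_real_derivative_iff_has_vector_derivative)
    then show "(sin has_integral 1) {0..pi/2}" by simp
  qed
  have "m * period_K m - period_K1 m \<le> sqrt m * 1"
  proof (rule has_integral_le[OF has_integral_diff[OF has_integral_mult_right[OF IK, of m] IK1] Is])
    fix \<psi> assume p: "\<psi> \<in> {0..pi/2}"
    define s where "s = sin \<psi>"
    have s: "s \<ge> 0" unfolding s_def using p by (intro sin_ge_zero) auto
    define v where "v = sqrt (1 + m * s\<^sup>2)"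
    have v: "v > 0" unfolding v_def s_def using cont_sq_pos[OF m0, of \<psi>] by simp
    have "sqrt m * s \<le> v" unfolding v_def using s m0 by (intro real_le_rsqrt) (simp add: power_mult_distrib)
    then have "(sqrt m * s) * (sqrt m * s) \<le> (sqrt m * s) * v" using s m0 by (intro mult_left_mono) auto
    then have "m * s\<^sup>2 \<le> sqrt m * s * v" using m0 by (simp add: power2_eq_square mult_ac)
    then have "m * s\<^sup>2 / v \<le> sqrt m * s" using v by (simp add: pos_divide_le_eq)
    moreover have "m * (1 / v) - m * (cos \<psi>)\<^sup>2 / v = m * s\<^sup>2 / v"
      unfolding s_def cos_squared_eq by (simp add: field_simps diff_divide_distrib)
    ultimately show "m * (1 / sqrt (1 + m * (sin \<psi>)\<^sup>2)) - m * (cos \<psi>)\<^sup>2 / sqrt (1 + m * (sin \<psi>)\<^sup>2) \<le> sqrt m * sin \<psi>"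
      unfolding v_def s_def by simp
  qed
  have "arsinh (sqrt m * (pi/2)) \<le> sqrt m * period_K m"
  proof (rule has_integral_le[OF _ has_integral_mult_right[OF IK, of "sqrt m"]])
    have "((\<lambda>\<psi>. sqrt m / sqrt (1 + m * \<psi>\<^sup>2)) has_integral (arsinh (sqrt m * (pi/2)) - arsinh (sqrt m * 0))) {0..pi/2}"
    proof (rule fundamental_theorem_of_calculus)
      fix x :: real
      have e: "(sqrt m * x)\<^sup>2 + 1 = 1 + m * x\<^sup>2" using m0 by (simp add: power_mult_distrib)
      have "((\<lambda>\<psi>. arsinh (sqrt m * \<psi>)) has_real_derivative (1 / sqrt ((sqrt m * x)\<^sup>2 + 1)) * sqrt m) (at x)"
        by (rule DERIV_chain2[where f = arsinh and g = "\<lambda>\<psi>. sqrt m * \<psi>"]) (auto intro!: derivative_eq_intros)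
      then have "((\<lambda>\<psi>. arsinh (sqrt m * \<psi>)) has_real_derivative sqrt m / sqrt (1 + m * x\<^sup>2)) (at x)" unfolding e by simp
      then have "((\<lambda>\<psi>. arsinh (sqrt m * \<psi>)) has_vector_derivative sqrt m / sqrt (1 + m * x\<^sup>2)) (at x)"
        by (simp only: has_real_derivative_iff_has_vector_derivative)
      then show "((\<lambda>\<psi>. arsinh (sqrt m * \<psi>)) has_vector_derivative sqrt m / sqrt (1 + m * x\<^sup>2)) (at x within {0..pi/2})"
        by (rule has_vector_derivative_at_within)
    qed simp
    then show "((\<lambda>\<psi>. sqrt m / sqrt (1 + m * \<psi>\<^sup>2)) has_integral arsinh (sqrt m * (pi/2))) {0..pi/2}" by simp
    fix \<psi> assume p: "\<psi> \<in> {0..pi/2}"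
    have "0 \<le> sin \<psi>" "sin \<psi> \<le> \<psi>" using p by (auto intro!: sin_ge_zero sin_x_le_x)
    then have "(sin \<psi>)\<^sup>2 \<le> \<psi>\<^sup>2" by (intro power_mono) auto
    then have "sqrt (1 + m * (sin \<psi>)\<^sup>2) \<le> sqrt (1 + m * \<psi>\<^sup>2)" using m0 by simp
    then have "sqrt m / sqrt (1 + m * \<psi>\<^sup>2) \<le> sqrt m / sqrt (1 + m * (sin \<psi>)\<^sup>2)"
      using cont_sq_pos[OF m0, of \<psi>] m0 by (intro divide_left_mono) (auto intro!: mult_pos_pos add_pos_nonneg)
    then show "sqrt m / sqrt (1 + m * \<psi>\<^sup>2) \<le> sqrt m * (1 / sqrt (1 + m * (sin \<psi>)\<^sup>2))" by simp
  qed
  moreover have "ln m / 2 \<le> arsinh (sqrt m * (pi/2))"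
  proof -
    have "ln m / 2 = ln (sqrt m)" using m0 by (simp add: ln_sqrt)
    also have "\<dots> \<le> ln (sqrt m * (pi/2) + sqrt ((sqrt m * (pi/2))\<^sup>2 + 1))"
    proof (rule ln_mono)
      have "sqrt m * 1 \<le> sqrt m * (pi/2)" using pi_gt3 m0 by (intro mult_left_mono) auto
      moreover have "0 \<le> sqrt ((sqrt m * (pi/2))\<^sup>2 + 1)" by simp
      ultimately show "sqrt m \<le> sqrt m * (pi/2) + sqrt ((sqrt m * (pi/2))\<^sup>2 + 1)" by linarith
    qed (use m0 in auto)
    finally show ?thesis unfolding arsinh_real_def .
  qed
  ultimately have "ln m / 2 \<le> sqrt m * period_K m" by linarith
  moreover have "ln m > 0" using m by simp
  ultimately have "m * period_K m - period_K1 m \<le> (2 * m / ln m) * period_K m"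
  proof -
    assume l: "ln m / 2 \<le> sqrt m * period_K m" "ln m > 0"
    have "sqrt m * ln m \<le> sqrt m * (2 * (sqrt m * period_K m))" using l m0 by (intro mult_left_mono) auto
    also have "\<dots> = 2 * m * period_K m" using m0 by (simp add: mult.assoc[symmetric])
    finally have "sqrt m \<le> 2 * m * period_K m / ln m" using l(2) by (simp add: pos_le_divide_eq)
    then show ?thesis using \<open>m * period_K m - period_K1 m \<le> sqrt m * 1\<close> by simp
  qed
  then have "(m - period_ratio m) * period_K m \<le> (2 * m / ln m) * period_K m" unfolding period_ratio_def using period_K_pos[OF m0] by (simp add: left_diff_distrib)
  then show ?thesis using period_K_pos[OF m0] by (simp only: mult_le_cancel_right_pos)
qed

text \<open>\<open>Im \<tau>\<close> along a level curve of \<open>Re \<tau>\<close>.\<close>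

definition level_height :: "(real \<Rightarrow> real) \<Rightarrow> real \<Rightarrow> real" where "level_height h m = 2 * axis_root m (h m) / circle_period m"

lemma level_height_deriv_pos:
  assumes h: "\<And>m. m > 0 \<Longrightarrow> (h has_real_derivative - (log_deriv m * sin (h m) * cos (h m)) / (m - period_ratio m + (sin (h m))\<^sup>2)) (at m)"
    and m: "m > 0"
  shows "\<exists>y. (level_height h has_real_derivative y) (at m) \<and> 0 < y"
proof -
  define s where "s = sin (h m)"
  define c where "c = cos (h m)"
  define d where "d = axis_root m (h m)"
  define L where "L = circle_period m"
  define Q where "Q = m - period_ratio m + s\<^sup>2"
  have d: "d > 0" unfolding d_def by (rule axis_root_pos[OF m])
  have L: "L > 0" unfolding L_def by (rule circle_period_pos[OF m])
  have Q: "Q > 0" unfolding Q_def using period_ratio_bounds[OF m] by (auto intro: add_pos_nonneg)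
  let ?h' = "- (log_deriv m * s * c) / Q"
  have Dh: "(h has_real_derivative ?h') (at m)" using h[OF m] unfolding s_def c_def Q_def .
  have "((\<lambda>m. m + (sin (h m))\<^sup>2) has_real_derivative 1 + 2 * s * (c * ?h')) (at m)"
  proof -
    have D1: "((\<lambda>m. sin (h m)) has_real_derivative c * ?h') (at m)" unfolding c_def
      by (rule DERIV_chain2[where f = sin and g = h, OF DERIV_sin Dh[unfolded c_def]])
    have "((\<lambda>m. m + sin (h m) * sin (h m)) has_real_derivative 1 + (c * ?h' * s + c * ?h' * s)) (at m)"
      unfolding s_def by (intro DERIV_add DERIV_ident DERIV_mult D1[unfolded s_def])
    moreover have "1 + (c * ?h' * s + c * ?h' * s) = 1 + 2 * s * (c * ?h')" by simp
    ultimately show ?thesis unfolding power2_eq_square by (simp only:)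
  qed
  then have "((\<lambda>m. axis_root m (h m)) has_real_derivative inverse d / 2 * (1 + 2 * s * (c * ?h'))) (at m)"
    unfolding axis_root_def d_def
    by (rule DERIV_chain2[where f = sqrt and g = "\<lambda>m. m + (sin (h m))\<^sup>2", OF DERIV_real_sqrt[OF sum_sq_pos[OF m]]])
  then have D: "((\<lambda>m. 2 * axis_root m (h m) / circle_period m) has_real_derivative
     (2 * (inverse d / 2 * (1 + 2 * s * (c * ?h'))) * L - 2 * d * (log_deriv m * L)) / (L * L)) (at m)"
    unfolding L_def d_def using circle_period_pos[OF m] by (intro DERIV_divide DERIV_cmult DERIV_circle_period m) auto
  have "(2 * (inverse d / 2 * (1 + 2 * s * (c * ?h'))) * L - 2 * d * (log_deriv m * L)) / (L * L)
    = (Q * (1 - 2 * log_deriv m * d\<^sup>2) - 2 * log_deriv m * s\<^sup>2 * c\<^sup>2) / (d * L * Q)"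
    using d L Q by (simp add: divide_simps) (simp add: algebra_simps power2_eq_square)
  also have "\<dots> = ((m - period_ratio m) * (1 + m - period_ratio m) * d\<^sup>2 / (m * (1 + m))) / (d * L * Q)"
    unfolding Q_def d_def s_def c_def log_deriv_identity[OF m] ..
  also have "\<dots> > 0" using d L Q period_ratio_bounds[OF m] m by (intro divide_pos_pos mult_pos_pos) auto
  finally show ?thesis using D unfolding level_height_def[abs_def] by blast
qed

text \<open>As \<open>m \<rightarrow> 0\<close> the circle period tends to 2 and \<open>axis_integral m t\<close> to \<open>1 - cos t\<close>, so \<open>cos (h m) \<rightarrow>
  1 - 2 \<xi>\<close> along the level curve, and \<open>\<tau>\<close> tends to a point of the circle \<open>\<bar>\<tau> + 1\<bar> = 1\<close>.\<close>

lemma height_limit_zero: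
  assumes \<xi>: "0 < \<xi>" "\<xi> \<le> 1"
    and h: "\<And>m. m > 0 \<Longrightarrow> 0 < h m \<and> h m \<le> pi \<and> axis_integral m (h m) = \<xi> * circle_period m"
  shows "((\<lambda>m. (level_height h m)\<^sup>2) \<longlongrightarrow> 1 - (1 - 2 * \<xi>)\<^sup>2) (at_right 0)"
proof -
  have pos: "eventually (\<lambda>m::real. m > 0) (at_right 0)" by (rule eventually_at_right_less)
  have sq: "((\<lambda>m. sqrt m * (2 * pi)) \<longlongrightarrow> sqrt 0 * (2 * pi)) (at_right 0)" by (intro tendsto_intros)
  have LB: "\<bar>circle_period m - 2\<bar> \<le> sqrt m * pi" if "m > 0" for m
    using axis_integral_bounds[OF that, of pi] unfolding circle_period_def by simp
  have L: "(circle_period \<longlongrightarrow> 2) (at_right 0)"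
  proof (rule LIM_zero_cancel, rule Lim_null_comparison)
    show "((\<lambda>m. sqrt m * (2 * pi)) \<longlongrightarrow> 0) (at_right 0)" using sq by simp
    show "eventually (\<lambda>m. norm (circle_period m - 2) \<le> sqrt m * (2 * pi)) (at_right 0)"
      using pos by (rule eventually_mono) (use LB in \<open>auto intro: order_trans[OF LB] mult_left_mono\<close>)
  qed
  have C: "((\<lambda>m. cos (h m)) \<longlongrightarrow> 1 - 2 * \<xi>) (at_right 0)"
  proof (rule LIM_zero_cancel, rule Lim_null_comparison)
    show "((\<lambda>m. sqrt m * (2 * pi)) \<longlongrightarrow> 0) (at_right 0)" using sq by simp
    show "eventually (\<lambda>m. norm (cos (h m) - (1 - 2 * \<xi>)) \<le> sqrt m * (2 * pi)) (at_right 0)"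
      using pos
    proof (rule eventually_mono)
      fix m :: real assume m: "m > 0"
      have 1: "\<bar>\<xi> * circle_period m - (1 - cos (h m))\<bar> \<le> sqrt m * h m" using axis_integral_bounds[OF m, of "h m"] h[OF m] by simp
      have 2: "sqrt m * h m \<le> sqrt m * pi" using h[OF m] m by (intro mult_left_mono) auto
      have 3: "\<bar>\<xi> * (circle_period m - 2)\<bar> \<le> 1 * (sqrt m * pi)" unfolding abs_mult using \<xi> LB[OF m] by (intro mult_mono) auto
      have "cos (h m) - (1 - 2 * \<xi>) = (\<xi> * circle_period m - (1 - cos (h m))) - \<xi> * (circle_period m - 2)" by (simp add: algebra_simps)
      then have "\<bar>cos (h m) - (1 - 2 * \<xi>)\<bar> \<le> \<bar>\<xi> * circle_period m - (1 - cos (h m))\<bar> + \<bar>\<xi> * (circle_period m - 2)\<bar>"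
        using abs_triangle_ineq4 by metis
      then show "norm (cos (h m) - (1 - 2 * \<xi>)) \<le> sqrt m * (2 * pi)" using 1 2 3 by simp
    qed
  qed
  have "((\<lambda>m. 4 * (m + (1 - (cos (h m))\<^sup>2)) / (circle_period m)\<^sup>2) \<longlongrightarrow> 4 * (0 + (1 - (1 - 2 * \<xi>)\<^sup>2)) / 2\<^sup>2) (at_right 0)"
    by (intro tendsto_intros L C) simp
  moreover have "4 * (0 + (1 - x)) / 2\<^sup>2 = 1 - x" for x :: real by simp
  ultimately have "((\<lambda>m. 4 * (m + (1 - (cos (h m))\<^sup>2)) / (circle_period m)\<^sup>2) \<longlongrightarrow> 1 - (1 - 2 * \<xi>)\<^sup>2) (at_right 0)" by (simp only:)
  moreover have "eventually (\<lambda>m. 4 * (m + (1 - (cos (h m))\<^sup>2)) / (circle_period m)\<^sup>2 = (level_height h m)\<^sup>2) (at_right 0)"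
    using pos by (rule eventually_mono) (simp add: level_height_def power_divide power_mult_distrib axis_root_sq sin_squared_eq)
  ultimately show ?thesis by (rule Lim_transform_eventually)
qed

text \<open>\<open>axis_root \<ge> sqrt m\<close>, while \<open>circle_period\<close> is of smaller order than \<open>sqrt m\<close> by
  \<open>period_ratio_gap_upper\<close>. This bound tends to infinity with \<open>m\<close>.\<close>

lemma height_lower:
  assumes m: "m > 1"
  shows "2 / (pi * (2 / ln m + 1 / m)) \<le> level_height h m"
proof -
  have m0: "m > 0" using m by simp
  have l: "ln m > 0" using m by simp
  have L: "circle_period m > 0" by (rule circle_period_pos[OF m0])
  have "circle_period m \<le> pi * (m - period_ratio m + 1) / sqrt m" by (rule circle_period_upper[OF m0])
  also have "\<dots> \<le> pi * (2 * m / ln m + 1) / sqrt m" using period_ratio_gap_upper[OF m] m0 by (intro divide_right_mono mult_left_mono) auto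
  also have "2 * m / ln m + 1 = m * (2 / ln m + 1 / m)" using m0 by (simp add: field_simps)
  also have "pi * (m * (2 / ln m + 1 / m)) / sqrt m = (m / sqrt m) * (pi * (2 / ln m + 1 / m))" by simp
  also have "m / sqrt m = sqrt m" using m0 by (simp add: real_div_sqrt)
  finally have LU: "circle_period m \<le> sqrt m * (pi * (2 / ln m + 1 / m))" .
  have P: "pi * (2 / ln m + 1 / m) > 0" using l m0 by (intro mult_pos_pos add_pos_pos divide_pos_pos) auto
  have "2 * circle_period m \<le> 2 * sqrt m * (pi * (2 / ln m + 1 / m))" using LU by simp
  also have "\<dots> \<le> 2 * axis_root m (h m) * (pi * (2 / ln m + 1 / m))"
    using P unfolding axis_root_def by (intro mult_right_mono) auto
  finally show ?thesis unfolding level_height_def using L P by (simp add: frac_le_eq divide_simps mult_ac)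
qed

text \<open>A continuous and strictly increasing function takes exactly the values between its limits.\<close>

lemma height_range:
  assumes \<xi>: "0 < \<xi>" "\<xi> \<le> 1"
    and h: "\<And>m. m > 0 \<Longrightarrow> 0 < h m \<and> h m \<le> pi \<and> axis_integral m (h m) = \<xi> * circle_period m"
      "\<And>m. m > 0 \<Longrightarrow> (h has_real_derivative - (log_deriv m * sin (h m) * cos (h m)) / (m - period_ratio m + (sin (h m))\<^sup>2)) (at m)"
  shows "m > 0 \<Longrightarrow> (level_height h m)\<^sup>2 > 1 - (1 - 2 * \<xi>)\<^sup>2"
    and "y > 0 \<Longrightarrow> y\<^sup>2 > 1 - (1 - 2 * \<xi>)\<^sup>2 \<Longrightarrow> \<exists>m>0. level_height h m = y"
proof -
  let ?L = "1 - (1 - 2 * \<xi>)\<^sup>2"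
  have pos: "level_height h m > 0" if "m > 0" for m unfolding level_height_def using axis_root_pos[OF that] circle_period_pos[OF that] by simp
  have cont: "isCont (level_height h) m" if "m > 0" for m using level_height_deriv_pos[OF h(2) that] DERIV_isCont by blast
  have mono: "level_height h a < level_height h b" if "0 < a" "a < b" for a b
    by (rule DERIV_pos_imp_increasing[OF that(2)]) (use level_height_deriv_pos[OF h(2)] that in auto)
  have lim: "((\<lambda>m. (level_height h m)\<^sup>2) \<longlongrightarrow> ?L) (at_right 0)" by (rule height_limit_zero[OF \<xi> h(1)])
  show "(level_height h m)\<^sup>2 > ?L" if m: "m > 0"
  proof -
    have m2: "0 < m / 2" "m / 2 < m" using m by auto
    have "eventually (\<lambda>x. 0 < x \<and> x < m / 2) (at_right 0)"
      using eventually_at_right_real[OF m2(1)] by (rule eventually_mono) auto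
    then have "eventually (\<lambda>x. (level_height h x)\<^sup>2 \<le> (level_height h (m / 2))\<^sup>2) (at_right 0)"
    proof (rule eventually_mono)
      fix x assume x: "0 < x \<and> x < m / 2"
      then have "level_height h x \<le> level_height h (m / 2)" using mono[of x "m / 2"] by simp
      then show "(level_height h x)\<^sup>2 \<le> (level_height h (m / 2))\<^sup>2" using pos[of x] x by (intro power_mono) auto
    qed
    then have "?L \<le> (level_height h (m / 2))\<^sup>2" using lim by (intro tendsto_upperbound) auto
    also have "\<dots> < (level_height h m)\<^sup>2" using mono[OF m2] pos[OF m2(1)] by (intro power_strict_mono) auto
    finally show ?thesis .
  qed
  show "\<exists>m>0. level_height h m = y" if y: "y > 0" "y\<^sup>2 > ?L"
  proof -
    have "eventually (\<lambda>m. (level_height h m)\<^sup>2 < y\<^sup>2) (at_right 0)" using lim y(2) by (rule order_tendstoD)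
    then have "eventually (\<lambda>m. (level_height h m)\<^sup>2 < y\<^sup>2 \<and> 0 < m \<and> m < 1) (at_right 0)"
      by (intro eventually_conj eventually_at_right_less) (auto intro!: eventually_at_right_real[THEN eventually_mono])
    then obtain a where a: "(level_height h a)\<^sup>2 < y\<^sup>2" "0 < a" "a < 1"
      using eventually_happens' trivial_limit_at_right_real by blast
    have ya: "level_height h a < y" using a(1) y(1) by (rule power2_less_imp_less[OF _ less_imp_le])
    have "filterlim (\<lambda>m::real. 2 / (pi * (2 / ln m + 1 / m))) at_top at_top" using pi_gt_zero by real_asymp
    then have "eventually (\<lambda>m. y \<le> 2 / (pi * (2 / ln m + 1 / m)) \<and> m > 1) at_top"
      by (intro eventually_conj eventually_gt_at_top) (simp add: filterlim_at_top)
    then obtain b where b: "y \<le> 2 / (pi * (2 / ln b + 1 / b))" "b > 1"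
      using eventually_happens' trivial_limit_at_top_linorder by blast
    have yb: "y \<le> level_height h b" using b(1) height_lower[OF b(2), of h] by linarith
    have "\<exists>x\<ge>a. x \<le> b \<and> level_height h x = y"
      by (rule IVT') (use ya yb a b cont in \<open>auto intro!: continuous_at_imp_continuous_on\<close>)
    then obtain x where "x \<ge> a" "level_height h x = y" by blast
    then show ?thesis using a(2) by (intro exI[of _ x]) auto
  qed
qed

section \<open>The lattice of a spectral curve\<close>

text \<open>Integrate \<open>d ln M\<close> over the real segment from 0 to either branch point, \<open>\<epsilon>\<close> being the sign. The
  differential of the second kind contributes nothing by the choice of its constant, the one of
  the first kind contributes \<open>\<epsilon> j period_K\<close>, and the exact part \<open>\<i> t dV\<close> contributes \<open>- \<i> t sqrt
  m\<close>. At the branch point \<open>\<nu> = 0\<close>, so \<open>M\<close> extends continuously with the value \<open>f\<close>.\<close>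

lemma pullback_to_branch_point:
  assumes r: "0 < r" "r < 1" and \<epsilon>: "\<epsilon> = 1 \<or> \<epsilon> = (-1 :: real)"
    and f: "f holomorphic_on - {0}" and g: "g holomorphic_on - {0}"
    and M: "\<And>z. branch_fun (modulus r) z \<notin> \<real>\<^sub>\<le>\<^sub>0 \<Longrightarrow> M z = f (curve_x \<phi> z) + g (curve_x \<phi> z) * (nu_factor \<phi> (curve_x \<phi> z) * csqrt (branch_fun (modulus r) z))"
    and DM: "\<And>z. branch_fun (modulus r) z \<notin> \<real>\<^sub>\<le>\<^sub>0 \<Longrightarrow> (M has_field_derivative M' z) (at z)"
    and eq: "\<And>z. branch_fun (modulus r) z \<notin> \<real>\<^sub>\<le>\<^sub>0 \<Longrightarrow> csqrt (branch_fun (modulus r) z) * M' z = (log_form (modulus r) s t z + of_real j) * M z"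
  shows "f (curve_x \<phi> (of_real (\<epsilon> * arsinh (sqrt (modulus r))))) = M 0 * exp (of_real (\<epsilon> * j * period_K (modulus r)) - \<i> * of_real (t * sqrt (modulus r)))"
proof -
  define m where "m = modulus r"
  have m: "m > 0" unfolding m_def using modulus_pos[OF r] .
  have ee': "\<epsilon> * \<epsilon> = 1" using \<epsilon> by auto
  let ?v = "\<lambda>\<psi>. sqrt (1 + m * (sin \<psi>)\<^sup>2)"
  let ?z = "\<lambda>\<psi>. complex_of_real (\<epsilon> * real_path m \<psi>)"
  \<comment> \<open>\<open>M\<close> along the path, with the root replaced by an expression that is smooth up to the end point\<close>
  define N where "N \<psi> = f (curve_x \<phi> (?z \<psi>)) + g (curve_x \<phi> (?z \<psi>)) * (nu_factor \<phi> (curve_x \<phi> (?z \<psi>)) * of_real (sqrt m * cos \<psi>))" for \<psi>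
  define n where "n \<psi> = (m * (sin \<psi>)\<^sup>2 - (m - period_ratio m)) / ?v \<psi>" for \<psi>
  define I1 where "I1 \<psi> = integral {0..\<psi>} n" for \<psi>
  define I2 where "I2 \<psi> = integral {0..\<psi>} (\<lambda>\<psi>. 1 / ?v \<psi>)" for \<psi>
  define H where "H \<psi> = of_real (\<epsilon> * (s * I1 \<psi> + j * I2 \<psi>)) + \<i> * of_real (t * sqrt m * cos \<psi>)" for \<psi>
  define h where "h \<psi> = of_real (\<epsilon> * (s * n \<psi> + j * (1 / ?v \<psi>))) + \<i> * of_real (t * sqrt m * (- sin \<psi>))" for \<psi>
  have PPe: "branch_fun m (?z \<psi>) = of_real (m * (cos \<psi>)\<^sup>2)" for \<psi>
    using \<epsilon> branch_fun_real_path[OF m, of \<psi>] by (auto simp: branch_fun_def)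
  have pos: "branch_fun m (?z \<psi>) \<notin> \<real>\<^sub>\<le>\<^sub>0" "csqrt (branch_fun m (?z \<psi>)) = of_real (sqrt m * cos \<psi>)" if "- (pi/2) < \<psi>" "\<psi> < pi/2" for \<psi>
  proof -
    have c: "cos \<psi> > 0" using that by (rule cos_gt_zero_pi)
    then have "m * (cos \<psi>)\<^sup>2 > 0" using m by simp
    then show "branch_fun m (?z \<psi>) \<notin> \<real>\<^sub>\<le>\<^sub>0" unfolding PPe complex_nonpos_Reals_iff by (simp only: Re_complex_of_real not_le) simp
    have "csqrt (branch_fun m (?z \<psi>)) = of_real (sqrt (m * (cos \<psi>)\<^sup>2))" unfolding PPe using m by (intro csqrt_of_real) simp
    then show "csqrt (branch_fun m (?z \<psi>)) = of_real (sqrt m * cos \<psi>)" using c by (simp add: real_sqrt_mult)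
  qed
  have NM: "N \<psi> = M (?z \<psi>)" if "- (pi/2) < \<psi>" "\<psi> < pi/2" for \<psi>
    unfolding N_def M[OF pos(1)[OF that, unfolded m_def], folded m_def] pos(2)[OF that] ..
  have cn: "continuous_on UNIV n" unfolding n_def[abs_def] by (intro continuous_intros) (auto simp: cont_sq_nz m)
  have cv: "continuous_on UNIV (\<lambda>\<psi>. 1 / ?v \<psi>)" by (rule continuous_period_K_integrand[OF m])
  have csg: "continuous_on A ?z" for A
    by (intro continuous_intros DERIV_continuous_on[OF has_field_derivative_at_within[OF DERIV_real_path[OF m]]])
  have cl: "continuous_on A (\<lambda>\<psi>. curve_x \<phi> (?z \<psi>))" for A unfolding curve_x_def by (intro continuous_intros csg)
  have "N (pi/2) = N 0 * exp (H (pi/2) - H 0)"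
  proof (rule exp_solution_on_interval)
    show "continuous_on {0..pi/2} N" unfolding N_def[abs_def] nu_factor_def
      by (intro continuous_intros cl continuous_on_compose2[OF holomorphic_on_imp_continuous_on[OF f]]
          continuous_on_compose2[OF holomorphic_on_imp_continuous_on[OF g]]) (auto simp: curve_x_nz)
    show "continuous_on {0..pi/2} H" unfolding H_def[abs_def] I1_def I2_def
      by (intro continuous_intros indefinite_integral_continuous_1 integrable_continuous_real
          continuous_on_subset[OF cn] continuous_on_subset[OF cv]) auto
    fix x assume x: "0 < x" "x < pi / 2"
    then have x': "- (pi/2) < x" "x < pi/2" by auto
    define v where "v = ?v x"
    have v: "v > 0" unfolding v_def using cont_sq_pos[OF m, of x] by simp
    have Ds: "((\<lambda>\<psi>. \<epsilon> * real_path m \<psi>) has_real_derivative \<epsilon> * (sqrt m * cos x / v)) (at x)"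
      unfolding v_def by (rule DERIV_cmult[OF DERIV_real_path[OF m]])
    have DM1: "((\<lambda>x. M (?z x)) has_vector_derivative of_real (\<epsilon> * (sqrt m * cos x / v)) * M' (?z x)) (at x)"
      by (rule has_vector_derivative_comp_real[OF DM[OF pos(1)[OF x', unfolded m_def], folded m_def] Ds])
    have "(N has_vector_derivative of_real (\<epsilon> * (sqrt m * cos x / v)) * M' (?z x)) (at x)"
      by (rule has_vector_derivative_transform_within_open[OF DM1, of "{- (pi/2) <..< pi/2}"]) (use x' NM in auto)
    also have "of_real (\<epsilon> * (sqrt m * cos x / v)) * M' (?z x) = of_real (\<epsilon> / v) * (csqrt (branch_fun m (?z x)) * M' (?z x))"
      unfolding pos(2)[OF x'] by simp
    also have "\<dots> = of_real (\<epsilon> / v) * (log_form m s t (?z x) + of_real j) * M (?z x)"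
      using eq[OF pos(1)[OF x', unfolded m_def], folded m_def] by simp
    also have "of_real (\<epsilon> / v) * (log_form m s t (?z x) + of_real j) = h x"
    proof -
      have "sinh (?z x) = of_real (\<epsilon> * (sqrt m * sin x))" "cosh (?z x) = of_real v"
        using \<epsilon> unfolding v_def sinh_complex_of_real cosh_complex_of_real by (auto simp: sinh_real_path cosh_real_path[OF m])
      moreover have "(complex_of_real (\<epsilon> * (sqrt m * sin x)))\<^sup>2 = of_real (m * (sin x)\<^sup>2)"
        using \<epsilon> m by (auto simp: power_mult_distrib simp flip: of_real_power)
      ultimately have BBe: "log_form m s t (?z x) = of_real (s * (m * (sin x)\<^sup>2 - (m - period_ratio m))) - \<i> * of_real (t * (\<epsilon> * (sqrt m * sin x) * v))"
        unfolding log_form_def form_num_def by simp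
      have gen: "complex_of_real a * (of_real X - \<i> * of_real Y + of_real j) = of_real (a * (X + j)) - \<i> * of_real (a * Y)" for a X Y
        by (simp add: algebra_simps)
      have "of_real (\<epsilon> / v) * (log_form m s t (?z x) + of_real j) = of_real (\<epsilon> / v * (s * (m * (sin x)\<^sup>2 - (m - period_ratio m)) + j)) - \<i> * of_real (\<epsilon> / v * (t * (\<epsilon> * (sqrt m * sin x) * v)))"
        unfolding BBe gen ..
      also have "\<epsilon> / v * (s * (m * (sin x)\<^sup>2 - (m - period_ratio m)) + j) = \<epsilon> * (s * n x + j * (1 / ?v x))"
        unfolding n_def v_def[symmetric] using v by (simp add: field_simps)
      also have "\<epsilon> / v * (t * (\<epsilon> * (sqrt m * sin x) * v)) = (\<epsilon> * \<epsilon>) * (t * sqrt m * sin x)" using v by simp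
      finally show ?thesis unfolding h_def ee' by simp
    qed
    finally show "(N has_vector_derivative h x * N x) (at x)" unfolding NM[OF x'] .
    have D1: "(I1 has_real_derivative n x) (at x)"
    proof -
      have "(I1 has_real_derivative n x) (at x within {0..pi/2})" unfolding I1_def[abs_def]
        by (rule integral_has_real_derivative[OF continuous_on_subset[OF cn]]) (use x in auto)
      then show ?thesis using x by (simp add: at_within_Icc_at)
    qed
    have D2: "(I2 has_real_derivative 1 / ?v x) (at x)"
    proof -
      have "(I2 has_real_derivative 1 / ?v x) (at x within {0..pi/2})" unfolding I2_def[abs_def]
        by (rule integral_has_real_derivative[OF continuous_on_subset[OF cv]]) (use x in auto)
      then show ?thesis using x by (simp add: at_within_Icc_at)
    qed
    have "((\<lambda>\<psi>. \<epsilon> * (s * I1 \<psi> + j * I2 \<psi>)) has_real_derivative \<epsilon> * (s * n x + j * (1 / ?v x))) (at x)"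
      by (intro DERIV_cmult DERIV_add D1 D2)
    moreover have "((\<lambda>\<psi>. t * sqrt m * cos \<psi>) has_real_derivative t * sqrt m * (- sin x)) (at x)"
      by (intro DERIV_cmult DERIV_cos)
    ultimately show "(H has_vector_derivative h x) (at x)" unfolding H_def[abs_def] h_def
      by (intro has_vector_derivative_add has_vector_derivative_mult_right has_vector_derivative_of_real)
        (simp_all add: has_real_derivative_iff_has_vector_derivative)
  qed simp
  moreover have "H (pi/2) - H 0 = of_real (\<epsilon> * j * period_K m) - \<i> * of_real (t * sqrt m)"
  proof -
    have "I1 (pi/2) = 0" unfolding I1_def n_def[abs_def] using quarter_period_zero[OF m] by (rule integral_unique)
    moreover have "I2 (pi/2) = period_K m" unfolding I2_def period_K_def ..
    moreover have "I1 0 = 0" "I2 0 = 0" unfolding I1_def I2_def by simp_all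
    ultimately show ?thesis unfolding H_def by (simp add: algebra_simps)
  qed
  moreover have "N 0 = M 0" using NM[of 0] by (simp add: real_path_def)
  moreover have "N (pi/2) = f (curve_x \<phi> (of_real (\<epsilon> * arsinh (sqrt m))))" unfolding N_def by (simp add: real_path_def)
  ultimately show ?thesis unfolding m_def by simp
qed

text \<open>On the imaginary axis \<open>d ln M = \<i> (t d axis_root - s d axis_integral)\<close>.\<close>

lemma pullback_on_imag_axis:
  assumes m: "m > 0" and y: "y \<ge> 0"
    and DM: "\<And>z. branch_fun m z \<notin> \<real>\<^sub>\<le>\<^sub>0 \<Longrightarrow> (M has_field_derivative M' z) (at z)"
    and eq: "\<And>z. branch_fun m z \<notin> \<real>\<^sub>\<le>\<^sub>0 \<Longrightarrow> csqrt (branch_fun m z) * M' z = log_form m s t z * M z"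
  shows "M (\<i> * of_real y) = M 0 * exp (\<i> * of_real (t * axis_root m y - s * axis_integral m y - t * sqrt m))"
proof -
  have pos: "branch_fun m (\<i> * of_real x) \<notin> \<real>\<^sub>\<le>\<^sub>0" for x :: real
    unfolding branch_fun_i[OF m] using axis_root_pos[OF m, of x] by (auto simp: complex_nonpos_Reals_iff)
  define H where "H x = \<i> * of_real (t * axis_root m x - s * axis_integral m x)" for x
  define h where "h x = \<i> * of_real (t * (sin x * cos x / axis_root m x) - s * ((m - period_ratio m + (sin x)\<^sup>2) / axis_root m x))" for x
  have D: "((\<lambda>x. M (\<i> * of_real x)) has_vector_derivative h x * M (\<i> * of_real x)) (at x)" for x
  proof -
    let ?z = "\<i> * complex_of_real x"
    have d: "complex_of_real (axis_root m x) \<noteq> 0" using axis_root_nz[OF m] by simp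
    have "((\<lambda>y. \<i> * complex_of_real y) has_vector_derivative \<i>) (at x)" by (auto intro!: derivative_eq_intros)
    from field_vector_diff_chain_at[OF this DM[OF pos]]
    have 1: "((\<lambda>y. M (\<i> * of_real y)) has_vector_derivative \<i> * M' ?z) (at x)" by (simp add: o_def)
    have "of_real (axis_root m x) * M' ?z = log_form m s t ?z * M ?z" using eq[OF pos[of x]] unfolding csqrt_branch_fun_i[OF m] .
    then have F1: "M' ?z = log_form m s t ?z / of_real (axis_root m x) * M ?z" using d by (simp add: field_simps)
    have F2: "\<i> * (log_form m s t ?z / of_real (axis_root m x)) = h x"
    proof -
      have "log_form m s t ?z = of_real (t * (sin x * cos x) - s * (m - period_ratio m + (sin x)\<^sup>2))"
        unfolding log_form_def form_num_def sinh_i cosh_i by (simp add: power_mult_distrib algebra_simps)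
      then show ?thesis unfolding h_def by (simp add: diff_divide_distrib)
    qed
    have "\<i> * M' ?z = h x * M ?z" unfolding F1 mult.assoc[symmetric] F2 ..
    then show ?thesis using 1 by simp
  qed
  have "M (\<i> * of_real y) = M (\<i> * of_real 0) * exp (H y - H 0)"
  proof (rule exp_solution_on_interval[OF y, where M = "\<lambda>x. M (\<i> * of_real x)" and h = h])
    show "continuous_on {0..y} (\<lambda>x. M (\<i> * of_real x))"
      using D by (intro continuous_at_imp_continuous_on ballI) (rule has_vector_derivative_continuous)
    show "continuous_on {0..y} H" unfolding H_def[abs_def]
      by (intro continuous_intros continuous_on_subset[OF continuous_axis_root] continuous_axis_integral[OF m]) auto
    fix x assume x: "0 < x" "x < y"
    show "((\<lambda>x. M (\<i> * of_real x)) has_vector_derivative h x * M (\<i> * of_real x)) (at x)" by (rule D)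
    have "((\<lambda>x. t * axis_root m x - s * axis_integral m x) has_real_derivative t * (sin x * cos x / axis_root m x) - s * ((m - period_ratio m + (sin x)\<^sup>2) / axis_root m x)) (at x)"
      by (intro DERIV_diff DERIV_cmult DERIV_axis_root_t DERIV_axis_integral_t m x)
    then show "(H has_vector_derivative h x) (at x)" unfolding H_def[abs_def] h_def
      by (intro has_vector_derivative_mult_right has_vector_derivative_of_real)
        (simp_all add: has_real_derivative_iff_has_vector_derivative)
  qed
  moreover have "H y - H 0 = \<i> * of_real (t * axis_root m y - s * axis_integral m y - t * sqrt m)"
    unfolding H_def axis_integral_zero by (simp add: axis_root_def algebra_simps)
  ultimately show ?thesis by simp
qed

lemma exp_i_eq_1:
  assumes "exp (\<i> * of_real x) = 1"
  obtains n :: int where "x = 2 * pi * of_int n"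
proof -
  obtain n :: int where "Im (\<i> * complex_of_real x) = of_int (2 * n) * pi" using assms unfolding exp_eq_1 by blast
  then have "x = 2 * pi * of_int n" by simp
  then show ?thesis by (rule that)
qed

text \<open>At the two branch points and at the double point \<open>\<mu> = \<plusminus> 1\<close>, since \<open>\<sigma>\<close> fixes these points and
  inverts \<open>\<mu>\<close>. The two branch points give the values \<open>(M 0)\<^sup>2 exp (\<plusminus> 2 j period_K - 2 \<i> t sqrt m)
  = 1\<close>, so \<open>j = 0\<close> and \<open>(M 0)\<^sup>2\<close> is known. The other two conditions come from
  \<open>pullback_on_imag_axis\<close>, at \<open>y = \<pi>\<close>, which is the same point of the curve as \<open>y = 0\<close>, and at \<open>y
  = 2 \<phi>\<close>, which is the double point.\<close>

lemma Gamma_subset: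
  assumes r: "0 < r" "r < 1" and \<phi>: "\<phi> > 0" and \<omega>: "\<omega> \<in> Gamma_tilde (M22_param (r, \<phi>))"
  obtains s t :: real and k l :: int where "s * circle_period (modulus r) = 2 * pi * of_int k"
    "t * axis_root (modulus r) (2 * \<phi>) - s * axis_integral (modulus r) (2 * \<phi>) = pi * of_int l" "\<omega> = - cis (- \<phi>) * Complex s t / 2"
proof -
  define m where "m = modulus r"
  have m: "m > 0" unfolding m_def using modulus_pos[OF r] .
  let ?a = "M22_param (r, \<phi>)"
  from \<omega> obtain b \<mu> where \<omega>b: "\<omega> = poly b 0" and deg: "degree b \<le> 3"
    and real: "\<And>z. z \<noteq> 0 \<Longrightarrow> cnj z ^ 3 * poly b (inverse (cnj z)) = - cnj (poly b z)"
    and adm: "admissible ?a b \<mu>" unfolding Gamma_tilde_def by blast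
  obtain f g M M' and s t j :: real where f: "f holomorphic_on - {0}" and g: "g holomorphic_on - {0}"
    and fg: "\<And>x \<nu>. (x, \<nu>) \<in> curve ?a \<Longrightarrow> \<mu> (x, \<nu>) = f x + g x * \<nu>"
    and M: "\<And>z. branch_fun m z \<notin> \<real>\<^sub>\<le>\<^sub>0 \<Longrightarrow> M z = f (curve_x \<phi> z) + g (curve_x \<phi> z) * (nu_factor \<phi> (curve_x \<phi> z) * csqrt (branch_fun m z))"
    and DM: "\<And>z. branch_fun m z \<notin> \<real>\<^sub>\<le>\<^sub>0 \<Longrightarrow> (M has_field_derivative M' z) (at z)"
    and eq: "\<And>z. branch_fun m z \<notin> \<real>\<^sub>\<le>\<^sub>0 \<Longrightarrow> csqrt (branch_fun m z) * M' z = (log_form m s t z + of_real j) * M z"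
    and Mnz: "\<And>z. branch_fun m z \<notin> \<real>\<^sub>\<le>\<^sub>0 \<Longrightarrow> M z \<noteq> 0"
    and b0: "poly b 0 = - cis (- \<phi>) * Complex s t / 2"
    by (rule pullback_solution[OF r adm deg real, folded m_def, unfolded mem_Collect_eq]) (assumption | rule that)+
  have pos: "branch_fun m (\<i> * of_real x) \<notin> \<real>\<^sub>\<le>\<^sub>0" for x :: real
    unfolding branch_fun_i[OF m] using axis_root_pos[OF m, of x] by (auto simp: complex_nonpos_Reals_iff)
  have M0: "M 0 \<noteq> 0" using Mnz[OF pos[of 0]] by simp
  \<comment> \<open>\<open>\<mu>\<close> is \<open>\<plusminus>1\<close> at the fixed points of \<open>\<sigma>\<close>\<close>
  have fixed: "(f x)\<^sup>2 = 1" if "(x, 0) \<in> curve ?a" for x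
  proof -
    have "\<mu> (invol_sigma (x, 0)) = inverse (\<mu> (x, 0))" "\<mu> (x, 0) \<noteq> 0" using adm that unfolding admissible_def by blast+
    then show ?thesis using fg[OF that] by (simp add: invol_sigma_def power2_eq_square field_simps)
  qed
  have branch: "(M 0)\<^sup>2 * exp (2 * of_real (\<epsilon> * j * period_K m) - 2 * \<i> * of_real (t * sqrt m)) = 1" if \<epsilon>: "\<epsilon> = 1 \<or> \<epsilon> = (-1 :: real)" for \<epsilon>
  proof -
    let ?z = "complex_of_real (\<epsilon> * arsinh (sqrt m))"
    have "branch_fun m ?z = 0" using \<epsilon> m by (auto simp: branch_fun_def sinh_complex_of_real simp flip: of_real_power)
    then have "(curve_x \<phi> ?z, 0) \<in> curve ?a" unfolding curve_iff[OF r(1)] m_def by simp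
    from fixed[OF this] have "(M 0 * exp (of_real (\<epsilon> * j * period_K m) - \<i> * of_real (t * sqrt m)))\<^sup>2 = 1"
      using pullback_to_branch_point[OF r \<epsilon> f g, folded m_def, OF M DM eq] by simp
    moreover have "2 * of_real (\<epsilon> * j * period_K m) - 2 * \<i> * of_real (t * sqrt m) = 2 * (of_real (\<epsilon> * j * period_K m) - \<i> * of_real (t * sqrt m))"
      by (simp add: algebra_simps)
    ultimately show ?thesis by (simp only: power_mult_distrib exp_double)
  qed
  have j: "j = 0"
  proof -
    let ?X = "2 * complex_of_real (j * period_K m)"
    let ?Y = "2 * \<i> * complex_of_real (t * sqrt m)"
    have "(M 0)\<^sup>2 * exp (?X - ?Y) = (M 0)\<^sup>2 * exp (- ?X - ?Y)" using branch[of 1] branch[of "-1"] by simp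
    then have "exp (?X - ?Y) = exp (- ?X - ?Y)" using M0 by simp
    then have "exp ?X = exp (- ?X)" by (simp add: exp_diff)
    then have "exp (complex_of_real (2 * (j * period_K m))) = exp (of_real (- (2 * (j * period_K m))))" by simp
    then have "exp (2 * (j * period_K m)) = exp (- (2 * (j * period_K m)))" unfolding exp_of_real of_real_eq_iff .
    then have "j * period_K m = 0" by simp
    then show ?thesis using period_K_pos[OF m] by simp
  qed
  have M0sq: "(M 0)\<^sup>2 = exp (2 * \<i> * of_real (t * sqrt m))"
    using branch[of 1] unfolding j by (simp add: exp_minus field_simps)
  have imag: "M (\<i> * of_real y) = M 0 * exp (\<i> * of_real (t * axis_root m y - s * axis_integral m y - t * sqrt m))" if "y \<ge> 0" for y
    by (rule pullback_on_imag_axis[OF m that DM]) (use eq j in simp_all)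
  have d0: "axis_root m 0 = sqrt m" "axis_root m pi = sqrt m" by (simp_all add: axis_root_def)
  \<comment> \<open>\<open>z = 0\<close> and \<open>z = \<pi> \<i>\<close> have the same image on the curve, as \<open>axis_root m\<close> takes the same value at \<open>0\<close> and \<open>\<pi>\<close>\<close>
  obtain k :: int where k: "s * circle_period m = 2 * pi * of_int k"
  proof -
    have "exp (2 * (\<i> * complex_of_real pi)) = 1" using exp_two_pi_i by (metis mult.assoc mult.commute)
    then have "curve_x \<phi> (\<i> * of_real pi) = curve_x \<phi> 0" unfolding curve_x_def by (simp only: mult_zero_right exp_zero)
    then have "M (\<i> * of_real pi) = M (\<i> * of_real 0)"
      unfolding M[OF pos[of pi]] M[OF pos[of 0]] unfolding csqrt_branch_fun_i[OF m] d0 by simp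
    then have "exp (\<i> * of_real (- (s * circle_period m))) = 1"
      using imag[of pi] M0 d0 unfolding circle_period_def by simp
    then obtain n :: int where "- (s * circle_period m) = 2 * pi * of_int n" by (rule exp_i_eq_1)
    then show ?thesis using that[of "- n"] by simp
  qed
  \<comment> \<open>\<open>z = 2 \<i> \<phi>\<close> lies over the double root, where \<open>\<nu> = 0\<close>\<close>
  obtain l :: int where l: "t * axis_root m (2 * \<phi>) - s * axis_integral m (2 * \<phi>) = pi * of_int l"
  proof -
    let ?z = "\<i> * complex_of_real (2 * \<phi>)"
    let ?x = "t * axis_root m (2 * \<phi>) - s * axis_integral m (2 * \<phi>)"
    have w: "nu_factor \<phi> (curve_x \<phi> ?z) = 0"
    proof -
      have "exp (2 * ?z) = cis (4 * \<phi>)" by (simp add: cis_conv_exp mult_ac)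
      then have "curve_x \<phi> ?z = cis (2 * \<phi>)" unfolding curve_x_def by (simp add: cis_mult)
      then show ?thesis unfolding nu_factor_def by simp
    qed
    then have "(curve_x \<phi> ?z, 0) \<in> curve ?a" unfolding curve_iff[OF r(1)] by simp
    then have "(M ?z)\<^sup>2 = 1" using fixed w unfolding M[OF pos] by simp
    then have "(M 0)\<^sup>2 * (exp (\<i> * of_real (?x - t * sqrt m)))\<^sup>2 = 1" using imag[of "2 * \<phi>"] \<phi> by (simp add: power_mult_distrib)
    then have "exp (2 * \<i> * of_real (t * sqrt m)) * exp (2 * (\<i> * of_real (?x - t * sqrt m))) = 1"
      unfolding M0sq exp_double .
    then have "exp (2 * \<i> * of_real (t * sqrt m) + 2 * (\<i> * of_real (?x - t * sqrt m))) = 1" unfolding exp_add .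
    moreover have "2 * \<i> * of_real (t * sqrt m) + 2 * (\<i> * of_real (?x - t * sqrt m)) = \<i> * of_real (2 * ?x)"
      by (simp add: algebra_simps)
    ultimately have "exp (\<i> * of_real (2 * ?x)) = 1" by (simp only:)
    then obtain n :: int where "2 * ?x = 2 * pi * of_int n" by (rule exp_i_eq_1)
    then show ?thesis using that[of n] by simp
  qed
  show ?thesis by (rule that[OF k[unfolded m_def] l[unfolded m_def]]) (use \<omega>b b0 in simp)
qed

definition tau_fun :: "real \<Rightarrow> real \<Rightarrow> complex" where
  "tau_fun m \<eta> = Complex (- 2 * axis_integral m \<eta> / circle_period m) (2 * axis_root m \<eta> / circle_period m)"

text \<open>The two integrality conditions parametrise \<open>(s, t)\<close> by two integers \<open>k\<close> and \<open>l\<close>. The vector with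
  \<open>k = 0\<close>, \<open>l = 1\<close> is \<open>\<i> \<pi> / axis_root\<close>; scaling it to 1 turns the vector with \<open>k = - 1\<close>, \<open>l = 0\<close>
  into \<open>\<tau>\<close>.\<close>

lemma Gamma_iso_std_lattice:
  assumes r: "0 < r" "r < 1" and \<phi>: "\<phi> > 0"
  shows "lattice_iso (Gamma_tilde (M22_param (r, \<phi>))) (std_lattice (tau_fun (modulus r) (2 * \<phi>)))"
proof (rule lattice_iso_sym)
  define m where "m = modulus r"
  have m: "m > 0" unfolding m_def using modulus_pos[OF r] .
  define d where "d = axis_root m (2 * \<phi>)"
  define g where "g = axis_integral m (2 * \<phi>)"
  define L where "L = circle_period m"
  have d: "d > 0" unfolding d_def by (rule axis_root_pos[OF m])
  have L: "L > 0" unfolding L_def by (rule circle_period_pos[OF m])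
  define c where "c = - cis (- \<phi>) / 2 * (\<i> * of_real (pi / d))"
  have c: "c \<noteq> 0" unfolding c_def using d by simp
  have key: "c * (of_int l + of_int k * tau_fun m (2 * \<phi>)) = - cis (- \<phi>) * Complex s t / 2"
    if "s * L = 2 * pi * of_int (- k)" "t * d - s * g = pi * of_int l" for s t and k l :: int
  proof -
    have s: "s = - 2 * pi * of_int k / L" using that(1) L by (simp add: field_simps)
    have t: "t = (pi * of_int l + s * g) / d" using that(2) d by (simp add: field_simps)
    have e: "\<i> * of_real (pi / d) * (of_int l + of_int k * tau_fun m (2 * \<phi>)) = Complex s t"
      unfolding t s tau_fun_def d_def[symmetric] g_def[symmetric] L_def[symmetric] using d L
      by (simp add: complex_eq_iff field_simps)
    show ?thesis unfolding c_def mult.assoc unfolding mult.assoc[symmetric, of \<i>] e by simp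
  qed
  have "Gamma_tilde (M22_param (r, \<phi>)) = (\<lambda>z. c * z) ` std_lattice (tau_fun m (2 * \<phi>))"
  proof (intro equalityI subsetI)
    fix \<omega> assume "\<omega> \<in> Gamma_tilde (M22_param (r, \<phi>))"
    then obtain s t :: real and k l :: int where "s * L = 2 * pi * of_int k" "t * d - s * g = pi * of_int l"
      "\<omega> = - cis (- \<phi>) * Complex s t / 2"
      unfolding L_def d_def g_def m_def by (rule Gamma_subset[OF r \<phi>])
    then have "\<omega> = c * (of_int l + of_int (- k) * tau_fun m (2 * \<phi>))" using key[of s "- k" t l] by simp
    then show "\<omega> \<in> (\<lambda>z. c * z) ` std_lattice (tau_fun m (2 * \<phi>))" unfolding std_lattice_def by blast
  next
    fix \<omega> assume "\<omega> \<in> (\<lambda>z. c * z) ` std_lattice (tau_fun m (2 * \<phi>))"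
    then obtain l k :: int where \<omega>: "\<omega> = c * (of_int l + of_int k * tau_fun m (2 * \<phi>))" unfolding std_lattice_def by blast
    define s where "s = 2 * pi * of_int (- k) / L"
    define t where "t = (pi * of_int l + s * g) / d"
    have st: "s * L = 2 * pi * of_int (- k)" "t * d - s * g = pi * of_int l"
      unfolding s_def t_def using L d by simp_all
    show "\<omega> \<in> Gamma_tilde (M22_param (r, \<phi>))"
      unfolding \<omega> key[OF st] by (rule Gamma_superset[OF r \<phi> st[unfolded L_def d_def g_def m_def]])
  qed
  then show "lattice_iso (std_lattice (tau_fun (modulus r) (2 * \<phi>))) (Gamma_tilde (M22_param (r, \<phi>)))"
    unfolding lattice_iso_def m_def[symmetric] using c by blast
qed

section \<open>The image\<close>

lemma tau_fun_in_region:
  assumes m: "m > 0" and \<eta>: "0 < \<eta>" "\<eta> \<le> pi"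
  shows "- 2 \<le> Re (tau_fun m \<eta>)" "Re (tau_fun m \<eta>) < 0" "Im (tau_fun m \<eta>) > 0" "(Re (tau_fun m \<eta>) + 1)\<^sup>2 + (Im (tau_fun m \<eta>))\<^sup>2 > 1"
proof -
  define \<xi> where "\<xi> = axis_integral m \<eta> / circle_period m"
  have L: "circle_period m > 0" by (rule circle_period_pos[OF m])
  have g: "0 < axis_integral m \<eta>" using axis_integral_strict_mono[OF m order_refl \<eta>(1)] by (simp add: axis_integral_zero)
  have "axis_integral m \<eta> \<le> circle_period m" using axis_integral_strict_mono[OF m, of \<eta> pi] \<eta> unfolding circle_period_def by (cases "\<eta> = pi") auto
  then have \<xi>: "0 < \<xi>" "\<xi> \<le> 1" unfolding \<xi>_def using g L by simp_all
  obtain h where h: "\<And>m. m > 0 \<Longrightarrow> 0 < h m \<and> h m \<le> pi \<and> axis_integral m (h m) = \<xi> * circle_period m"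
    "\<And>m. m > 0 \<Longrightarrow> (h has_real_derivative - (log_deriv m * sin (h m) * cos (h m)) / (m - period_ratio m + (sin (h m))\<^sup>2)) (at m)"
    using level_curve[OF \<xi>] by blast
  have "axis_integral m (h m) = axis_integral m \<eta>" using h(1)[OF m] L unfolding \<xi>_def by simp
  then have hm: "h m = \<eta>"
    using axis_integral_strict_mono[OF m, of "h m" \<eta>] axis_integral_strict_mono[OF m, of \<eta> "h m"] h(1)[OF m] \<eta>
    by (cases "h m" \<eta> rule: linorder_cases) auto
  have "(level_height h m)\<^sup>2 > 1 - (1 - 2 * \<xi>)\<^sup>2" by (rule height_range(1)[OF \<xi> h m])
  moreover have R: "Re (tau_fun m \<eta>) = - 2 * \<xi>" unfolding tau_fun_def \<xi>_def by simp
  moreover have I: "Im (tau_fun m \<eta>) = level_height h m" unfolding tau_fun_def level_height_def hm by simp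
  ultimately show "(Re (tau_fun m \<eta>) + 1)\<^sup>2 + (Im (tau_fun m \<eta>))\<^sup>2 > 1" by simp
  show "- 2 \<le> Re (tau_fun m \<eta>)" "Re (tau_fun m \<eta>) < 0" using R \<xi> by simp_all
  show "Im (tau_fun m \<eta>) > 0" unfolding tau_fun_def using axis_root_pos[OF m] L by simp
qed

lemma tau_fun_onto_region:
  assumes x: "- 2 \<le> x" "x < 0" and y: "y > 0" and xy: "(x + 1)\<^sup>2 + y\<^sup>2 > 1"
  obtains m \<eta> where "m > 0" "\<eta> > 0" "tau_fun m \<eta> = Complex x y"
proof -
  define \<xi> where "\<xi> = - x / 2"
  have \<xi>: "0 < \<xi>" "\<xi> \<le> 1" unfolding \<xi>_def using x by simp_all
  obtain h where h: "\<And>m. m > 0 \<Longrightarrow> 0 < h m \<and> h m \<le> pi \<and> axis_integral m (h m) = \<xi> * circle_period m"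
    "\<And>m. m > 0 \<Longrightarrow> (h has_real_derivative - (log_deriv m * sin (h m) * cos (h m)) / (m - period_ratio m + (sin (h m))\<^sup>2)) (at m)"
    using level_curve[OF \<xi>] by blast
  have "y\<^sup>2 > 1 - (1 - 2 * \<xi>)\<^sup>2" using xy unfolding \<xi>_def by (simp add: add.commute)
  then obtain m where m: "m > 0" "level_height h m = y" using height_range(2)[OF \<xi> h y] by blast
  have "tau_fun m (h m) = Complex x y"
    using h(1)[OF m(1)] circle_period_pos[OF m(1)] m(2) unfolding tau_fun_def level_height_def \<xi>_def by simp
  then show ?thesis using that[OF m(1)] h(1)[OF m(1)] by blast
qed

text \<open>The solution is \<open>r = u\<^sup>2\<close> with \<open>u = sqrt (1 + m) - sqrt m = exp (- arsinh (sqrt m))\<close>.\<close>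

lemma modulus_surj:
  assumes "m > 0"
  obtains r where "0 < r" "r < 1" "modulus r = m"
proof -
  define u where "u = sqrt (1 + m) - sqrt m"
  define w where "w = sqrt (1 + m) + sqrt m"
  have uw: "u * w = 1" unfolding u_def w_def using assms by (simp add: algebra_simps)
  have "sqrt (1 + m) > 1" "sqrt m > 0" using assms by simp_all
  then have "w > 1" unfolding w_def by linarith
  have u: "u > 0" unfolding u_def using assms by simp
  have "u * 1 < u * w" using u \<open>w > 1\<close> by (intro mult_strict_left_mono) auto
  then have u1: "u < 1" using uw by simp
  have "1 - u\<^sup>2 = u * (w - u)" using uw by (simp add: algebra_simps power2_eq_square)
  also have "w - u = 2 * sqrt m" unfolding w_def u_def by simp
  finally have "(1 - u\<^sup>2)\<^sup>2 = u\<^sup>2 * (4 * m)" using assms by (simp add: power_mult_distrib)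
  then have "modulus (u\<^sup>2) = m" unfolding modulus_def using u by simp
  moreover have "u\<^sup>2 < 1" using u u1 by (simp add: power_less_one_iff)
  ultimately show ?thesis using that[of "u\<^sup>2"] u by simp
qed

lemma tau_fun_shift:
  assumes m: "m > 0" and "\<eta> \<ge> 0"
  shows "tau_fun m (\<eta> + pi * of_nat n) = tau_fun m \<eta> + of_int (- 2 * int n)"
proof (induction n)
  case (Suc n)
  have "\<eta> + pi * of_nat (Suc n) = (\<eta> + pi * of_nat n) + pi" by (simp add: algebra_simps)
  moreover have "axis_integral m ((\<eta> + pi * of_nat n) + pi) = axis_integral m (\<eta> + pi * of_nat n) + circle_period m"
    by (rule axis_integral_add_pi[OF m]) (use assms in simp)
  moreover have "axis_root m ((\<eta> + pi * of_nat n) + pi) = axis_root m (\<eta> + pi * of_nat n)" by (simp add: axis_root_def)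
  ultimately have "tau_fun m (\<eta> + pi * of_nat (Suc n)) = tau_fun m (\<eta> + pi * of_nat n) - 2"
    using circle_period_pos[OF m] unfolding tau_fun_def by (simp add: complex_eq_iff field_simps)
  then show ?case using Suc by simp
qed simp

text \<open>For \<open>Re \<tau>\<close> in \<open>[-3/2, -1/2]\<close> the translate \<open>\<tau> + 1\<close> is outside the unit circle. Otherwise let \<open>u\<close>
  be \<open>\<tau>\<close> or \<open>\<tau> + 2\<close>, with \<open>\<bar>Re u\<bar> \<le> 1/2\<close>. That \<open>\<tau>\<close> is outside the circle around \<open>-1\<close> means \<open>2 \<bar>Re
  u\<bar> < \<bar>u\<bar>\<^sup>2\<close>, that is \<open>\<bar>Re (1 / u)\<bar> < 1/2\<close>. So \<open>u\<close> or \<open>- 1 / u\<close> is in the fundamental domain, and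
  in neither case it is one of the two corners.\<close>

lemma region_representative:
  assumes R: "- 2 \<le> Re \<tau>" "Re \<tau> < 0" and I: "Im \<tau> > 0" and out: "(Re \<tau> + 1)\<^sup>2 + (Im \<tau>)\<^sup>2 > 1"
  obtains \<tau>' where "\<tau>' \<in> fund_domain" "\<bar>Re \<tau>'\<bar> < 1/2 \<or> cmod \<tau>' > 1" "lattice_iso (std_lattice \<tau>) (std_lattice \<tau>')"
proof -
  have refl: "lattice_iso L L" for L unfolding lattice_iso_def by (intro exI[of _ 1]) auto
  have shift: "lattice_iso (std_lattice \<tau>) (std_lattice (\<tau> + of_int j))" for j
    unfolding std_lattice_shift by (rule refl)
  have inv: "\<exists>\<tau>'. \<tau>' \<in> fund_domain \<and> (\<bar>Re \<tau>'\<bar> < 1/2 \<or> cmod \<tau>' > 1) \<and> lattice_iso (std_lattice \<tau>) (std_lattice \<tau>')"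
    if u: "u = \<tau> + of_int j" "\<bar>Re u\<bar> \<le> 1/2" "2 * \<bar>Re u\<bar> < (cmod u)\<^sup>2" for u j
  proof (cases "cmod u \<ge> 1")
    case True
    have "\<bar>Re u\<bar> < 1/2 \<or> cmod u > 1"
    proof (rule ccontr)
      assume "\<not> ?thesis"
      then have "\<bar>Re u\<bar> = 1/2" "cmod u = 1" using u(2) True by auto
      then show False using u(3) by simp
    qed
    then show ?thesis using True u(1,2) I shift[of j] unfolding fund_domain_def by (intro exI[of _ u]) auto
  next
    case False
    have Iu: "Im u > 0" using u(1) I by simp
    then have u0: "u \<noteq> 0" by auto
    let ?v = "- inverse u"
    have n: "(cmod u)\<^sup>2 = (Re u)\<^sup>2 + (Im u)\<^sup>2" by (rule cmod_power2)
    have n0: "(cmod u)\<^sup>2 > 0" using u0 by simp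
    have e: "Re ?v = - Re u / (cmod u)\<^sup>2" "Im ?v = Im u / (cmod u)\<^sup>2" unfolding n by simp_all
    have "\<bar>Re ?v\<bar> < 1/2" "Im ?v > 0" unfolding e using u(3) Iu n0
      by (simp_all add: abs_divide pos_divide_less_eq)
    moreover have "cmod ?v > 1" using False u0 by (simp add: norm_inverse one_less_inverse)
    moreover have "lattice_iso (std_lattice \<tau>) (std_lattice ?v)"
      using lattice_iso_inversion[OF u0] unfolding u(1) std_lattice_shift .
    ultimately show ?thesis unfolding fund_domain_def by (intro exI[of _ ?v]) auto
  qed
  have cm: "(cmod (\<tau> + of_int j))\<^sup>2 = (Re \<tau> + j)\<^sup>2 + (Im \<tau>)\<^sup>2" for j by (simp add: cmod_power2)
  consider "Re \<tau> < - 3/2" | "- 3/2 \<le> Re \<tau>" "Re \<tau> \<le> -1/2" | "- 1/2 < Re \<tau>" by linarith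
  then have "\<exists>\<tau>'. \<tau>' \<in> fund_domain \<and> (\<bar>Re \<tau>'\<bar> < 1/2 \<or> cmod \<tau>' > 1) \<and> lattice_iso (std_lattice \<tau>) (std_lattice \<tau>')"
  proof cases
    case 1
    have "2 * \<bar>Re \<tau> + 2\<bar> < (Re \<tau> + 2)\<^sup>2 + (Im \<tau>)\<^sup>2" using R out by (simp add: power2_eq_square algebra_simps)
    then show ?thesis using inv[of "\<tau> + of_int 2" 2] 1 R cm[of 2] by simp
  next
    case 2
    let ?u = "\<tau> + of_int 1"
    have "(cmod ?u)\<^sup>2 > 1" using cm[of 1] out by simp
    then have "cmod ?u > 1" by (metis one_power2 power2_less_imp_less norm_ge_zero)
    moreover have "Re ?u = Re \<tau> + 1" by simp
    then have "\<bar>Re ?u\<bar> \<le> 1/2" using 2 by linarith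
    ultimately show ?thesis using I shift[of 1] unfolding fund_domain_def by (intro exI[of _ ?u]) auto
  next
    case 3
    have "2 * \<bar>Re \<tau>\<bar> < (Re \<tau>)\<^sup>2 + (Im \<tau>)\<^sup>2" using R out by (simp add: power2_eq_square algebra_simps)
    then show ?thesis using inv[of "\<tau> + of_int 0" 0] 3 R cm[of 0] by simp
  qed
  then show ?thesis using that by blast
qed

text \<open>Outside the unit circle, translate by \<open>- 1\<close>. On the arc, \<open>\<tau>\<close> (if \<open>Re \<tau> < 0\<close>) or \<open>\<tau> - 2\<close> has
  distance more than 1 from \<open>-1\<close>, except at the corners.\<close>

lemma fund_domain_in_region:
  assumes F: "\<tau> \<in> fund_domain" and ne: "\<bar>Re \<tau>\<bar> < 1/2 \<or> cmod \<tau> > 1"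
  obtains j :: int where "- 2 \<le> Re (\<tau> + of_int j)" "Re (\<tau> + of_int j) < 0" "Im (\<tau> + of_int j) > 0"
    "(Re (\<tau> + of_int j) + 1)\<^sup>2 + (Im (\<tau> + of_int j))\<^sup>2 > 1"
proof -
  have b: "Im \<tau> > 0" "\<bar>Re \<tau>\<bar> \<le> 1/2" "cmod \<tau> \<ge> 1" using F unfolding fund_domain_def by auto
  have n: "(cmod \<tau>)\<^sup>2 = (Re \<tau>)\<^sup>2 + (Im \<tau>)\<^sup>2" by (rule cmod_power2)
  show ?thesis
  proof (cases "cmod \<tau> > 1")
    case True
    then have "(cmod \<tau>)\<^sup>2 > 1" by (simp add: one_less_power)
    then show ?thesis using that[of "-1"] b n by simp
  next
    case False
    then have 1: "(Re \<tau>)\<^sup>2 + (Im \<tau>)\<^sup>2 = 1" and 2: "\<bar>Re \<tau>\<bar> < 1/2" using b n ne by auto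
    show ?thesis
    proof (cases "Re \<tau> \<ge> 0")
      case True
      have "(Re \<tau> - 1)\<^sup>2 + (Im \<tau>)\<^sup>2 > 1" using 1 2 by (simp add: power2_eq_square algebra_simps)
      then show ?thesis using that[of "-2"] b 2 True by simp
    next
      case False
      have "(Re \<tau> + 1)\<^sup>2 + (Im \<tau>)\<^sup>2 > 1" using 1 2 by (simp add: power2_eq_square algebra_simps)
      then show ?thesis using that[of 0] b 2 False by simp
    qed
  qed
qed

text \<open>The integrals are taken from 0 to the angle, so a positive representative of the angle modulo
  \<open>\<pi>\<close> is convenient.\<close>

lemma M22_positive_angle:
  assumes "a \<in> M22"
  obtains r \<phi> where "0 < r" "r < 1" "\<phi> > 0" "a = M22_param (r, \<phi>)"
proof -
  obtain r \<phi> where r: "0 < r" "r < 1" "a = M22_param (r, \<phi>)" using M22_imp_param[OF assms] .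
  obtain n where n: "- \<phi> < of_nat n * pi" using reals_Archimedean3[OF pi_gt_zero] by blast
  then have "\<phi> + pi * of_int (int n) > 0" by (simp add: mult.commute)
  then show ?thesis using that[OF r(1,2), of "\<phi> + pi * of_int (int n)"] r(3) M22_param_shift[of r \<phi> "int n"] by simp
qed

lemma excluded_point:
  assumes "\<tau> \<in> fund_domain"
  shows "(\<bar>Re \<tau>\<bar> < 1/2 \<or> cmod \<tau> > 1) \<longleftrightarrow> \<not> (\<bar>Re \<tau>\<bar> = 1/2 \<and> Im \<tau> = sqrt 3 / 2)"
proof -
  have b: "Im \<tau> > 0" "\<bar>Re \<tau>\<bar> \<le> 1/2" "cmod \<tau> \<ge> 1" using assms unfolding fund_domain_def by auto
  have "cmod \<tau> = 1 \<longleftrightarrow> Im \<tau> = sqrt 3 / 2" if "\<bar>Re \<tau>\<bar> = 1/2"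
  proof -
    have "(Re \<tau>)\<^sup>2 = (1/2)\<^sup>2" using that by (metis power2_abs)
    then have n: "(cmod \<tau>)\<^sup>2 = 1/4 + (Im \<tau>)\<^sup>2" unfolding cmod_power2 by (simp add: power2_eq_square)
    have "cmod \<tau> = 1 \<longleftrightarrow> (cmod \<tau>)\<^sup>2 = 1\<^sup>2" using b by (subst power2_eq_iff_nonneg) auto
    also have "\<dots> \<longleftrightarrow> (Im \<tau>)\<^sup>2 = (sqrt 3 / 2)\<^sup>2" unfolding n by (simp add: power_divide) linarith
    also have "\<dots> \<longleftrightarrow> Im \<tau> = sqrt 3 / 2" using b by (subst power2_eq_iff_nonneg) auto
    finally show ?thesis .
  qed
  then show ?thesis using b by (auto simp: less_le)
qed

text \<open>The angle is reduced to \<open>0 < \<eta> \<le> \<pi>\<close>, where \<open>tau_fun_in_region\<close> and \<open>region_representative\<close> give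
  a representative in the fundamental domain; conversely \<open>fund_domain_in_region\<close> and
  \<open>tau_fun_onto_region\<close> produce a curve.\<close>

lemma T_map_image:
  "T_map ` M22 = moduli_space - moduli_point ` {Complex (1 / 2) (sqrt 3 / 2), Complex (- 1 / 2) (sqrt 3 / 2)}"
proof (intro equalityI subsetI)
  fix t assume "t \<in> T_map ` M22"
  then obtain a where a: "a \<in> M22" "t = T_map a" by blast
  obtain r \<phi> where r: "0 < r" "r < 1" and \<phi>: "\<phi> > 0" and a': "a = M22_param (r, \<phi>)" using M22_positive_angle[OF a(1)] .
  define m where "m = modulus r"
  have m: "m > 0" unfolding m_def using modulus_pos[OF r] .
  \<comment> \<open>the reduced angle has to lie in \<open>(0, \<pi>]\<close>, hence the ceiling minus one\<close>
  define n where "n = nat (\<lceil>2 * \<phi> / pi\<rceil> - 1)"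
  define \<eta> where "\<eta> = 2 * \<phi> - pi * of_nat n"
  have "2 * \<phi> / pi > 0" using \<phi> by simp
  then have "\<lceil>2 * \<phi> / pi\<rceil> \<ge> 1" by linarith
  then have n: "real n = of_int \<lceil>2 * \<phi> / pi\<rceil> - 1" unfolding n_def by simp
  have "real n < 2 * \<phi> / pi" "2 * \<phi> / pi \<le> real n + 1" unfolding n by linarith+
  then have "real n * pi < 2 * \<phi>" "2 * \<phi> \<le> (real n + 1) * pi"
    by (simp_all only: pos_less_divide_eq[OF pi_gt_zero] pos_divide_le_eq[OF pi_gt_zero])
  then have \<eta>: "0 < \<eta>" "\<eta> \<le> pi" unfolding \<eta>_def by (simp_all add: algebra_simps)
  have "tau_fun m (2 * \<phi>) = tau_fun m \<eta> + of_int (- 2 * int n)"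
    using tau_fun_shift[OF m, of \<eta> n] \<eta> unfolding \<eta>_def by simp
  then have "std_lattice (tau_fun m (2 * \<phi>)) = std_lattice (tau_fun m \<eta>)" using std_lattice_shift by metis
  then have iso: "lattice_iso (Gamma_tilde a) (std_lattice (tau_fun m \<eta>))"
    using Gamma_iso_std_lattice[OF r \<phi>] unfolding a' m_def by simp
  obtain \<tau> where \<tau>: "\<tau> \<in> fund_domain" "\<bar>Re \<tau>\<bar> < 1/2 \<or> cmod \<tau> > 1" "lattice_iso (std_lattice (tau_fun m \<eta>)) (std_lattice \<tau>)"
    using region_representative[OF tau_fun_in_region[OF m \<eta>]] .
  have t: "t = moduli_point \<tau>" unfolding a(2)
    by (rule T_map_eq_moduli_point[OF \<tau>(1) lattice_iso_trans[OF iso \<tau>(3)]])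
  have "(\<tau>, \<tau>) \<in> fund_rel" using \<tau>(1) unfolding fund_rel_def by auto
  then have "\<tau> \<in> t" unfolding t moduli_point_def by simp
  moreover have "t \<in> moduli_space" unfolding t moduli_point_def moduli_space_def using \<tau>(1) by (rule quotientI)
  moreover have "\<tau> \<notin> moduli_point \<rho>" if "Im \<rho> = sqrt 3 / 2" "\<bar>Re \<rho>\<bar> = 1/2" for \<rho>
  proof
    assume "\<tau> \<in> moduli_point \<rho>"
    then have "(\<rho>, \<tau>) \<in> fund_rel" unfolding moduli_point_def by simp
    then have "Im \<tau> = sqrt 3 / 2 \<and> \<bar>Re \<tau>\<bar> = 1/2" using fund_rel_invariants[of \<rho> \<tau>] that by simp
    then show False using excluded_point[OF \<tau>(1)] \<tau>(2) by blast
  qed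
  then have "\<tau> \<notin> moduli_point (Complex (1 / 2) (sqrt 3 / 2))" "\<tau> \<notin> moduli_point (Complex (- 1 / 2) (sqrt 3 / 2))" by simp_all
  ultimately show "t \<in> moduli_space - moduli_point ` {Complex (1 / 2) (sqrt 3 / 2), Complex (- 1 / 2) (sqrt 3 / 2)}"
    by blast
next
  fix t assume t: "t \<in> moduli_space - moduli_point ` {Complex (1 / 2) (sqrt 3 / 2), Complex (- 1 / 2) (sqrt 3 / 2)}"
  then obtain \<tau> where \<tau>: "\<tau> \<in> fund_domain" "t = moduli_point \<tau>"
    unfolding moduli_space_def moduli_point_def by (auto elim: quotientE)
  have "\<not> (\<bar>Re \<tau>\<bar> = 1/2 \<and> Im \<tau> = sqrt 3 / 2)"
  proof
    assume "\<bar>Re \<tau>\<bar> = 1/2 \<and> Im \<tau> = sqrt 3 / 2"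
    then have "\<tau> = Complex (1 / 2) (sqrt 3 / 2) \<or> \<tau> = Complex (- 1 / 2) (sqrt 3 / 2)"
      by (auto simp: complex_eq_iff abs_if split: if_splits)
    then show False using t \<tau>(2) by blast
  qed
  then have "\<bar>Re \<tau>\<bar> < 1/2 \<or> cmod \<tau> > 1" using excluded_point[OF \<tau>(1)] by blast
  then obtain j :: int where "- 2 \<le> Re (\<tau> + of_int j)" "Re (\<tau> + of_int j) < 0" "Im (\<tau> + of_int j) > 0"
    "(Re (\<tau> + of_int j) + 1)\<^sup>2 + (Im (\<tau> + of_int j))\<^sup>2 > 1"
    using fund_domain_in_region[OF \<tau>(1)] by blast
  then obtain m \<eta> where m: "m > 0" and \<eta>: "\<eta> > 0" and tau_fun: "tau_fun m \<eta> = Complex (Re (\<tau> + of_int j)) (Im (\<tau> + of_int j))"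
    by (rule tau_fun_onto_region)
  obtain r where r: "0 < r" "r < 1" "modulus r = m" using modulus_surj[OF m] .
  have "lattice_iso (Gamma_tilde (M22_param (r, \<eta> / 2))) (std_lattice (tau_fun m \<eta>))"
    using Gamma_iso_std_lattice[OF r(1,2), of "\<eta> / 2"] \<eta> r(3) by simp
  also have "std_lattice (tau_fun m \<eta>) = std_lattice \<tau>" unfolding tau_fun complex_surj by (rule std_lattice_shift)
  finally have "T_map (M22_param (r, \<eta> / 2)) = t" unfolding \<tau>(2) by (rule T_map_eq_moduli_point[OF \<tau>(1)])
  then show "t \<in> T_map ` M22" using M22_param_in_M22[OF r(1,2), of "\<eta> / 2"] by blast
qed

section \<open>Smoothness and the differential\<close>

text \<open>The ring of functions generated over the constants by \<open>G\<close>. If the partial derivatives of the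
  generators belong to it, it is a differential ring and all its elements are smooth.\<close>

inductive_set ring_of :: "('a \<Rightarrow> real) set \<Rightarrow> ('a \<Rightarrow> real) set" for G :: "('a \<Rightarrow> real) set" where
  gen: "g \<in> G \<Longrightarrow> g \<in> ring_of G"
| const: "(\<lambda>_. c) \<in> ring_of G"
| add: "f \<in> ring_of G \<Longrightarrow> g \<in> ring_of G \<Longrightarrow> (\<lambda>q. f q + g q) \<in> ring_of G"
| mult: "f \<in> ring_of G \<Longrightarrow> g \<in> ring_of G \<Longrightarrow> (\<lambda>q. f q * g q) \<in> ring_of G"

definition plane_derivs :: "(real \<times> real) set \<Rightarrow> (real \<times> real \<Rightarrow> real) set \<Rightarrow> (real \<times> real \<Rightarrow> real) \<Rightarrow> bool" where
  "plane_derivs U R f \<longleftrightarrow> (\<exists>f1\<in>R. \<exists>f2\<in>R. \<forall>q\<in>U. (f has_derivative (\<lambda>v. f1 q * fst v + f2 q * snd v)) (at q))"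

lemma plane_derivsI:
  assumes "fa \<in> R" "fb \<in> R" "\<And>q. q \<in> U \<Longrightarrow> (f has_derivative (\<lambda>v. fa q * fst v + fb q * snd v)) (at q)"
  shows "plane_derivs U R f"
  using assms unfolding plane_derivs_def by blast

lemma ring_of_derivs:
  assumes G: "\<And>g. g \<in> G \<Longrightarrow> plane_derivs U (ring_of G) g" and f: "f \<in> ring_of G"
  shows "plane_derivs U (ring_of G) f"
  using f
proof induction
  case (gen g)
  then show ?case by (rule G)
next
  case (const c)
  show ?case unfolding plane_derivs_def
    by (intro bexI[of _ "\<lambda>_. 0"] ballI ring_of.const) simp
next
  case (add f g)
  then obtain f1 f2 g1 g2 where R: "f1 \<in> ring_of G" "f2 \<in> ring_of G" "g1 \<in> ring_of G" "g2 \<in> ring_of G"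
    and D: "\<And>q. q \<in> U \<Longrightarrow> (f has_derivative (\<lambda>v. f1 q * fst v + f2 q * snd v)) (at q)"
      "\<And>q. q \<in> U \<Longrightarrow> (g has_derivative (\<lambda>v. g1 q * fst v + g2 q * snd v)) (at q)"
    unfolding plane_derivs_def by blast
  have der: "((\<lambda>q. f q + g q) has_derivative (\<lambda>v. (f1 q + g1 q) * fst v + (f2 q + g2 q) * snd v)) (at q)" if "q \<in> U" for q
    using has_derivative_add[OF D(1)[OF that] D(2)[OF that]] by (rule has_derivative_eq_rhs) (simp add: algebra_simps)
  show ?case by (rule plane_derivsI[OF ring_of.add[OF R(1,3)] ring_of.add[OF R(2,4)] der])
next
  case (mult f g)
  then obtain f1 f2 g1 g2 where R: "f1 \<in> ring_of G" "f2 \<in> ring_of G" "g1 \<in> ring_of G" "g2 \<in> ring_of G"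
    and D: "\<And>q. q \<in> U \<Longrightarrow> (f has_derivative (\<lambda>v. f1 q * fst v + f2 q * snd v)) (at q)"
      "\<And>q. q \<in> U \<Longrightarrow> (g has_derivative (\<lambda>v. g1 q * fst v + g2 q * snd v)) (at q)"
    unfolding plane_derivs_def by blast
  have der: "((\<lambda>q. f q * g q) has_derivative (\<lambda>v. (f q * g1 q + f1 q * g q) * fst v + (f q * g2 q + f2 q * g q) * snd v)) (at q)" if "q \<in> U" for q
    using has_derivative_mult[OF D(1)[OF that] D(2)[OF that]] by (rule has_derivative_eq_rhs) (simp add: algebra_simps)
  have mem: "(\<lambda>q. f q * g1 q + f1 q * g q) \<in> ring_of G" "(\<lambda>q. f q * g2 q + f2 q * g q) \<in> ring_of G"
    by (intro ring_of.add ring_of.mult R mult)+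
  show ?case by (rule plane_derivsI[OF mem der])
qed

lemma Cn_on_cong:
  assumes "open U" "\<And>x. x \<in> U \<Longrightarrow> f x = g x" "Cn_on n U f"
  shows "Cn_on n U g"
  using assms(2,3)
proof (induction n arbitrary: f g)
  case 0
  then show ?case using continuous_on_cong[of U U f g] by simp
next
  case (Suc n)
  have D: "(g has_derivative f') (at x)" if x: "x \<in> U" and "(f has_derivative f') (at x)" for x f'
    by (rule has_derivative_transform_within_open[OF that(2) assms(1) x]) (rule Suc.prems(1))
  have F: "frechet_derivative f (at x) = frechet_derivative g (at x)" "g differentiable (at x)" if "x \<in> U" for x
  proof -
    have "f differentiable (at x)" using Suc.prems(2) that by simp
    then have "(f has_derivative frechet_derivative f (at x)) (at x)" by (simp add: frechet_derivative_works)
    then have g: "(g has_derivative frechet_derivative f (at x)) (at x)" by (rule D[OF that])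
    then show "frechet_derivative f (at x) = frechet_derivative g (at x)" by (rule frechet_derivative_at)
    show "g differentiable (at x)" using g unfolding differentiable_def by blast
  qed
  have "Cn_on n U (\<lambda>x. frechet_derivative g (at x) v)" for v
    by (rule Suc.IH[of "\<lambda>x. frechet_derivative f (at x) v"]) (use F(1) Suc.prems(2) in auto)
  then show ?case using F(2) by simp
qed

text \<open>By induction on the order of differentiability, simultaneously for all members of the family.\<close>

lemma smooth_on_closed_family:
  fixes F :: "('a::real_normed_vector \<Rightarrow> 'b::real_normed_vector) set"
  assumes U: "open U"
    and D: "\<And>f. f \<in> F \<Longrightarrow> \<exists>f'. (\<forall>x\<in>U. (f has_derivative f' x) (at x)) \<and> (\<forall>v. (\<lambda>x. f' x v) \<in> F)"
    and f: "f \<in> F"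
  shows "smooth_on U f"
proof -
  have "Cn_on n U f" if "f \<in> F" for n f
    using that
  proof (induction n arbitrary: f)
    case 0
    from D[OF 0] obtain f' where "\<forall>x\<in>U. (f has_derivative f' x) (at x)" by blast
    then have "continuous_on U f" by (intro continuous_at_imp_continuous_on ballI) (auto intro: has_derivative_continuous)
    then show ?case by simp
  next
    case (Suc n)
    from D[OF Suc.prems] obtain f' where f': "\<And>x. x \<in> U \<Longrightarrow> (f has_derivative f' x) (at x)" "\<And>v. (\<lambda>x. f' x v) \<in> F" by blast
    have "Cn_on n U (\<lambda>x. frechet_derivative f (at x) v)" for v
      by (rule Cn_on_cong[OF U _ Suc.IH[OF f'(2)[of v]]]) (simp add: frechet_derivative_at[OF f'(1), symmetric])
    then show ?case using f'(1) by (auto simp: differentiable_def)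
  qed
  then show ?thesis using f unfolding smooth_on_def by blast
qed

text \<open>A part of the coordinate domain that meets every class of coordinates modulo \<open>\<phi> \<mapsto> \<phi> + \<pi>\<close> and on
  which \<open>axis_integral\<close> is differentiable in the angle.\<close>

definition positive_chart :: "(real \<times> real) set" where "positive_chart = {0<..<1} \<times> {0<..}"

definition chart_modulus :: "real \<times> real \<Rightarrow> real" where "chart_modulus q = modulus (fst q)"
definition chart_modulus_deriv :: "real \<times> real \<Rightarrow> real" where "chart_modulus_deriv q = (1 - (1 / fst q) * (1 / fst q)) / 4"
definition chart_angle :: "real \<times> real \<Rightarrow> real" where "chart_angle q = 2 * snd q"

text \<open>The functions that occur in \<open>\<tau>\<close> and those needed to express their derivatives. Reciprocals are
  generators of their own, because the ring has no division.\<close>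

definition tau_generators :: "(real \<times> real \<Rightarrow> real) set" where
  "tau_generators = {(\<lambda>q. 1 / fst q), (\<lambda>q. period_ratio (chart_modulus q)), (\<lambda>q. 1 / chart_modulus q), (\<lambda>q. 1 / (1 + chart_modulus q)),
     (\<lambda>q. sin (chart_angle q)), (\<lambda>q. cos (chart_angle q)), (\<lambda>q. axis_root (chart_modulus q) (chart_angle q)), (\<lambda>q. 1 / axis_root (chart_modulus q) (chart_angle q)),
     (\<lambda>q. axis_integral (chart_modulus q) (chart_angle q)), (\<lambda>q. 1 / circle_period (chart_modulus q)), fst}"

lemma chart_modulus_pos: "q \<in> positive_chart \<Longrightarrow> chart_modulus q > 0" unfolding positive_chart_def chart_modulus_def by (auto intro: modulus_pos)
lemma chart_angle_pos: "q \<in> positive_chart \<Longrightarrow> chart_angle q > 0" unfolding positive_chart_def chart_angle_def by auto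

lemma D_chart_modulus: assumes "q \<in> positive_chart" shows "(chart_modulus has_derivative (\<lambda>v. chart_modulus_deriv q * fst v)) (at q)"
proof -
  have r: "fst q > 0" using assms unfolding positive_chart_def by auto
  have "(modulus has_real_derivative (1 - (1 / fst q) * (1 / fst q)) / 4) (at (fst q))"
  proof -
    have "modulus x = (1 / x + x - 2) / 4" if "x > 0" for x unfolding modulus_def using that by (simp add: field_simps power2_eq_square)
    moreover have "((\<lambda>x. (1 / x + x - 2) / 4) has_real_derivative (1 - (1 / fst q) * (1 / fst q)) / 4) (at (fst q))"
    proof -
      have "((\<lambda>x. (1 / x + x - 2) / 4) has_real_derivative ((0 * fst q - 1 * 1) / (fst q * fst q) + 1 - 0) / 4) (at (fst q))"
        using r by (intro DERIV_cdivide DERIV_diff DERIV_add DERIV_divide DERIV_const DERIV_ident) simp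
      then show ?thesis by simp
    qed
    ultimately show ?thesis using r
      by (intro has_field_derivative_transform_within_open[of "\<lambda>x. (1 / x + x - 2) / 4" _ _ "{0<..}" modulus]) auto
  qed
  from has_derivative_compose[OF has_derivative_fst[OF has_derivative_ident] this[unfolded has_field_derivative_def]]
  show ?thesis unfolding chart_modulus_def[abs_def] chart_modulus_deriv_def .
qed

lemma D_of_chart_modulus:
  assumes "q \<in> positive_chart" "(F has_real_derivative F') (at (chart_modulus q))"
  shows "((\<lambda>q. F (chart_modulus q)) has_derivative (\<lambda>v. (F' * chart_modulus_deriv q) * fst v + 0 * snd v)) (at q)"
  using has_derivative_compose[OF D_chart_modulus[OF assms(1)] assms(2)[unfolded has_field_derivative_def]]
  by (rule has_derivative_eq_rhs) (simp add: mult.assoc)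

lemma D_chart_angle: "(chart_angle has_derivative (\<lambda>v. 2 * snd v)) (at q)"
  unfolding chart_angle_def[abs_def] by (auto intro!: derivative_eq_intros)

lemma D_pair: assumes "q \<in> positive_chart" shows "((\<lambda>q. (chart_modulus q, chart_angle q)) has_derivative (\<lambda>v. (chart_modulus_deriv q * fst v, 2 * snd v))) (at q)"
  by (intro has_derivative_Pair D_chart_modulus D_chart_angle assms)

lemma D_axis_integral:
  assumes q: "q \<in> positive_chart"
  shows "((\<lambda>q. axis_integral (chart_modulus q) (chart_angle q)) has_derivative
    (\<lambda>v. (log_deriv (chart_modulus q) * (axis_integral (chart_modulus q) (chart_angle q) + sin (chart_angle q) * cos (chart_angle q) / axis_root (chart_modulus q) (chart_angle q)) * chart_modulus_deriv q) * fst v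
      + ((chart_modulus q - period_ratio (chart_modulus q) + (sin (chart_angle q))\<^sup>2) / axis_root (chart_modulus q) (chart_angle q) * 2) * snd v)) (at q)"
  using has_derivative_compose[OF D_pair[OF q] axis_integral_total_derivative[OF chart_modulus_pos[OF q] chart_angle_pos[OF q]]]
  unfolding split_beta fst_conv snd_conv by (rule has_derivative_eq_rhs) (simp add: fun_eq_iff mult.assoc)

lemma D_axis_root:
  assumes q: "q \<in> positive_chart"
  shows "((\<lambda>q. axis_root (chart_modulus q) (chart_angle q)) has_derivative
    (\<lambda>v. (1 / 2 * (1 / axis_root (chart_modulus q) (chart_angle q)) * chart_modulus_deriv q) * fst v
      + (2 * sin (chart_angle q) * cos (chart_angle q) * (1 / axis_root (chart_modulus q) (chart_angle q))) * snd v)) (at q)"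
proof -
  have p: "chart_modulus q + (sin (chart_angle q))\<^sup>2 > 0" by (rule sum_sq_pos[OF chart_modulus_pos[OF q]])
  have "((\<lambda>q. sin (chart_angle q)) has_derivative (\<lambda>v. cos (chart_angle q) * (2 * snd v))) (at q)"
    using has_derivative_compose[OF D_chart_angle DERIV_sin[unfolded has_field_derivative_def]] .
  from has_derivative_add[OF D_chart_modulus[OF q] has_derivative_mult[OF this this]]
  have "((\<lambda>q. chart_modulus q + (sin (chart_angle q))\<^sup>2) has_derivative (\<lambda>v. chart_modulus_deriv q * fst v + (sin (chart_angle q) * (cos (chart_angle q) * (2 * snd v)) + cos (chart_angle q) * (2 * snd v) * sin (chart_angle q)))) (at q)"
    unfolding power2_eq_square .
  from has_derivative_compose[OF this DERIV_real_sqrt[OF p, unfolded has_field_derivative_def]]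
  moreover have "inverse w / 2 * (m' * a + (s * (c * (2 * b)) + c * (2 * b) * s)) = (1 / 2 * (1 / w) * m') * a + (2 * s * c * (1 / w)) * b"
    for w m' a s c b :: real by (cases "w = 0") (simp_all add: field_simps)
  ultimately show ?thesis unfolding axis_root_def by (simp only:)
qed

lemma D_inverse:
  assumes f: "(f has_derivative (\<lambda>v. a * fst v + b * snd v)) (at (q :: real \<times> real))" and nz: "f q \<noteq> (0 :: real)"
  shows "((\<lambda>q. 1 / f q) has_derivative (\<lambda>v. (- 1 * ((1 / f q) * (1 / f q)) * a) * fst v + (- 1 * ((1 / f q) * (1 / f q)) * b) * snd v)) (at q)"
  using has_derivative_divide'[OF has_derivative_const[of 1] f nz]
  by (rule has_derivative_eq_rhs) (use nz in \<open>simp add: fun_eq_iff field_simps\<close>)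

lemmas ringI = ring_of.add ring_of.mult ring_of.const

lemma tau_generators_in_ring:
  "(\<lambda>q. 1 / fst q) \<in> ring_of tau_generators" "(\<lambda>q. period_ratio (chart_modulus q)) \<in> ring_of tau_generators" "(\<lambda>q. 1 / chart_modulus q) \<in> ring_of tau_generators"
  "(\<lambda>q. 1 / (1 + chart_modulus q)) \<in> ring_of tau_generators" "(\<lambda>q. sin (chart_angle q)) \<in> ring_of tau_generators" "(\<lambda>q. cos (chart_angle q)) \<in> ring_of tau_generators"
  "(\<lambda>q. axis_root (chart_modulus q) (chart_angle q)) \<in> ring_of tau_generators" "(\<lambda>q. 1 / axis_root (chart_modulus q) (chart_angle q)) \<in> ring_of tau_generators"
  "(\<lambda>q. axis_integral (chart_modulus q) (chart_angle q)) \<in> ring_of tau_generators" "(\<lambda>q. 1 / circle_period (chart_modulus q)) \<in> ring_of tau_generators" "(\<lambda>q. fst q) \<in> ring_of tau_generators"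
  by (rule ring_of.gen, simp add: tau_generators_def)+

lemma chart_modulus_deriv_in_ring: "chart_modulus_deriv \<in> ring_of tau_generators"
proof -
  have "(\<lambda>q. (1 + - 1 * ((1 / fst q) * (1 / fst q))) * (1 / 4)) \<in> ring_of tau_generators" by (intro ringI tau_generators_in_ring)
  moreover have "(\<lambda>q. (1 + - 1 * ((1 / fst q) * (1 / fst q))) * (1 / 4)) = chart_modulus_deriv" by (simp add: fun_eq_iff chart_modulus_deriv_def)
  ultimately show ?thesis by simp
qed

lemma log_deriv_in_ring: "(\<lambda>q. log_deriv (chart_modulus q)) \<in> ring_of tau_generators"
proof -
  have "(\<lambda>q. (1 / 2) * (period_ratio (chart_modulus q) * ((1 / chart_modulus q) * (1 / (1 + chart_modulus q))))) \<in> ring_of tau_generators" by (intro ringI tau_generators_in_ring)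
  then show ?thesis unfolding log_deriv_def by (simp add: mult_ac)
qed

text \<open>The modulus \<open>(1 - r)\<^sup>2 / (4 r) = (1 / r + r - 2) / 4\<close> as an element of the ring, which agrees
  with \<open>chart_modulus\<close> where \<open>r \<noteq> 0\<close>.\<close>

definition chart_modulus_rat :: "real \<times> real \<Rightarrow> real" where "chart_modulus_rat q = (1 / fst q + (fst q + - 2)) * (1 / 4)"

lemma chart_modulus_rat_in_ring: "chart_modulus_rat \<in> ring_of tau_generators"
  unfolding chart_modulus_rat_def[abs_def] by (intro ringI tau_generators_in_ring)

lemma chart_modulus_rat_eq: "q \<in> positive_chart \<Longrightarrow> chart_modulus_rat q = chart_modulus q"
  unfolding chart_modulus_rat_def chart_modulus_def modulus_def positive_chart_def by (auto simp: field_simps power2_eq_square)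

lemma tau_generators_derivs:
  assumes "g \<in> tau_generators"
  shows "plane_derivs positive_chart (ring_of tau_generators) g"
proof -
  let ?R = "ring_of tau_generators"
  have mqR: "(\<lambda>q. f q * chart_modulus_deriv q) \<in> ?R" if "f \<in> ?R" for f using ring_of.mult[OF that chart_modulus_deriv_in_ring] .
  have g1: "plane_derivs positive_chart ?R (\<lambda>q. 1 / fst q)"
  proof (rule plane_derivsI[where fa = "\<lambda>q. - 1 * ((1 / fst q) * (1 / fst q)) * 1" and fb = "\<lambda>q. - 1 * ((1 / fst q) * (1 / fst q)) * 0"])
    fix q assume "q \<in> positive_chart"
    then have "fst q \<noteq> 0" unfolding positive_chart_def by auto
    moreover have "(fst has_derivative (\<lambda>v. 1 * fst v + 0 * snd v)) (at q)" by (auto intro!: derivative_eq_intros)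
    ultimately show "((\<lambda>q. 1 / fst q) has_derivative (\<lambda>v. (- 1 * ((1 / fst q) * (1 / fst q)) * 1) * fst v + (- 1 * ((1 / fst q) * (1 / fst q)) * 0) * snd v)) (at q)"
      by (intro D_inverse)
  qed (intro ringI tau_generators_in_ring)+
  have g2: "plane_derivs positive_chart ?R (\<lambda>q. period_ratio (chart_modulus q))"
  proof (rule plane_derivsI[where fa = "\<lambda>q. (1/2 + (period_ratio (chart_modulus q) * period_ratio (chart_modulus q)) * ((1/2) * ((1 / chart_modulus q) * (1 / (1 + chart_modulus q))))) * chart_modulus_deriv q" and fb = "\<lambda>_. 0"])
    fix q assume q: "q \<in> positive_chart"
    have "(period_ratio (chart_modulus q))\<^sup>2 / (2 * chart_modulus q * (1 + chart_modulus q)) = (period_ratio (chart_modulus q) * period_ratio (chart_modulus q)) * ((1/2) * ((1 / chart_modulus q) * (1 / (1 + chart_modulus q))))"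
      by (simp add: power2_eq_square)
    then show "((\<lambda>q. period_ratio (chart_modulus q)) has_derivative (\<lambda>v. ((1/2 + (period_ratio (chart_modulus q) * period_ratio (chart_modulus q)) * ((1/2) * ((1 / chart_modulus q) * (1 / (1 + chart_modulus q))))) * chart_modulus_deriv q) * fst v + 0 * snd v)) (at q)"
      using D_of_chart_modulus[OF q DERIV_period_ratio[OF chart_modulus_pos[OF q]]] by simp
  qed (intro mqR ringI tau_generators_in_ring)+
  have g3: "plane_derivs positive_chart ?R (\<lambda>q. 1 / chart_modulus q)"
  proof (rule plane_derivsI[where fa = "\<lambda>q. - 1 * ((1 / chart_modulus q) * (1 / chart_modulus q)) * chart_modulus_deriv q" and fb = "\<lambda>q. - 1 * ((1 / chart_modulus q) * (1 / chart_modulus q)) * 0"])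
    fix q assume q: "q \<in> positive_chart"
    have "(chart_modulus has_derivative (\<lambda>v. chart_modulus_deriv q * fst v + 0 * snd v)) (at q)" using D_chart_modulus[OF q] by simp
    then show "((\<lambda>q. 1 / chart_modulus q) has_derivative (\<lambda>v. (- 1 * ((1 / chart_modulus q) * (1 / chart_modulus q)) * chart_modulus_deriv q) * fst v + (- 1 * ((1 / chart_modulus q) * (1 / chart_modulus q)) * 0) * snd v)) (at q)"
      by (rule D_inverse) (use chart_modulus_pos[OF q] in simp)
  qed (intro mqR ringI tau_generators_in_ring)+
  have g4: "plane_derivs positive_chart ?R (\<lambda>q. 1 / (1 + chart_modulus q))"
  proof (rule plane_derivsI[where fa = "\<lambda>q. - 1 * ((1 / (1 + chart_modulus q)) * (1 / (1 + chart_modulus q))) * chart_modulus_deriv q" and fb = "\<lambda>q. - 1 * ((1 / (1 + chart_modulus q)) * (1 / (1 + chart_modulus q))) * 0"])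
    fix q assume q: "q \<in> positive_chart"
    have "((\<lambda>q. 1 + chart_modulus q) has_derivative (\<lambda>v. chart_modulus_deriv q * fst v + 0 * snd v)) (at q)"
      using has_derivative_add[OF has_derivative_const[of 1] D_chart_modulus[OF q]] by simp
    then show "((\<lambda>q. 1 / (1 + chart_modulus q)) has_derivative (\<lambda>v. (- 1 * ((1 / (1 + chart_modulus q)) * (1 / (1 + chart_modulus q))) * chart_modulus_deriv q) * fst v + (- 1 * ((1 / (1 + chart_modulus q)) * (1 / (1 + chart_modulus q))) * 0) * snd v)) (at q)"
      by (rule D_inverse) (use chart_modulus_pos[OF q] in simp)
  qed (intro mqR ringI tau_generators_in_ring)+
  have g5: "plane_derivs positive_chart ?R (\<lambda>q. sin (chart_angle q))"
  proof (rule plane_derivsI[where fa = "\<lambda>_. 0" and fb = "\<lambda>q. cos (chart_angle q) * 2"])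
    fix q
    show "((\<lambda>q. sin (chart_angle q)) has_derivative (\<lambda>v. 0 * fst v + (cos (chart_angle q) * 2) * snd v)) (at q)"
      using has_derivative_compose[OF D_chart_angle DERIV_sin[unfolded has_field_derivative_def]] by (simp add: mult.assoc)
  qed (intro ringI tau_generators_in_ring)+
  have g6: "plane_derivs positive_chart ?R (\<lambda>q. cos (chart_angle q))"
  proof (rule plane_derivsI[where fa = "\<lambda>_. 0" and fb = "\<lambda>q. (- 1 * sin (chart_angle q)) * 2"])
    fix q
    show "((\<lambda>q. cos (chart_angle q)) has_derivative (\<lambda>v. 0 * fst v + ((- 1 * sin (chart_angle q)) * 2) * snd v)) (at q)"
      using has_derivative_compose[OF D_chart_angle DERIV_cos[unfolded has_field_derivative_def]] by (simp add: mult.assoc)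
  qed (intro ringI tau_generators_in_ring)+
  have g7: "plane_derivs positive_chart ?R (\<lambda>q. axis_root (chart_modulus q) (chart_angle q))"
    by (rule plane_derivsI[OF _ _ D_axis_root]) (intro mqR ringI tau_generators_in_ring)+
  have g8: "plane_derivs positive_chart ?R (\<lambda>q. 1 / axis_root (chart_modulus q) (chart_angle q))"
    by (rule plane_derivsI[OF _ _ D_inverse[OF D_axis_root]]) (intro mqR ringI tau_generators_in_ring chart_modulus_deriv_in_ring | simp add: axis_root_nz chart_modulus_pos)+
  have g9: "plane_derivs positive_chart ?R (\<lambda>q. axis_integral (chart_modulus q) (chart_angle q))"
  proof (rule plane_derivsI[where fa = "\<lambda>q. (log_deriv (chart_modulus q) * (axis_integral (chart_modulus q) (chart_angle q) + sin (chart_angle q) * (cos (chart_angle q) * (1 / axis_root (chart_modulus q) (chart_angle q))))) * chart_modulus_deriv q"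
      and fb = "\<lambda>q. (chart_modulus_rat q + - 1 * period_ratio (chart_modulus q) + sin (chart_angle q) * sin (chart_angle q)) * ((1 / axis_root (chart_modulus q) (chart_angle q)) * 2)"])
    fix q assume q: "q \<in> positive_chart"
    show "((\<lambda>q. axis_integral (chart_modulus q) (chart_angle q)) has_derivative
      (\<lambda>v. ((log_deriv (chart_modulus q) * (axis_integral (chart_modulus q) (chart_angle q) + sin (chart_angle q) * (cos (chart_angle q) * (1 / axis_root (chart_modulus q) (chart_angle q))))) * chart_modulus_deriv q) * fst v
        + ((chart_modulus_rat q + - 1 * period_ratio (chart_modulus q) + sin (chart_angle q) * sin (chart_angle q)) * ((1 / axis_root (chart_modulus q) (chart_angle q)) * 2)) * snd v)) (at q)"
      using D_axis_integral[OF q] unfolding chart_modulus_rat_eq[OF q] by (simp add: power2_eq_square)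
  qed (intro mqR ringI tau_generators_in_ring log_deriv_in_ring chart_modulus_rat_in_ring)+
  have g10: "plane_derivs positive_chart ?R (\<lambda>q. 1 / circle_period (chart_modulus q))"
  proof (rule plane_derivsI[where fa = "\<lambda>q. (- 1 * (log_deriv (chart_modulus q) * (1 / circle_period (chart_modulus q)))) * chart_modulus_deriv q" and fb = "\<lambda>_. 0"])
    fix q assume q: "q \<in> positive_chart"
    have L: "circle_period (chart_modulus q) \<noteq> 0" using circle_period_pos[OF chart_modulus_pos[OF q]] by simp
    have "((\<lambda>m. 1 / circle_period m) has_real_derivative (0 * circle_period (chart_modulus q) - 1 * (log_deriv (chart_modulus q) * circle_period (chart_modulus q))) / (circle_period (chart_modulus q) * circle_period (chart_modulus q))) (at (chart_modulus q))"
      by (intro DERIV_divide DERIV_const DERIV_circle_period chart_modulus_pos q L)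
    also have "(0 * circle_period (chart_modulus q) - 1 * (log_deriv (chart_modulus q) * circle_period (chart_modulus q))) / (circle_period (chart_modulus q) * circle_period (chart_modulus q)) = - 1 * (log_deriv (chart_modulus q) * (1 / circle_period (chart_modulus q)))"
      using L by simp
    finally show "((\<lambda>q. 1 / circle_period (chart_modulus q)) has_derivative (\<lambda>v. ((- 1 * (log_deriv (chart_modulus q) * (1 / circle_period (chart_modulus q)))) * chart_modulus_deriv q) * fst v + 0 * snd v)) (at q)"
      by (rule D_of_chart_modulus[OF q])
  qed (intro mqR ringI tau_generators_in_ring log_deriv_in_ring)+
  have g11: "plane_derivs positive_chart ?R fst"
    by (rule plane_derivsI[where fa = "\<lambda>_. 1" and fb = "\<lambda>_. 0"]) (auto intro!: derivative_eq_intros ring_of.const)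
  show ?thesis using assms g1 g2 g3 g4 g5 g6 g7 g8 g9 g10 g11 unfolding tau_generators_def by (elim insertE) simp_all
qed

definition chart_tau :: "real \<times> real \<Rightarrow> complex" where "chart_tau q = tau_fun (chart_modulus q) (chart_angle q)"

lemma has_derivative_Complex:
  assumes "(f has_derivative f') F" "(g has_derivative g') F"
  shows "((\<lambda>x. Complex (f x) (g x)) has_derivative (\<lambda>v. Complex (f' v) (g' v))) F"
  unfolding Complex_eq by (intro has_derivative_add has_derivative_mult_right has_derivative_of_real assms)

lemma open_positive_chart: "open positive_chart" unfolding positive_chart_def by (intro open_Times) auto

lemma chart_tau_smooth: "smooth_on positive_chart chart_tau"
proof -
  let ?R = "ring_of tau_generators"
  let ?F = "{(\<lambda>q. Complex (f q) (g q)) | f g. f \<in> ?R \<and> g \<in> ?R}"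
  show ?thesis
  proof (rule smooth_on_closed_family[OF open_positive_chart, where F = ?F])
    fix c assume "c \<in> ?F"
    then obtain f g where c: "c = (\<lambda>q. Complex (f q) (g q))" "f \<in> ?R" "g \<in> ?R" by blast
    obtain f1 f2 where f: "f1 \<in> ?R" "f2 \<in> ?R" "\<And>q. q \<in> positive_chart \<Longrightarrow> (f has_derivative (\<lambda>v. f1 q * fst v + f2 q * snd v)) (at q)"
      using ring_of_derivs[OF tau_generators_derivs c(2)] unfolding plane_derivs_def by blast
    obtain g1 g2 where g: "g1 \<in> ?R" "g2 \<in> ?R" "\<And>q. q \<in> positive_chart \<Longrightarrow> (g has_derivative (\<lambda>v. g1 q * fst v + g2 q * snd v)) (at q)"
      using ring_of_derivs[OF tau_generators_derivs c(3)] unfolding plane_derivs_def by blast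
    let ?c' = "\<lambda>q v. Complex (f1 q * fst v + f2 q * snd v) (g1 q * fst v + g2 q * snd v)"
    have A: "\<forall>q\<in>positive_chart. (c has_derivative ?c' q) (at q)" unfolding c(1) using has_derivative_Complex[OF f(3) g(3)] by blast
    have B: "(\<lambda>q. ?c' q v) \<in> ?F" for v
    proof -
      have "(\<lambda>q. f1 q * fst v + f2 q * snd v) \<in> ?R" "(\<lambda>q. g1 q * fst v + g2 q * snd v) \<in> ?R"
        by (intro ring_of.add ring_of.mult ring_of.const f g)+
      then show ?thesis
        by (intro CollectI exI[of _ "\<lambda>q. f1 q * fst v + f2 q * snd v"] exI[of _ "\<lambda>q. g1 q * fst v + g2 q * snd v"]) simp
    qed
    show "\<exists>c'. (\<forall>x\<in>positive_chart. (c has_derivative c' x) (at x)) \<and> (\<forall>v. (\<lambda>x. c' x v) \<in> ?F)"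
      by (rule exI[of _ ?c'], rule conjI[OF A], rule allI, rule B)
  next
    have "(\<lambda>q. - 2 * (axis_integral (chart_modulus q) (chart_angle q) * (1 / circle_period (chart_modulus q)))) \<in> ?R" "(\<lambda>q. 2 * (axis_root (chart_modulus q) (chart_angle q) * (1 / circle_period (chart_modulus q)))) \<in> ?R"
      by (intro ringI tau_generators_in_ring)+
    moreover have "chart_tau = (\<lambda>q. Complex (- 2 * (axis_integral (chart_modulus q) (chart_angle q) * (1 / circle_period (chart_modulus q)))) (2 * (axis_root (chart_modulus q) (chart_angle q) * (1 / circle_period (chart_modulus q)))))"
      unfolding chart_tau_def[abs_def] tau_fun_def by simp
    ultimately show "chart_tau \<in> ?F"
      by (intro CollectI exI[of _ "\<lambda>q. - 2 * (axis_integral (chart_modulus q) (chart_angle q) * (1 / circle_period (chart_modulus q)))"]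
        exI[of _ "\<lambda>q. 2 * (axis_root (chart_modulus q) (chart_angle q) * (1 / circle_period (chart_modulus q)))"] conjI)
  qed
qed

text \<open>The Jacobian determinant is a nonzero multiple of the bracket in \<open>log_deriv_identity\<close>.\<close>

lemma chart_tau_immersion:
  assumes q: "q \<in> positive_chart"
  shows "inj (frechet_derivative chart_tau (at q))"
proof -
  define m where "m = chart_modulus q"
  define t where "t = chart_angle q"
  define d where "d = axis_root m t"
  define L where "L = circle_period m"
  define s where "s = sin t"
  define c where "c = cos t"
  define D where "D = log_deriv m"
  define Q where "Q = m - period_ratio m + s\<^sup>2"
  have m: "m > 0" unfolding m_def by (rule chart_modulus_pos[OF q])
  have d: "d > 0" unfolding d_def by (rule axis_root_pos[OF m])
  have L: "L > 0" unfolding L_def by (rule circle_period_pos[OF m])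
  have L0: "circle_period (chart_modulus q) \<noteq> 0" using L unfolding L_def m_def by simp
  have m': "chart_modulus_deriv q \<noteq> 0"
  proof -
    have "fst q > 0" "fst q < 1" using q unfolding positive_chart_def by auto
    then have "1 / fst q > 1" by simp
    then have "(1 / fst q) * (1 / fst q) > 1" by (metis less_1_mult)
    moreover have "(1 - P) / 4 \<noteq> 0" if "P > 1" for P :: real using that by simp
    ultimately show ?thesis unfolding chart_modulus_deriv_def by blast
  qed
  have DL: "((\<lambda>q. circle_period (chart_modulus q)) has_derivative (\<lambda>v. (D * L * chart_modulus_deriv q) * fst v + 0 * snd v)) (at q)"
    unfolding D_def L_def m_def by (rule D_of_chart_modulus[OF q DERIV_circle_period[OF chart_modulus_pos[OF q]]])
  define A where "A = - 2 * D * s * c / (d * L) * chart_modulus_deriv q"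
  define B where "B = - 4 * Q / (d * L)"
  define C where "C = (1 - 2 * D * d\<^sup>2) / (d * L) * chart_modulus_deriv q"
  define E where "E = 4 * s * c / (d * L)"
  have "((\<lambda>q. - 2 * axis_integral (chart_modulus q) (chart_angle q) / circle_period (chart_modulus q)) has_derivative (\<lambda>v. A * fst v + B * snd v)) (at q)"
    using has_derivative_divide'[OF has_derivative_mult_right[OF D_axis_integral[OF q], of "- 2"] DL L0]
    unfolding m_def[symmetric] t_def[symmetric] d_def[symmetric] L_def[symmetric] s_def[symmetric] c_def[symmetric] D_def[symmetric] Q_def[symmetric]
    by (rule has_derivative_eq_rhs) (use d L in \<open>simp_all add: A_def B_def fun_eq_iff field_simps\<close>)
  moreover have "((\<lambda>q. 2 * axis_root (chart_modulus q) (chart_angle q) / circle_period (chart_modulus q)) has_derivative (\<lambda>v. C * fst v + E * snd v)) (at q)"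
    using has_derivative_divide'[OF has_derivative_mult_right[OF D_axis_root[OF q], of "2"] DL L0]
    unfolding m_def[symmetric] t_def[symmetric] d_def[symmetric] L_def[symmetric] s_def[symmetric] c_def[symmetric] D_def[symmetric] Q_def[symmetric]
    by (rule has_derivative_eq_rhs) (use d L in \<open>simp_all add: C_def E_def fun_eq_iff field_simps power2_eq_square\<close>)
  ultimately have "(chart_tau has_derivative (\<lambda>v. Complex (A * fst v + B * snd v) (C * fst v + E * snd v))) (at q)"
    unfolding chart_tau_def[abs_def] tau_fun_def by (rule has_derivative_Complex)
  then have F: "frechet_derivative chart_tau (at q) = (\<lambda>v. Complex (A * fst v + B * snd v) (C * fst v + E * snd v))"
    by (rule frechet_derivative_at[symmetric])
  have "B * C - A * E = - 4 * chart_modulus_deriv q / (d * L)\<^sup>2 * (Q * (1 - 2 * D * d\<^sup>2) - 2 * D * s\<^sup>2 * c\<^sup>2)"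
    unfolding A_def B_def C_def E_def using d L by (simp add: divide_simps) (simp add: algebra_simps power2_eq_square)
  also have "Q * (1 - 2 * D * d\<^sup>2) - 2 * D * s\<^sup>2 * c\<^sup>2 = (m - period_ratio m) * (1 + m - period_ratio m) * d\<^sup>2 / (m * (1 + m))"
    unfolding Q_def D_def d_def s_def c_def by (rule log_deriv_identity[OF m])
  finally have det: "B * C - A * E \<noteq> 0" using m m' d L period_ratio_bounds[OF m] by simp
  have "v = w" if "A * fst v + B * snd v = A * fst w + B * snd w" "C * fst v + E * snd v = C * fst w + E * snd w" for v w :: "real \<times> real"
  proof -
    have 1: "A * (fst v - fst w) + B * (snd v - snd w) = 0" "C * (fst v - fst w) + E * (snd v - snd w) = 0"
      using that by (simp_all add: algebra_simps)
    have "(B * C - A * E) * (fst v - fst w) = B * (C * (fst v - fst w) + E * (snd v - snd w)) - E * (A * (fst v - fst w) + B * (snd v - snd w))"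
      "(B * C - A * E) * (snd v - snd w) = C * (A * (fst v - fst w) + B * (snd v - snd w)) - A * (C * (fst v - fst w) + E * (snd v - snd w))"
      by (simp_all add: algebra_simps)
    then have "fst v - fst w = 0" "snd v - snd w = 0" using det unfolding 1 by simp_all
    then show ?thesis by (simp add: prod_eq_iff)
  qed
  then show ?thesis unfolding F by (intro injI) (simp add: complex_eq_iff)
qed

lemma T_immersion:
  assumes "a \<in> M22"
  shows "T_immersion_at a"
proof -
  obtain r \<phi> where r: "0 < r" "r < 1" "\<phi> > 0" "a = M22_param (r, \<phi>)" using M22_positive_angle[OF assms] .
  have "lattice_iso (Gamma_tilde (M22_param q)) (std_lattice (chart_tau q)) \<and> Im (chart_tau q) > 0" if q: "q \<in> positive_chart" for q
  proof -
    obtain r \<phi> where [simp]: "q = (r, \<phi>)" by (cases q)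
    have "0 < r" "r < 1" "\<phi> > 0" using q unfolding positive_chart_def by auto
    then show ?thesis using Gamma_iso_std_lattice axis_root_pos circle_period_pos chart_modulus_pos[OF q] unfolding chart_tau_def chart_modulus_def chart_angle_def tau_fun_def by simp
  qed
  moreover have "positive_chart \<subseteq> M22_coords" unfolding positive_chart_def M22_coords_def by auto
  moreover have "(r, \<phi>) \<in> positive_chart" unfolding positive_chart_def using r by simp
  ultimately show ?thesis unfolding T_immersion_at_def
    using open_positive_chart chart_tau_smooth chart_tau_immersion r(4) by (intro bexI[of _ "(r, \<phi>)"] conjI exI[of _ positive_chart] exI[of _ chart_tau]) auto
qed

theorem theorem4p1:
  shows "T_map ` M22 =
      moduli_space - moduli_point ` {Complex (1 / 2) (sqrt 3 / 2), Complex (- 1 / 2) (sqrt 3 / 2)}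
    \<and> (\<forall>a\<in>M22. T_immersion_at a)"
  using T_map_image T_immersion by blast

end
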